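(* Let $\mathcal{C}^{\bullet}$ be a subcritical family of labelled rooted connected graphs, and let $R_n$ be a uniformly random element of $\mathcal{C}^{\bullet}$ with $n$ vertices. Then $R_n$ converges weakly, as $n\to\infty$, to a random infinite rooted graph that can be described as follows: (i) the root is the source of a first $2$-ended link $L_1\in\mathcal{L}$, chosen randomly according to the probability measure $p_{\mathcal{L}}$; (ii) for every $j\in\mathbb{N}$, $j \geq 1$, the sink of $L_j$ is identified with the source of a $2$-ended link $L_{j+1}\in\mathcal{L}$, again chosen randomly according to $p_{\mathcal{L}}$; (iii) the result is an infinite chain of $2$-ended links $L_1,L_2,\ldots$, where the choices are independent.
   Context: Graph classes consist of finite simple graphs and are closed under isomorphism. A block of a graph is a maximal $2$-connected subgraph, where $K_2$ counts as $2$-connected (so the one-vertex graph has no blocks). A class $\mathcal{G}$ of graphs is block-stable if it contains $K_2$ and a graph belongs to $\mathcal{G}$ if and only if each of its blocks belongs to $\mathcal{G}$. Let $\mathcal{C}$ be the class of connected graphs in $\mathcal{G}$ and $\mathcal{B}$ the class of blocks ($2$-connected graphs, including $K_2$) in $\mathcal{G}$. Labelled setting: graphs on $n$ vertices are labelled by $\{1,\ldots,n\}$. Let $C(z)$ and $B(z)$ be the exponential generating functions of the labelled graphs in $\mathcal{C}$ and $\mathcal{B}$, and let $C^{\bullet}(z)=zC'(z)$, the exponential generating function of the class $\mathcal{C}^{\bullet}$ of graphs in $\mathcal{C}$ with a distinguished root vertex; it satisfies $C^{\bullet}(z)=z\exp(B'(C^{\bullet}(z)))$. Let $\rho$ and $\eta$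 be the radii of convergence of $C(z)$ and $B(y)$ respectively. The class is called subcritical if $C^{\bullet}(\rho)<\eta$; a "subcritical family of labelled rooted connected graphs" is the class $\mathcal{C}^{\bullet}$ arising from such a block-stable class. A $2$-ended link is a graph in $\mathcal{G}$ obtained from a block $B\in\mathcal{B}$ with two distinct distinguished vertices, called the source $s$ and the sink $t$, by identifying each vertex of $B$ except the sink with the root of some graph in $\mathcal{C}^{\bullet}$. Let $\mathcal{L}$ be the set of all unlabelled $2$-ended links (up to isomorphism preserving source and sink). For $L\in\mathcal{L}$, let $|L|$ be the number of vertices of $L$ other than the sink, let $\ell(L)$ be the number of non-isomorphic labellings of $L$ in which all vertices except the sink are labelled (by $1,\ldots,|L|$), and let $p_{\mathcal{L}}(L)=\ell(L)\rho^{|L|}/|L|!$. This defines a probability measure on $\mathcal{L}$. A sequence of random rooted graphs $(R_n)$ converges weakly to a random locally finite rooted graph $R$ if for every $r\in\mathbb{N}$ the ball of radius $r$ in $R_n$ centred at its root, considered up to isomorphism of rooted (unlabelled) graphs, converges in distribution to the ball of radius $r$ in $R$ centred at its root. *)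

theory Defs
  imports "HOL-Probability.Probability"
begin

section \<open>Simple graphs\<close>

datatype 'v graph = Graph (verts: "'v set") (edges: "'v set set")

definition sgraph :: "'v graph \<Rightarrow> bool" where
  "sgraph G \<longleftrightarrow> (\<forall>e\<in>edges G. e \<subseteq> verts G \<and> card e = 2)"

definition fin_sgraph :: "'v graph \<Rightarrow> bool" where
  "fin_sgraph G \<longleftrightarrow> sgraph G \<and> finite (verts G)"

definition locally_finite :: "'v graph \<Rightarrow> bool" where
  "locally_finite G \<longleftrightarrow> (\<forall>v\<in>verts G. finite {e \<in> edges G. v \<in> e})"

definition adj :: "'v graph \<Rightarrow> ('v \<times> 'v) set" where
  "adj G = {(u, v). {u, v} \<in> edges G}"

definition gconnected :: "'v graph \<Rightarrow> bool" where
  "gconnected G \<longleftrightarrow> verts G \<noteq> {} \<and> (\<forall>u\<in>verts G. \<forall>v\<in>verts G. (u, v) \<in> (adj G)\<^sup>*)"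

definition subgraph :: "'v graph \<Rightarrow> 'v graph \<Rightarrow> bool" where
  "subgraph H G \<longleftrightarrow> sgraph H \<and> verts H \<subseteq> verts G \<and> edges H \<subseteq> edges G"

definition induced :: "'v graph \<Rightarrow> 'v set \<Rightarrow> 'v graph" where
  "induced G S = Graph (verts G \<inter> S) {e \<in> edges G. e \<subseteq> S}"

text \<open>With the bound 2 on the number of vertices (instead of 3) this notion includes $K_2$ and
  excludes $K_1$.\<close>

definition two_connected :: "'v graph \<Rightarrow> bool" where
  "two_connected G \<longleftrightarrow> card (verts G) \<ge> 2 \<and> gconnected G \<and>
     (\<forall>v\<in>verts G. gconnected (induced G (verts G - {v})))"

definition is_block_of :: "'v graph \<Rightarrow> 'v graph \<Rightarrow> bool" where
  "is_block_of H G \<longleftrightarrow> subgraph H G \<and> two_connected H \<and>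
     (\<forall>H'. subgraph H' G \<and> two_connected H' \<and> subgraph H H' \<longrightarrow> H' = H)"

definition graph_iso :: "('v \<Rightarrow> 'w) \<Rightarrow> 'v graph \<Rightarrow> 'w graph \<Rightarrow> bool" where
  "graph_iso f G H \<longleftrightarrow> bij_betw f (verts G) (verts H) \<and> edges H = (\<lambda>e. f ` e) ` edges G"


section \<open>Block-stable classes and their generating functions\<close>

text \<open>Every finite graph has an isomorphic copy with vertices in \<^typ>\<open>nat\<close>, so a class of finite
  graphs closed under isomorphism is represented by its members with vertices in \<^typ>\<open>nat\<close>.\<close>

definition graph_class :: "nat graph set \<Rightarrow> bool" where
  "graph_class \<G> \<longleftrightarrow> (\<forall>G\<in>\<G>. fin_sgraph G) \<and> (\<forall>G\<in>\<G>. \<forall>f H. graph_iso f G H \<longrightarrow> H \<in> \<G>)"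

definition block_stable :: "nat graph set \<Rightarrow> bool" where
  "block_stable \<G> \<longleftrightarrow> graph_class \<G> \<and> Graph {1, 2} {{1, 2}} \<in> \<G> \<and>
     (\<forall>G. fin_sgraph G \<longrightarrow> (G \<in> \<G> \<longleftrightarrow> (\<forall>H. is_block_of H G \<longrightarrow> H \<in> \<G>)))"

definition conn_class :: "nat graph set \<Rightarrow> nat graph set" where
  "conn_class \<G> = {G \<in> \<G>. gconnected G}"

definition block_class :: "nat graph set \<Rightarrow> nat graph set" where
  "block_class \<G> = {G \<in> \<G>. two_connected G}"

definition egf :: "nat graph set \<Rightarrow> real fps" where
  "egf \<A> = Abs_fps (\<lambda>n. real (card {G \<in> \<A>. verts G = {1..n}}) / fact n)"

definition rooted_egf :: "nat graph set \<Rightarrow> real fps" where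
  "rooted_egf \<G> = fps_X * fps_deriv (egf (conn_class \<G>))"

definition conn_radius :: "nat graph set \<Rightarrow> ereal" where
  "conn_radius \<G> = fps_conv_radius (egf (conn_class \<G>))"

definition block_radius :: "nat graph set \<Rightarrow> ereal" where
  "block_radius \<G> = fps_conv_radius (egf (block_class \<G>))"

text \<open>The series of nonnegative terms on the left is evaluated on the boundary of its disc of
  convergence, hence in \<^typ>\<open>ennreal\<close>, where divergence means the value \<open>\<infinity>\<close>.\<close>

definition subcritical :: "nat graph set \<Rightarrow> bool" where
  "subcritical \<G> \<longleftrightarrow>
     (\<Sum>n. ennreal (fps_nth (rooted_egf \<G>) n) * e2ennreal (conn_radius \<G>) ^ n)
       < e2ennreal (block_radius \<G>)"


section \<open>Rooted graphs and weak convergence\<close>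

definition rooted_class :: "'v graph \<times> 'v \<Rightarrow> (nat graph \<times> nat) set" where
  "rooted_class = (\<lambda>(G, x). {(H, y). \<exists>f. graph_iso f G H \<and> f x = y})"

definition rball :: "nat \<Rightarrow> 'v graph \<times> 'v \<Rightarrow> 'v graph \<times> 'v" where
  "rball r = (\<lambda>(G, x). (induced G {v. \<exists>k\<le>r. (x, v) \<in> adj G ^^ k}, x))"

definition ball_class :: "nat \<Rightarrow> 'v graph \<times> 'v \<Rightarrow> (nat graph \<times> nat) set" where
  "ball_class r R = rooted_class (rball r R)"

definition random_rooted_graph :: "'a measure \<Rightarrow> ('a \<Rightarrow> 'v graph \<times> 'v) \<Rightarrow> bool" where
  "random_rooted_graph M R \<longleftrightarrow> prob_space M \<and>
     (\<forall>\<omega>\<in>space M. case R \<omega> of (G, x) \<Rightarrow> sgraph G \<and> locally_finite G \<and> x \<in> verts G) \<and>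
     (\<forall>r. (\<lambda>\<omega>. ball_class r (R \<omega>)) \<in> measurable M (count_space UNIV))"

text \<open>Convergence in distribution on a discrete space, where every function is continuous.\<close>

definition discrete_weak_conv :: "(nat \<Rightarrow> 'a measure) \<Rightarrow> 'a measure \<Rightarrow> bool" where
  "discrete_weak_conv \<mu> \<nu> \<longleftrightarrow>
     (\<forall>f :: 'a \<Rightarrow> real. bounded (range f) \<longrightarrow>
        (\<lambda>n. integral\<^sup>L (\<mu> n) f) \<longlonglongrightarrow> integral\<^sup>L \<nu> f)"

definition converges_weakly ::
  "(nat \<Rightarrow> ('v graph \<times> 'v) pmf) \<Rightarrow> 'a measure \<Rightarrow> ('a \<Rightarrow> 'w graph \<times> 'w) \<Rightarrow> bool" where
  "converges_weakly Rn M R \<longleftrightarrow> random_rooted_graph M R \<and>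
     (\<forall>r. discrete_weak_conv (\<lambda>n. measure_pmf (map_pmf (ball_class r) (Rn n)))
            (distr M (count_space UNIV) (\<lambda>\<omega>. ball_class r (R \<omega>))))"

definition random_rooted :: "nat graph set \<Rightarrow> nat \<Rightarrow> (nat graph \<times> nat) pmf" where
  "random_rooted \<G> n =
     pmf_of_set {(G, x). G \<in> conn_class \<G> \<and> verts G = {1..n} \<and> x \<in> verts G}"


section \<open>Links\<close>

text \<open>A triple \<open>(G, s, t)\<close> is a graph with source \<open>s\<close> and sink \<open>t\<close>.\<close>

type_synonym 'v ended = "'v graph \<times> 'v \<times> 'v"

definition ended_iso :: "('v \<Rightarrow> 'w) \<Rightarrow> 'v ended \<Rightarrow> 'w ended \<Rightarrow> bool" where
  "ended_iso f = (\<lambda>(G, s, t) (G', s', t'). graph_iso f G G' \<and> f s = s' \<and> f t = t')"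

text \<open>The root of the connected graph \<open>H v\<close> is \<open>v\<close> itself; up to isomorphism, identification then
  amounts to a union of graphs that share no further vertices.\<close>

definition is_link :: "nat graph set \<Rightarrow> nat ended \<Rightarrow> bool" where
  "is_link \<G> = (\<lambda>(G, s, t). G \<in> \<G> \<and>
     (\<exists>B H. B \<in> block_class \<G> \<and> s \<in> verts B \<and> t \<in> verts B \<and> s \<noteq> t \<and>
        (\<forall>v\<in>verts B - {t}. H v \<in> conn_class \<G> \<and> verts (H v) \<inter> verts B = {v}) \<and>
        disjoint_family_on (\<lambda>v. verts (H v)) (verts B - {t}) \<and>
        G = Graph (verts B \<union> (\<Union>v\<in>verts B - {t}. verts (H v)))
                  (edges B \<union> (\<Union>v\<in>verts B - {t}. edges (H v)))))"

definition ended_class :: "nat ended \<Rightarrow> nat ended set" where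
  "ended_class x = {y. \<exists>f. ended_iso f x y}"

definition links :: "nat graph set \<Rightarrow> nat ended set set" where
  "links \<G> = ended_class ` {x. is_link \<G> x}"

definition link_rep :: "nat ended set \<Rightarrow> nat ended" where
  "link_rep L = (SOME x. x \<in> L)"

definition ended_size :: "nat ended \<Rightarrow> nat" where
  "ended_size = (\<lambda>(G, s, t). card (verts G - {t}))"

definition labellings :: "nat ended \<Rightarrow> (nat \<Rightarrow> nat) set" where
  "labellings = (\<lambda>(G, s, t). {\<phi> \<in> extensional (verts G - {t}).
     bij_betw \<phi> (verts G - {t}) {1..card (verts G - {t})}})"

definition labelling_iso :: "nat ended \<Rightarrow> ((nat \<Rightarrow> nat) \<times> (nat \<Rightarrow> nat)) set" where
  "labelling_iso = (\<lambda>(G, s, t). {(\<phi>, \<psi>).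
     \<phi> \<in> labellings (G, s, t) \<and> \<psi> \<in> labellings (G, s, t) \<and>
     (\<exists>\<alpha>. ended_iso \<alpha> (G, s, t) (G, s, t) \<and> (\<forall>v\<in>verts G - {t}. \<phi> v = \<psi> (\<alpha> v)))})"

definition num_labellings :: "nat ended \<Rightarrow> nat" where
  "num_labellings x = card (labellings x // labelling_iso x)"

text \<open>None of the quantities below depends on the choice of the representative of \<open>L\<close>.\<close>

definition link_weight :: "nat graph set \<Rightarrow> nat ended set \<Rightarrow> real" where
  "link_weight \<G> L = (let x = link_rep L in
     real (num_labellings x) * real_of_ereal (conn_radius \<G>) ^ ended_size x / fact (ended_size x))"

definition link_measure :: "nat graph set \<Rightarrow> nat ended set measure" where
  "link_measure \<G> = point_measure (links \<G>) (\<lambda>L. ennreal (link_weight \<G> L))"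


section \<open>Infinite chains of links\<close>

text \<open>The vertex \<open>v\<close> of the \<open>j\<close>-th link becomes \<open>(j, v)\<close>, except that the sink is identified
  with the source of the next link. The numbering of the links starts at 0.\<close>

definition chain_vertex :: "(nat \<Rightarrow> nat ended) \<Rightarrow> nat \<Rightarrow> nat \<Rightarrow> nat \<times> nat" where
  "chain_vertex x j v = (case (x j, x (Suc j)) of ((_, _, t), (_, s', _)) \<Rightarrow>
     if v = t then (Suc j, s') else (j, v))"

definition chain :: "(nat \<Rightarrow> nat ended) \<Rightarrow> (nat \<times> nat) graph \<times> (nat \<times> nat)" where
  "chain x =
     (Graph (\<Union>j. chain_vertex x j ` verts (fst (x j)))
            (\<Union>j. (\<lambda>e. chain_vertex x j ` e) ` edges (fst (x j))),
      (0, fst (snd (x 0))))"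

definition chain_space :: "nat graph set \<Rightarrow> (nat \<Rightarrow> nat ended set) measure" where
  "chain_space \<G> = PiM UNIV (\<lambda>_. link_measure \<G>)"

definition link_chain :: "(nat \<Rightarrow> nat ended set) \<Rightarrow> (nat \<times> nat) graph \<times> (nat \<times> nat)" where
  "link_chain \<omega> = chain (\<lambda>j. link_rep (\<omega> j))"

end

theory Submission
  imports Defs
begin

text \<open>
  Mark a second vertex \<open>v\<close> in a rooted connected graph \<open>(G, x)\<close>; for a uniformly random member on \<open>n\<close>
  labels a uniformly random mark does not change the law of \<open>(G, x)\<close>. If \<open>v \<noteq> x\<close>, there is exactly one block at
  \<open>x\<close> that leads towards \<open>v\<close>. Let \<open>t\<close> be the vertex at which the way to \<open>v\<close> leaves this block. Cutting at \<open>t\<close>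
  splits \<open>G\<close> into a link with source \<open>x\<close> and sink \<open>t\<close> and a smaller connected graph with root \<open>t\<close> and mark
  \<open>v\<close>, and every such pair arises once (\<open>bij_betw_glue\<close>).

  With \<open>T\<close> for the series of rooted connected graphs and \<open>L\<close> for the series of links, this says
  \<open>z T' = T + L z T'\<close> (\<open>pointed_equation\<close>). A link is a block with a rooted connected graph at every vertex but the sink, so
  \<open>L = T B''(T)\<close> (\<open>L_eq\<close>), and formal integration gives \<open>T = z exp (B'(T))\<close> (\<open>T_equation\<close>). Two
  analytic facts follow from this equation by elementary means, without singularity analysis. In the subcritical case
  \<open>\<tau> = T(\<rho>)\<close> is a critical point of \<open>y / exp (B'(y))\<close>, that is \<open>L(\<rho>) = \<tau> B''(\<tau>) = 1\<close>
  (\<open>L_sums\<close>): the link weights form a probability measure. And the ratio of consecutive coefficients of \<open>T\<close>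
  tends to \<open>\<rho>\<close> (\<open>T_ratio\<close>): contraction of the vertices with one child makes \<open>T\<close> a binomial transform of a
  nonnegative series, and the ratio is essentially the mean proportion of such vertices, which a bound on their moment
  generating function and Jensen's inequality determine.

  The sink of a link has distance at least 1 from its source. So the ball of radius \<open>r + 1\<close> around \<open>x\<close> is a function of
  the isomorphism class of the first link and of the class of the ball of radius \<open>r\<close> around \<open>t\<close> in the
  remaining graph (\<open>glue_ball_eq\<close>). The remaining graph on \<open>n - m\<close> labels is again uniformly distributed, and
  the first link is a given labelled link of size \<open>m\<close> with a probability that tends to
  \<open>\<rho>\<^sup>m / m!\<close> by the ratio limit. The infinite chain satisfies the same recursion with the
  limiting weights. By induction on \<open>r\<close> the expectation of each function of the ball with values in \<open>[0, 1]\<close> has in the limit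
  at least the value for the chain; since the limiting weights have total mass 1, this holds for \<open>f\<close> and for
  \<open>1 - f\<close>, which gives convergence (\<open>finite_mean_tendsto\<close>).
\<close>

section \<open>Power series with nonnegative coefficients\<close>

definition fps_nonneg :: "real fps \<Rightarrow> bool" where
  "fps_nonneg f \<longleftrightarrow> (\<forall>n. 0 \<le> fps_nth f n)"

lemma nonneg_partial_sums_bounded:
  fixes c :: "nat \<Rightarrow> real"
  assumes "\<And>k. 0 \<le> c k" "\<And>N. (\<Sum>k\<le>N. c k) \<le> z"
  shows "summable c" "suminf c \<le> z"
proof -
  have "(\<Sum>k<n. c k) \<le> z" for n
    using assms(2)[of n] sum_mono2[of "{..n}" "{..<n}" c] assms(1) by force
  then show "summable c" "suminf c \<le> z"
    using assms(1) by (auto intro: summableI_nonneg_bounded intro!: suminf_le_const)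
qed

lemma fps_nonneg_mult: "fps_nonneg f \<Longrightarrow> fps_nonneg g \<Longrightarrow> fps_nonneg (f * g)"
  by (auto simp: fps_nonneg_def fps_mult_nth intro!: sum_nonneg)

lemma fps_nonneg_power: "fps_nonneg f \<Longrightarrow> fps_nonneg (f ^ n)"
proof (induction n)
  case 0
  then show ?case by (auto simp: fps_nonneg_def fps_one_nth)
next
  case (Suc n)
  then show ?case by (auto intro!: fps_nonneg_mult)
qed

lemma fps_nonneg_compose: "fps_nonneg f \<Longrightarrow> fps_nonneg g \<Longrightarrow> fps_nonneg (fps_compose f g)"
  using fps_nonneg_power[of g]
  by (auto simp: fps_nonneg_def fps_compose_nth intro!: sum_nonneg mult_nonneg_nonneg)

lemma mult_nth_times_power:
  fixes f g :: "real fps"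
  shows "fps_nth (f * g) k * x ^ k
    = (\<Sum>i\<le>k. fps_nth f i * x ^ i * (fps_nth g (k - i) * x ^ (k - i)))"
  unfolding fps_mult_nth sum_distrib_right atLeast0AtMost
proof (rule sum.cong)
  fix i assume "i \<in> {..k}"
  then have "x ^ k = x ^ i * x ^ (k - i)" by (simp add: power_add[symmetric])
  then show "fps_nth f i * fps_nth g (k - i) * x ^ k
      = fps_nth f i * x ^ i * (fps_nth g (k - i) * x ^ (k - i))" by simp
qed simp

lemma partial_sum_mult_le:
  fixes f g :: "real fps"
  assumes "fps_nonneg f" "fps_nonneg g" "0 \<le> x"
  shows "(\<Sum>k\<le>N. fps_nth (f * g) k * x ^ k)
    \<le> (\<Sum>k\<le>N. fps_nth f k * x ^ k) * (\<Sum>k\<le>N. fps_nth g k * x ^ k)"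
proof -
  let ?F = "\<lambda>i. fps_nth f i * x ^ i" and ?G = "\<lambda>i. fps_nth g i * x ^ i"
  have "fps_nth (f * g) k * x ^ k = (\<Sum>i\<le>k. ?F i * ?G (k - i))" for k
    by (rule mult_nth_times_power)
  then have "(\<Sum>k\<le>N. fps_nth (f * g) k * x ^ k) = (\<Sum>k\<le>N. \<Sum>i\<le>k. ?F i * ?G (k - i))"
    by simp
  also have "\<dots> = (\<Sum>(i, j)\<in>{(i, j). i + j \<le> N}. ?F i * ?G j)"
    by (rule sum.triangle_reindex_eq[symmetric])
  also have "\<dots> \<le> (\<Sum>(i, j)\<in>{..N} \<times> {..N}. ?F i * ?G j)"
    using assms by (intro sum_mono2) (auto simp: fps_nonneg_def)
  also have "\<dots> = (\<Sum>k\<le>N. ?F k) * (\<Sum>k\<le>N. ?G k)"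
    by (simp add: sum_product sum.cartesian_product)
  finally show ?thesis .
qed

lemma partial_sum_power_le:
  fixes g :: "real fps"
  assumes "fps_nonneg g" "0 \<le> x"
  shows "(\<Sum>k\<le>N. fps_nth (g ^ j) k * x ^ k) \<le> (\<Sum>k\<le>N. fps_nth g k * x ^ k) ^ j"
proof (induction j)
  case 0
  have "(\<Sum>k\<le>N. fps_nth 1 k * x ^ k) = (\<Sum>k\<le>N. if k = 0 then 1 else 0)"
    by (intro sum.cong) (auto simp: fps_one_nth)
  then show ?case by (simp add: sum.delta)
next
  case (Suc j)
  have "(\<Sum>k\<le>N. fps_nth (g ^ Suc j) k * x ^ k)
      \<le> (\<Sum>k\<le>N. fps_nth g k * x ^ k) * (\<Sum>k\<le>N. fps_nth (g ^ j) k * x ^ k)"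
    using partial_sum_mult_le[OF assms(1) fps_nonneg_power[OF assms(1)] assms(2)] by simp
  also have "\<dots> \<le> (\<Sum>k\<le>N. fps_nth g k * x ^ k) * (\<Sum>k\<le>N. fps_nth g k * x ^ k) ^ j"
    using Suc assms by (intro mult_left_mono sum_nonneg) (auto simp: fps_nonneg_def)
  finally show ?case by simp
qed

lemma compose_nth_atMost:
  fixes f g :: "real fps"
  assumes "fps_nth g 0 = 0" "k \<le> N"
  shows "fps_nth (fps_compose f g) k = (\<Sum>j\<le>N. fps_nth f j * fps_nth (g ^ j) k)"
  unfolding fps_compose_nth atLeast0AtMost
  using assms by (intro sum.mono_neutral_left) (auto simp: startsby_zero_power_prefix)

lemma partial_sum_compose_le:
  fixes f g :: "real fps"
  assumes "fps_nonneg f" "fps_nonneg g" "fps_nth g 0 = 0" "0 \<le> x"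
  shows "(\<Sum>k\<le>N. fps_nth (fps_compose f g) k * x ^ k)
    \<le> (\<Sum>j\<le>N. fps_nth f j * (\<Sum>k\<le>N. fps_nth g k * x ^ k) ^ j)"
proof -
  have "(\<Sum>k\<le>N. fps_nth (fps_compose f g) k * x ^ k)
      = (\<Sum>k\<le>N. \<Sum>j\<le>N. fps_nth f j * (fps_nth (g ^ j) k * x ^ k))"
    using compose_nth_atMost[OF assms(3)]
    by (intro sum.cong) (auto simp: sum_distrib_right mult.assoc)
  also have "\<dots> = (\<Sum>j\<le>N. fps_nth f j * (\<Sum>k\<le>N. fps_nth (g ^ j) k * x ^ k))"
    by (subst sum.swap) (simp add: sum_distrib_left)
  also have "\<dots> \<le> (\<Sum>j\<le>N. fps_nth f j * (\<Sum>k\<le>N. fps_nth g k * x ^ k) ^ j)"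
    using assms by (intro sum_mono mult_left_mono partial_sum_power_le) (auto simp: fps_nonneg_def)
  finally show ?thesis .
qed

lemma power_sums:
  fixes g :: "real fps"
  assumes "fps_nonneg g" "0 \<le> x" "(\<lambda>k. fps_nth g k * x ^ k) sums y"
  shows "(\<lambda>k. fps_nth (g ^ j) k * x ^ k) sums (y ^ j)"
proof (induction j)
  case 0
  have "(\<lambda>k. fps_nth 1 k * x ^ k) = (\<lambda>k. if k = 0 then 1 else 0 :: real)"
    by (auto simp: fps_one_nth)
  then show ?case using sums_single[of 0 "\<lambda>_. 1 :: real"] by simp
next
  case (Suc j)
  let ?F = "\<lambda>k. fps_nth g k * x ^ k" and ?G = "\<lambda>k. fps_nth (g ^ j) k * x ^ k"
  have nn: "0 \<le> ?F k" "0 \<le> ?G k" for k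
    using assms fps_nonneg_power[OF assms(1), of j] by (auto simp: fps_nonneg_def)
  have "(\<lambda>k. \<Sum>i\<le>k. ?F i * ?G (k - i)) sums ((\<Sum>k. ?F k) * (\<Sum>k. ?G k))"
    using nn assms(3) Suc by (intro Cauchy_product_sums) (auto simp: sums_iff)
  also have "(\<lambda>k. \<Sum>i\<le>k. ?F i * ?G (k - i)) = (\<lambda>k. fps_nth (g ^ Suc j) k * x ^ k)"
    using mult_nth_times_power[of g "g ^ j" _ x] by simp
  finally show ?case using assms(3) Suc by (simp add: sums_iff)
qed

text \<open>Each partial sum of the outer series is a sum of finitely many convergent series in \<open>x\<close>, and all their coefficients
  occur among the nonnegative summands of the coefficients of the composition.\<close>

lemma compose_outer_partial_sum_le:
  fixes f g :: "real fps"
  assumes f: "fps_nonneg f" and g: "fps_nonneg g" "fps_nth g 0 = 0" and x: "0 \<le> x"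
    and gs: "(\<lambda>k. fps_nth g k * x ^ k) sums y"
    and cs: "summable (\<lambda>k. fps_nth (fps_compose f g) k * x ^ k)"
  shows "(\<Sum>j\<le>J. fps_nth f j * y ^ j) \<le> (\<Sum>k. fps_nth (fps_compose f g) k * x ^ k)"
proof -
  let ?c = "\<lambda>k. fps_nth (fps_compose f g) k * x ^ k"
  have s: "(\<lambda>k. \<Sum>j\<le>J. fps_nth f j * (fps_nth (g ^ j) k * x ^ k)) sums (\<Sum>j\<le>J. fps_nth f j * y ^ j)"
    by (intro sums_sum sums_mult power_sums g x gs)
  have "(\<Sum>j\<le>J. fps_nth f j * (fps_nth (g ^ j) k * x ^ k)) \<le> ?c k" for k
  proof -
    have "(\<Sum>j\<le>J. fps_nth f j * (fps_nth (g ^ j) k * x ^ k))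
        = (\<Sum>j\<le>J. fps_nth f j * fps_nth (g ^ j) k) * x ^ k"
      by (simp add: sum_distrib_right mult.assoc)
    also have "\<dots> \<le> (\<Sum>j\<le>max J k. fps_nth f j * fps_nth (g ^ j) k) * x ^ k"
      using f fps_nonneg_power[OF g(1)] x
      by (intro mult_right_mono sum_mono2) (auto simp: fps_nonneg_def)
    also have "\<dots> = ?c k"
      using compose_nth_atMost[OF g(2), of k "max J k" f] by simp
    finally show ?thesis .
  qed
  then show ?thesis using suminf_le[OF _ sums_summable[OF s] cs] s by (simp add: sums_iff)
qed

text \<open>Nonnegativity of the coefficients makes all rearrangements legitimate, so substitution of
  series and evaluation commute up to and including the boundary of the disc of convergence of the
  inner series.\<close>

lemma compose_sums:
  fixes f g :: "real fps"
  assumes f: "fps_nonneg f" and g: "fps_nonneg g" "fps_nth g 0 = 0" and x: "0 \<le> x"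
    and gs: "(\<lambda>k. fps_nth g k * x ^ k) sums y" and fs: "(\<lambda>k. fps_nth f k * y ^ k) sums z"
  shows "(\<lambda>k. fps_nth (fps_compose f g) k * x ^ k) sums z"
proof -
  let ?c = "\<lambda>k. fps_nth (fps_compose f g) k * x ^ k"
  have c0: "0 \<le> ?c k" for k
    using fps_nonneg_compose[OF f g(1)] x by (auto simp: fps_nonneg_def)
  have Y: "(\<Sum>k\<le>N. fps_nth g k * x ^ k) \<le> y" for N
    using gs g(1) x by (auto simp: sums_iff fps_nonneg_def intro!: sum_le_suminf)
  have y0: "0 \<le> y" using Y[of 0] g(2) by simp
  have le: "(\<Sum>k\<le>N. ?c k) \<le> z" for N
  proof -
    have "(\<Sum>k\<le>N. ?c k) \<le> (\<Sum>j\<le>N. fps_nth f j * (\<Sum>k\<le>N. fps_nth g k * x ^ k) ^ j)"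
      by (rule partial_sum_compose_le[OF f g x])
    also have "\<dots> \<le> (\<Sum>j\<le>N. fps_nth f j * y ^ j)"
      using f Y g x by (intro sum_mono mult_left_mono power_mono sum_nonneg) (auto simp: fps_nonneg_def)
    also have "\<dots> \<le> z"
      using fs f y0 by (auto simp: sums_iff fps_nonneg_def intro!: sum_le_suminf)
    finally show ?thesis .
  qed
  note sm = nonneg_partial_sums_bounded[of ?c, OF c0 le]
  have "suminf (\<lambda>j. fps_nth f j * y ^ j) \<le> suminf ?c"
    using f y0 compose_outer_partial_sum_le[OF f g x gs sm(1)]
    by (intro nonneg_partial_sums_bounded(2)) (auto simp: fps_nonneg_def)
  then show ?thesis using sm fs by (simp add: sums_iff)
qed

section \<open>The functional equation of simply generated trees\<close>

text \<open>A real number \<open>y\<close> with \<open>z \<phi>(y) \<le> y\<close> dominates the monotone iteration that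
  starts at 0 and computes the coefficients of the solution.\<close>

lemma tree_series_partial_sum_le:
  fixes T \<phi> :: "real fps"
  assumes T: "T = fps_X * fps_compose \<phi> T" "fps_nonneg T" and \<phi>: "fps_nonneg \<phi>"
    and z: "0 \<le> z" and y: "0 \<le> y" "summable (\<lambda>k. fps_nth \<phi> k * y ^ k)"
    and super: "z * (\<Sum>k. fps_nth \<phi> k * y ^ k) \<le> y"
  shows "(\<Sum>k\<le>N. fps_nth T k * z ^ k) \<le> y"
proof (induction N)
  case 0
  have "fps_nth T 0 = 0" by (subst T(1)) simp
  then show ?case using y by simp
next
  case (Suc N)
  have T0: "fps_nth T 0 = 0" by (subst T(1)) simp
  have TS: "fps_nth T (Suc k) = fps_nth (fps_compose \<phi> T) k" for k
    by (subst T(1)) simp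
  have "(\<Sum>k\<le>Suc N. fps_nth T k * z ^ k) = (\<Sum>k\<le>N. fps_nth T (Suc k) * z ^ Suc k)"
    by (subst sum.atMost_Suc_shift) (simp add: T0)
  also have "\<dots> = z * (\<Sum>k\<le>N. fps_nth (fps_compose \<phi> T) k * z ^ k)"
    by (simp add: TS sum_distrib_left algebra_simps)
  also have "\<dots> \<le> z * (\<Sum>j\<le>N. fps_nth \<phi> j * (\<Sum>k\<le>N. fps_nth T k * z ^ k) ^ j)"
    by (intro mult_left_mono partial_sum_compose_le \<phi> T T0 z)
  also have "\<dots> \<le> z * (\<Sum>j\<le>N. fps_nth \<phi> j * y ^ j)"
    using z \<phi> T(2) Suc
    by (intro mult_left_mono sum_mono power_mono sum_nonneg) (auto simp: fps_nonneg_def)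
  also have "\<dots> \<le> z * (\<Sum>k. fps_nth \<phi> k * y ^ k)"
    using z \<phi> y by (intro mult_left_mono sum_le_suminf) (auto simp: fps_nonneg_def)
  also have "\<dots> \<le> y" by (rule super)
  finally show ?case .
qed

lemma tree_series_summable:
  fixes T \<phi> :: "real fps"
  assumes T: "T = fps_X * fps_compose \<phi> T" "fps_nonneg T" and \<phi>: "fps_nonneg \<phi>"
    and z: "0 \<le> z" and y: "0 \<le> y" "summable (\<lambda>k. fps_nth \<phi> k * y ^ k)"
    and super: "z * (\<Sum>k. fps_nth \<phi> k * y ^ k) \<le> y"
  shows "summable (\<lambda>k. fps_nth T k * z ^ k)"
  using tree_series_partial_sum_le[OF assms] T(2) z
  by (intro nonneg_partial_sums_bounded(1)[of _ y]) (auto simp: fps_nonneg_def)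

lemma tree_series_value:
  fixes T \<phi> :: "real fps"
  assumes T: "T = fps_X * fps_compose \<phi> T" "fps_nonneg T" and \<phi>: "fps_nonneg \<phi>"
    and \<rho>: "0 \<le> \<rho>" "(\<lambda>k. fps_nth T k * \<rho> ^ k) sums \<tau>" "summable (\<lambda>k. fps_nth \<phi> k * \<tau> ^ k)"
  shows "\<tau> = \<rho> * (\<Sum>k. fps_nth \<phi> k * \<tau> ^ k)"
proof -
  have T0: "fps_nth T 0 = 0" by (subst T(1)) simp
  have TS: "fps_nth T (Suc k) = fps_nth (fps_compose \<phi> T) k" for k
    by (subst T(1)) simp
  have "(\<lambda>k. fps_nth (fps_compose \<phi> T) k * \<rho> ^ k) sums (\<Sum>k. fps_nth \<phi> k * \<tau> ^ k)"
    using \<rho> by (intro compose_sums[OF \<phi> T(2) T0, of _ \<tau>]) auto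
  then have "(\<lambda>k. \<rho> * (fps_nth (fps_compose \<phi> T) k * \<rho> ^ k)) sums (\<rho> * (\<Sum>k. fps_nth \<phi> k * \<tau> ^ k))"
    by (rule sums_mult)
  then have "(\<lambda>k. fps_nth T (Suc k) * \<rho> ^ Suc k) sums (\<rho> * (\<Sum>k. fps_nth \<phi> k * \<tau> ^ k))"
    by (simp add: TS algebra_simps)
  then have "(\<lambda>k. fps_nth T k * \<rho> ^ k) sums (\<rho> * (\<Sum>k. fps_nth \<phi> k * \<tau> ^ k) + fps_nth T 0 * \<rho> ^ 0)"
    by (subst (asm) sums_Suc_iff) simp
  then show ?thesis using \<rho>(2) T0 by (simp add: sums_iff)
qed

text \<open>If \<open>\<tau>\<close> lies inside the disc of convergence of \<open>\<phi>\<close> then it is a critical point of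
  \<open>g(y) = y / \<phi>(y)\<close>: otherwise \<open>g\<close> exceeds \<open>g(\<tau>) = \<rho>\<close> somewhere near \<open>\<tau>\<close>, and there the
  solution converges beyond \<open>\<rho>\<close> by domination.\<close>

lemma tree_series_characteristic_equation:
  fixes T \<phi> :: "real fps"
  assumes T: "T = fps_X * fps_compose \<phi> T" "fps_nonneg T" and \<phi>: "fps_nonneg \<phi>" "0 < fps_nth \<phi> 0"
    and \<rho>: "0 < \<rho>" "(\<lambda>k. fps_nth T k * \<rho> ^ k) sums \<tau>"
    and radius: "\<And>z. \<rho> < z \<Longrightarrow> \<not> summable (\<lambda>k. fps_nth T k * z ^ k)"
    and \<tau>: "ereal \<tau> < fps_conv_radius \<phi>"
  shows "\<tau> * eval_fps (fps_deriv \<phi>) \<tau> = eval_fps \<phi> \<tau>"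
proof (rule ccontr)
  assume ne: "\<tau> * eval_fps (fps_deriv \<phi>) \<tau> \<noteq> eval_fps \<phi> \<tau>"
  have sm: "summable (\<lambda>k. fps_nth \<phi> k * y ^ k)" if "0 \<le> y" "ereal y < fps_conv_radius \<phi>" for y
    using that summable_fps[of y \<phi>] by simp
  have \<tau>0: "0 \<le> \<tau>"
    using \<rho> T(2) by (auto simp: sums_iff fps_nonneg_def intro!: suminf_nonneg)
  have ev: "eval_fps \<phi> y = (\<Sum>k. fps_nth \<phi> k * y ^ k)" for y by (simp add: eval_fps_def)
  have pos: "0 < eval_fps \<phi> y" if "0 \<le> y" "ereal y < fps_conv_radius \<phi>" for y
  proof -
    have "fps_nth \<phi> 0 * y ^ 0 \<le> (\<Sum>k. fps_nth \<phi> k * y ^ k)"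
      using sum_le_suminf[OF sm[OF that], of "{0}"] \<phi> that by (simp add: fps_nonneg_def)
    then show ?thesis using \<phi>(2) by (simp add: ev)
  qed
  have \<tau>\<rho>: "\<tau> = \<rho> * eval_fps \<phi> \<tau>"
    using tree_series_value[OF T \<phi>(1) less_imp_le[OF \<rho>(1)] \<rho>(2) sm[OF \<tau>0 \<tau>]] by (simp add: ev)
  have \<tau>pos: "0 < \<tau>" using \<tau>\<rho> \<rho>(1) pos[OF \<tau>0 \<tau>] by (metis mult_pos_pos)
  define g where "g = (\<lambda>y. y / eval_fps \<phi> y)"
  have g\<tau>: "g \<tau> = \<rho>" using \<tau>\<rho> pos[OF \<tau>0 \<tau>] by (simp add: g_def field_simps)
  have le: "g y \<le> \<rho>" if "0 < y" "ereal y < fps_conv_radius \<phi>" for y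
  proof (rule ccontr)
    assume "\<not> g y \<le> \<rho>"
    moreover have "summable (\<lambda>k. fps_nth T k * g y ^ k)"
      using that pos[of y] sm[of y]
      by (intro tree_series_summable[OF T \<phi>(1), of "g y" y]) (auto simp: g_def ev[symmetric])
    ultimately show False using radius[of "g y"] by simp
  qed
  have d: "(g has_real_derivative
      (eval_fps \<phi> \<tau> - \<tau> * eval_fps (fps_deriv \<phi>) \<tau>) / (eval_fps \<phi> \<tau>)\<^sup>2) (at \<tau>)"
    unfolding g_def using pos[OF \<tau>0 \<tau>] \<tau> \<tau>0
    by (auto intro!: derivative_eq_intros has_field_derivative_eval_fps
        simp: power2_eq_square field_simps)
  obtain e where e: "0 < e" "\<And>y. \<bar>\<tau> - y\<bar> < e \<Longrightarrow> 0 < y \<and> ereal y < fps_conv_radius \<phi>"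
  proof -
    obtain b where b: "\<tau> < b" "ereal b < fps_conv_radius \<phi>" using ereal_dense2[OF \<tau>] by auto
    show ?thesis
    proof (rule that[of "min \<tau> (b - \<tau>)"])
      show "0 < min \<tau> (b - \<tau>)" using \<tau>pos b by simp
      fix y assume y: "\<bar>\<tau> - y\<bar> < min \<tau> (b - \<tau>)"
      then have "y < b" by auto
      then have "ereal y < ereal b" by simp
      moreover have "ereal y < fps_conv_radius \<phi>" using calculation b(2) by (rule less_trans)
      ultimately show "0 < y \<and> ereal y < fps_conv_radius \<phi>" using y by auto
    qed
  qed
  have "(eval_fps \<phi> \<tau> - \<tau> * eval_fps (fps_deriv \<phi>) \<tau>) / (eval_fps \<phi> \<tau>)\<^sup>2 = 0"
    using DERIV_local_max[OF d e(1)] e(2) le g\<tau> by auto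
  then show False using ne pos[OF \<tau>0 \<tau>] by simp
qed

section \<open>Coefficient ratios\<close>

text \<open>Each coefficient is a polynomial with nonnegative coefficients in the earlier ones.\<close>

lemma tree_series_nonneg:
  fixes T \<phi> :: "real fps"
  assumes T: "T = fps_X * fps_compose \<phi> T" and \<phi>: "fps_nonneg \<phi>"
  shows "fps_nonneg T"
proof -
  have T0: "fps_nth T 0 = 0" by (subst T(1)) simp
  have TS: "fps_nth T (Suc k) = fps_nth (fps_compose \<phi> T) k" for k
    by (subst T(1)) simp
  have "0 \<le> fps_nth T n" for n
  proof (induction n rule: less_induct)
    case (less n)
    show ?case
    proof (cases n)
      case 0
      then show ?thesis using T0 by simp
    next
      case (Suc m)
      have pw: "\<forall>k\<le>m. 0 \<le> fps_nth (T ^ i) k" for i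
      proof (induction i)
        case 0
        then show ?case by (auto simp: fps_one_nth)
      next
        case (Suc i)
        then show ?case using less \<open>n = Suc m\<close>
          by (auto simp: fps_mult_nth intro!: sum_nonneg mult_nonneg_nonneg)
      qed
      show ?thesis using pw \<phi> unfolding Suc TS fps_compose_nth
        by (auto simp: fps_nonneg_def intro!: sum_nonneg mult_nonneg_nonneg)
    qed
  qed
  then show ?thesis by (simp add: fps_nonneg_def)
qed

text \<open>The series \<open>X / (1 - u X)\<close>. Substitution of it replaces each vertex by a path, in which \<open>u\<close> marks the additional vertices.\<close>

definition geo :: "real \<Rightarrow> real fps" where
  "geo u = Abs_fps (\<lambda>n. if n = 0 then 0 else u ^ (n - 1))"

lemma geo_0 [simp]: "fps_nth (geo u) 0 = 0"
  by (simp add: geo_def)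

lemma geo_nonneg: "0 \<le> u \<Longrightarrow> fps_nonneg (geo u)"
  by (auto simp: geo_def fps_nonneg_def)

lemma geo_mult: "geo u * (1 - fps_const u * fps_X) = fps_X"
proof (rule fps_ext)
  fix n
  have "geo u * (1 - fps_const u * fps_X) = geo u - fps_const u * (fps_X * geo u)"
    by (simp add: algebra_simps)
  then show "fps_nth (geo u * (1 - fps_const u * fps_X)) n = fps_nth fps_X n"
    by (cases n; cases "n - 1") (auto simp: geo_def)
qed

lemma geo_sums:
  assumes "\<bar>u * z\<bar> < 1"
  shows "(\<lambda>n. fps_nth (geo u) n * z ^ n) sums (z / (1 - u * z))"
proof -
  have "(\<lambda>n. z * (u * z) ^ n) sums (z * (1 / (1 - u * z)))"
    using assms by (intro sums_mult geometric_sums) auto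
  then have "(\<lambda>n. fps_nth (geo u) (Suc n) * z ^ Suc n) sums (z / (1 - u * z))"
    by (simp add: geo_def power_mult_distrib algebra_simps)
  then show ?thesis by (subst (asm) sums_Suc_iff) simp
qed

lemma geo_power_nth:
  assumes "0 < u"
  shows "fps_nth (geo u ^ k) n * u ^ k = fps_nth (geo 1 ^ k) n * u ^ n"
proof -
  have "fps_const u * geo u = fps_compose (geo 1) (fps_const u * fps_X)"
  proof (rule fps_ext)
    fix n show "fps_nth (fps_const u * geo u) n = fps_nth (fps_compose (geo 1) (fps_const u * fps_X)) n"
      by (cases n) (auto simp: geo_def)
  qed
  then have "fps_const u ^ k * geo u ^ k = fps_compose (geo 1 ^ k) (fps_const u * fps_X)"
    by (subst fps_compose_power[symmetric]) (simp_all add: power_mult_distrib[symmetric] del: fps_const_power)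
  then have "fps_nth (fps_const (u ^ k) * geo u ^ k) n = u ^ n * fps_nth (geo 1 ^ k) n"
    by (simp add: fps_const_power)
  then show ?thesis by (simp add: mult.commute)
qed

text \<open>The series \<open>v = X / (1 - X)\<close> satisfies \<open>X (1 - X) v' = v\<close>, hence \<open>X (1 - X) (v\<^sup>k)' = k v\<^sup>k\<close>. (The coefficients of
  \<open>v\<^sup>k\<close> are binomial coefficients.)\<close>

lemma geo_power_rec:
  "(real n + 1 - real k) * fps_nth (geo 1 ^ k) (Suc n) = real n * fps_nth (geo 1 ^ k) n"
proof -
  let ?v = "geo 1"
  have v: "?v * (1 - fps_X) = fps_X" using geo_mult[of 1] by simp
  then have "fps_deriv (?v * (1 - fps_X)) = 1" by simp
  then have d: "fps_deriv ?v * (1 - fps_X) = 1 + ?v" by (simp add: algebra_simps)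
  have "(1 + ?v) * (1 - fps_X) = 1" using v by (simp add: algebra_simps)
  then have d2: "fps_X * (1 - fps_X) * fps_deriv ?v = ?v"
    using d v by (metis (no_types, opaque_lifting) mult.assoc mult.commute mult.left_neutral)
  have V: "fps_X * (1 - fps_X) * fps_deriv (?v ^ k) = of_nat k * ?v ^ k"
  proof (cases k)
    case (Suc j)
    have "fps_X * (1 - fps_X) * fps_deriv (?v ^ k)
        = of_nat k * ?v ^ j * (fps_X * (1 - fps_X) * fps_deriv ?v)"
      unfolding fps_deriv_power fps_of_nat Suc diff_Suc_1 by (simp only: mult_ac)
    then show ?thesis unfolding d2 by (simp add: Suc mult.assoc mult.commute)
  qed simp
  let ?W = "?v ^ k"
  have "fps_nth (fps_X * (1 - fps_X) * fps_deriv ?W) (Suc n)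
      = fps_nth (fps_X * fps_deriv ?W) (Suc n) - fps_nth (fps_X * (fps_X * fps_deriv ?W)) (Suc n)"
    by (simp add: algebra_simps)
  also have "\<dots> = real (Suc n) * fps_nth ?W (Suc n) - real n * fps_nth ?W n"
    by (cases n) auto
  finally have "real (Suc n) * fps_nth ?W (Suc n) - real n * fps_nth ?W n = real k * fps_nth ?W (Suc n)"
    unfolding V by (simp add: fps_of_nat[symmetric])
  then show ?thesis by (simp add: algebra_simps)
qed

text \<open>Read \<open>T\<close> as the series of trees in which \<open>\<phi>\<close> weights the numbers of children. The weight 1 of vertices with exactly one child is split off
  from \<open>\<phi>\<close>, and contraction of the vertices that carry it leaves trees with weights \<open>\<phi>(y) - y\<close>. Replacing every vertex by a path inverts
  the contraction. So the solution is a binomial transform of a nonnegative series.\<close>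

lemma tree_series_contract_unary:
  fixes T \<phi> :: "real fps"
  assumes T: "T = fps_X * fps_compose \<phi> T" and \<phi>: "fps_nonneg \<phi>" "1 \<le> fps_nth \<phi> 1"
  obtains S where "fps_nonneg S" "T = fps_compose S (geo 1)"
proof -
  have T0: "fps_nth T 0 = 0" by (subst T(1)) simp
  define w where "w = geo (- 1)"
  have w: "w * (1 + fps_X) = fps_X" "fps_nth w 0 = 0" using geo_mult[of "- 1"] by (simp_all add: w_def fps_const_neg[symmetric] del: fps_const_neg)
  define S where "S = fps_compose T w"
  have S0: "fps_nth S 0 = 0" using T0 by (simp add: S_def)
  have "S = fps_compose (fps_X * fps_compose \<phi> T) w" using T by (simp add: S_def)
  also have "\<dots> = w * fps_compose (fps_compose \<phi> T) w"
    using w by (simp add: fps_compose_mult_distrib)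
  also have "fps_compose (fps_compose \<phi> T) w = fps_compose \<phi> S"
    unfolding S_def by (rule fps_compose_assoc[symmetric]) (auto simp: w T0)
  finally have "S * (1 + fps_X) = fps_X * fps_compose \<phi> S"
    using w by (metis (no_types, opaque_lifting) mult.assoc mult.commute)
  moreover have "fps_compose (\<phi> - fps_X) S = fps_compose \<phi> S - S"
    using S0 by (simp add: fps_compose_sub_distrib)
  moreover have "S = S * (1 + fps_X) - fps_X * S"
    by (simp add: algebra_simps)
  ultimately have "S = fps_X * fps_compose (\<phi> - fps_X) S"
    by (simp only: right_diff_distrib)
  moreover have "fps_nonneg (\<phi> - fps_X)"
    using \<phi> by (auto simp: fps_nonneg_def fps_X_def)
  ultimately have "fps_nonneg S" by (rule tree_series_nonneg)
  moreover have "T = fps_compose S (geo 1)"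
  proof -
    let ?v = "geo 1"
    have v: "?v * (1 - fps_X) = fps_X" using geo_mult[of 1] by simp
    have "fps_compose (w * (1 + fps_X)) ?v = ?v" using w by simp
    then have "fps_compose w ?v * (1 + ?v) = ?v"
      by (simp add: fps_compose_mult_distrib fps_compose_add_distrib)
    then have "fps_compose w ?v * ((1 + ?v) * (1 - fps_X)) = fps_X"
      using v by (metis mult.assoc)
    moreover have "(1 + ?v) * (1 - fps_X) = 1" using v by (simp add: algebra_simps)
    ultimately have "fps_compose w ?v = fps_X" by simp
    then show ?thesis unfolding S_def
      by (subst fps_compose_assoc[symmetric]) (auto simp: w)
  qed
  ultimately show ?thesis by (rule that)
qed

text \<open>The coefficients of \<open>T\<close> dominate those of \<open>\<phi>\<^sub>2 X T\<^sup>2\<close> and of \<open>\<phi>\<^sub>1 X T\<close>.\<close>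

lemma tree_series_supermult:
  fixes T \<phi> :: "real fps"
  assumes T: "T = fps_X * fps_compose \<phi> T" and \<phi>: "fps_nonneg \<phi>"
  shows "fps_nth \<phi> 2 * fps_nth T m * fps_nth T n \<le> fps_nth T (Suc (m + n))"
    and "fps_nth \<phi> 1 * fps_nth T n \<le> fps_nth T (Suc n)"
proof -
  have T0: "fps_nth T 0 = 0" by (subst T(1)) simp
  have TS: "fps_nth T (Suc k) = (\<Sum>i\<le>max k 2. fps_nth \<phi> i * fps_nth (T ^ i) k)" for k
    by (subst T(1)) (simp add: compose_nth_atMost[OF T0, of k "max k 2" \<phi>])
  have nnT: "fps_nonneg T" by (rule tree_series_nonneg[OF assms])
  have one: "fps_nth \<phi> i * fps_nth (T ^ i) k \<le> fps_nth T (Suc k)" if "i \<le> 2" for i k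
    unfolding TS using that \<phi> fps_nonneg_power[OF nnT]
    by (intro member_le_sum) (auto simp: fps_nonneg_def)
  have "fps_nth T m * fps_nth T n \<le> fps_nth (T ^ 2) (m + n)"
  proof -
    have "fps_nth T m * fps_nth T (m + n - m) \<le> (\<Sum>i\<le>m + n. fps_nth T i * fps_nth T (m + n - i))"
      using nnT by (intro member_le_sum) (auto simp: fps_nonneg_def)
    then show ?thesis by (simp add: power2_eq_square fps_mult_nth atLeast0AtMost)
  qed
  then have "fps_nth \<phi> 2 * (fps_nth T m * fps_nth T n) \<le> fps_nth \<phi> 2 * fps_nth (T ^ 2) (m + n)"
    using \<phi> by (intro mult_left_mono) (auto simp: fps_nonneg_def)
  then show "fps_nth \<phi> 2 * fps_nth T m * fps_nth T n \<le> fps_nth T (Suc (m + n))"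
    using one[of 2 "m + n"] by simp
  show "fps_nth \<phi> 1 * fps_nth T n \<le> fps_nth T (Suc n)"
    using one[of 1 n] by simp
qed

text \<open>The exponential growth rate is in general only a limes superior; supermultiplicativity enforces it along all \<open>n\<close>.\<close>

lemma supermult_growth:
  fixes c :: "nat \<Rightarrow> real"
  assumes pos: "\<And>n. 0 < n \<Longrightarrow> 0 < c n" and b: "0 < b"
    and super: "\<And>m n. b * c m * c n \<le> c (Suc (m + n))"
    and \<rho>: "0 < \<rho>" "\<And>z. \<rho> < z \<Longrightarrow> \<not> summable (\<lambda>k. c k * z ^ k)" and r': "\<rho> < r'"
  shows "eventually (\<lambda>n. (1 / r') ^ n \<le> c n) sequentially"
proof -
  \<comment> \<open>three rates \<open>\<rho> < z < r < r'\<close>: unboundedness at \<open>r\<close> comes from divergence at \<open>z\<close>, and the gap to \<open>r'\<close> absorbs a constant\<close>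
  define r where "r = (\<rho> + r') / 2"
  have r: "\<rho> < r" "r < r'" "0 < r" using r' \<rho> by (auto simp: r_def)
  define z where "z = (\<rho> + r) / 2"
  have z: "\<rho> < z" "z < r" "0 < z" using r \<rho> by (auto simp: z_def)
  have "\<exists>m>0. 1 \<le> b * c m * r ^ Suc m"
  proof (rule ccontr)
    assume neg: "\<not> (\<exists>m>0. 1 \<le> b * c m * r ^ Suc m)"
    have *: "b * c m * r ^ Suc m < 1" if "0 < m" for m
      using neg that by (meson not_le)
    have "c m * r ^ m \<le> 1 / (b * r)" if "0 < m" for m
      using *[OF that] b r by (simp add: field_simps)
    then have bd: "norm (c m * r ^ m) \<le> max \<bar>c 0\<bar> (1 / (b * r))" for m
      using pos[of m] r by (cases "m = 0") (auto simp: abs_mult intro: max.coboundedI2)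
    have "summable (\<lambda>k. c k * z ^ k)"
    proof (rule summable_comparison_test')
      show "summable (\<lambda>k. max \<bar>c 0\<bar> (1 / (b * r)) * (z / r) ^ k)"
        using z r by (intro summable_mult summable_geometric) auto
      fix k :: nat
      have "c k * z ^ k = c k * r ^ k * (z / r) ^ k" using r by (simp add: power_divide)
      then have "norm (c k * z ^ k) = norm (c k * r ^ k) * (z / r) ^ k"
        using z r by (simp add: abs_mult)
      also have "\<dots> \<le> max \<bar>c 0\<bar> (1 / (b * r)) * (z / r) ^ k"
        using bd z r by (intro mult_right_mono) auto
      finally show "norm (c k * z ^ k) \<le> max \<bar>c 0\<bar> (1 / (b * r)) * (z / r) ^ k" .
    qed
    then show False using \<rho>(2) z by blast
  qed
  then obtain m where m: "0 < m" "1 \<le> b * c m * r ^ Suc m" by blast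
  define e where "e = (\<lambda>n. c n * r ^ n)"
  \<comment> \<open>supermultiplicativity with this fixed \<open>m\<close> makes \<open>e\<close> nondecreasing along steps of length \<open>p\<close>\<close>
  define p where "p = Suc m"
  have step: "e n \<le> e (n + p)" if "0 < n" for n
  proof -
    have "e n * 1 \<le> e n * (b * c m * r ^ Suc m)"
      using m(2) pos[OF that] r by (intro mult_left_mono) (auto simp: e_def)
    also have "\<dots> = (b * c m * c n) * r ^ (n + p)"
      by (simp add: e_def p_def power_add algebra_simps)
    also have "\<dots> \<le> c (Suc (m + n)) * r ^ (n + p)"
      using super r by (intro mult_right_mono) auto
    also have "\<dots> = e (n + p)" by (simp add: e_def p_def add.commute)
    finally show ?thesis by simp
  qed
  define \<delta> where "\<delta> = Min (e ` {1..p})"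
  have \<delta>: "0 < \<delta>" using pos r by (auto simp: \<delta>_def p_def e_def)
  have low: "\<delta> \<le> e n" if "0 < n" for n
    using that
  proof (induction n rule: less_induct)
    case (less n)
    show ?case
    proof (cases "n \<le> p")
      case True
      then show ?thesis using less.prems by (auto simp: \<delta>_def intro!: Min_le)
    next
      case False
      then show ?thesis using less.IH[of "n - p"] step[of "n - p"] by (simp add: p_def)
    qed
  qed
  have "(\<lambda>n. (r / r') ^ n) \<longlonglongrightarrow> 0" using r by (intro LIMSEQ_power_zero) auto
  then have "eventually (\<lambda>n. (r / r') ^ n < \<delta>) sequentially"
    using \<delta> by (rule order_tendstoD(2))
  then show ?thesis
    using eventually_gt_at_top[of 0]
  proof eventually_elim
    case (elim n)
    then have "(r / r') ^ n \<le> c n * r ^ n" using low[of n] by (simp add: e_def)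
    then show ?case using r by (simp add: power_divide field_simps)
  qed
qed

text \<open>Let \<open>c\<^sub>n\<close> be the coefficients of \<open>T\<close>. In a random tree with \<open>n\<close> vertices, drawn with the weights \<open>\<phi>\<close>, the expected number of contractible
  vertices with exactly one child is \<open>(n - 1) c\<^sub>n\<^sub>-\<^sub>1 / c\<^sub>n\<close>. The moment generating function of this number is, up to
  subexponential factors, at most \<open>(1 - \<rho> + \<rho> e\<^sup>s)\<^sup>n\<close>, and convexity of the exponential function
  transfers this bound to the mean; both signs of \<open>s\<close> together pin the mean down to \<open>\<rho> n\<close>.\<close>

lemma tree_series_ratio:
  fixes T \<phi> :: "real fps"
  assumes T: "T = fps_X * fps_compose \<phi> T"
    and \<phi>: "fps_nonneg \<phi>" "fps_nth \<phi> 0 = 1" "1 \<le> fps_nth \<phi> 1" "0 < fps_nth \<phi> 2"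
    and \<rho>: "0 < \<rho>" "summable (\<lambda>k. fps_nth T k * \<rho> ^ k)"
    and radius: "\<And>z. \<rho> < z \<Longrightarrow> \<not> summable (\<lambda>k. fps_nth T k * z ^ k)"
  shows "(\<lambda>n. fps_nth T n / fps_nth T (Suc n)) \<longlonglongrightarrow> \<rho>"
proof -
  define c where "c = fps_nth T"
  have c0: "c 0 = 0" unfolding c_def by (subst T(1)) simp
  have c1: "c (Suc 0) = 1" unfolding c_def by (subst T(1)) (simp add: \<phi>)
  have nnT: "fps_nonneg T" by (rule tree_series_nonneg[OF T \<phi>(1)])
  have mono: "c n \<le> c (Suc n)" for n
  proof -
    have "1 * c n \<le> fps_nth \<phi> 1 * c n"
      using \<phi>(3) nnT by (intro mult_right_mono) (auto simp: c_def fps_nonneg_def)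
    then show ?thesis using tree_series_supermult(2)[OF T \<phi>(1), of n] by (simp add: c_def)
  qed
  have ge1: "1 \<le> c n" if "0 < n" for n
    using that
  proof (induction n)
    case (Suc n)
    then show ?case using mono[of n] c1 by (cases "n = 0") auto
  qed simp
  have \<rho>1: "\<rho> < 1"
  proof (rule ccontr)
    assume "\<not> \<rho> < 1"
    then have "1 \<le> c k * \<rho> ^ k" if "0 < k" for k
      using mult_mono[OF ge1[OF that] one_le_power[of \<rho> k]] ge1[OF that] by simp
    moreover have "(\<lambda>k. c k * \<rho> ^ k) \<longlonglongrightarrow> 0"
      using summable_LIMSEQ_zero[OF \<rho>(2)] by (simp add: c_def)
    ultimately have "(1 :: real) \<le> 0"
      by (intro LIMSEQ_le_const[where X = "\<lambda>k. c k * \<rho> ^ k"]) (auto intro!: exI[of _ 1])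
    then show False by simp
  qed
  obtain S where S: "fps_nonneg S" "T = fps_compose S (geo 1)"
    using tree_series_contract_unary[OF T \<phi>(1,3)] .
  define d where "d = fps_nth S"
  define V where "V = (\<lambda>k n. fps_nth (geo 1 ^ k) n)"
  define y where "y = \<rho> / (1 - \<rho>)"
  have y0: "0 \<le> y" using \<rho> \<rho>1 by (simp add: y_def)
  have d0: "0 \<le> d k" for k using S(1) by (simp add: d_def fps_nonneg_def)
  have V0: "0 \<le> V k n" for k n
    using fps_nonneg_power[OF geo_nonneg[of 1]] by (simp add: V_def fps_nonneg_def)
  have cV: "c n = (\<Sum>k\<le>n. d k * V k n)" for n
    unfolding c_def S(2) d_def V_def by (rule compose_nth_atMost) auto
  have cV': "c n = (\<Sum>k\<le>Suc n. d k * V k n)" for n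
    unfolding c_def S(2) d_def V_def by (rule compose_nth_atMost) auto
  have "summable (\<lambda>j. d j * y ^ j)"
  proof (rule nonneg_partial_sums_bounded(1))
    show "0 \<le> d j * y ^ j" for j using d0 y0 by simp
    show "(\<Sum>j\<le>J. d j * y ^ j) \<le> (\<Sum>k. fps_nth (fps_compose S (geo 1)) k * \<rho> ^ k)" for J
      unfolding d_def y_def using \<rho> \<rho>1 S geo_sums[of 1 \<rho>]
      by (intro compose_outer_partial_sum_le) (auto intro!: geo_nonneg)
  qed
  then obtain K where K: "(\<lambda>j. d j * y ^ j) sums K" by (auto simp: summable_def)
  \<comment> \<open>\<open>P n s\<close> below is \<open>c n\<close> with weight \<open>exp s\<close> for each vertex with one child, and \<open>\<theta> s\<close> bounds its growth rate\<close>
  define \<theta> where "\<theta> = (\<lambda>s. 1 / \<rho> - 1 + exp s)"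
  have \<theta>: "0 < \<theta> s" "exp s < \<theta> s" for s using \<rho> \<rho>1 by (auto simp: \<theta>_def intro: add_nonneg_pos)
  define P where "P = (\<lambda>n s. \<Sum>k\<le>n. d k * V k n * exp (s * (real n - real k)))"
  have Pu: "P n s \<le> K * \<theta> s ^ n" for n s
  proof -
    let ?u = "exp s"
    \<comment> \<open>at the point \<open>1 / \<theta> s\<close> the inner series has the same value \<open>y\<close> for every \<open>s\<close>, so one constant \<open>K\<close> bounds all \<open>P n s\<close>\<close>
    have val: "(1 / \<theta> s) / (1 - ?u * (1 / \<theta> s)) = y"
    proof -
      have "(1 / \<theta> s) / (1 - ?u * (1 / \<theta> s)) = 1 / (\<theta> s - ?u)" using \<theta>[of s] by (simp add: field_simps)
      also have "\<dots> = y" using \<rho> \<rho>1 by (simp add: \<theta>_def y_def field_simps)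
      finally show ?thesis .
    qed
    have g: "(\<lambda>j. fps_nth (geo ?u) j * (1 / \<theta> s) ^ j) sums y"
      using geo_sums[of ?u "1 / \<theta> s"] \<theta>[of s] val by simp
    have s1: "(\<lambda>j. fps_nth (fps_compose S (geo ?u)) j * (1 / \<theta> s) ^ j) sums K"
      using K \<theta>[of s] by (intro compose_sums[OF S(1) _ _ _ g]) (auto simp: geo_nonneg d_def)
    have nn: "0 \<le> fps_nth (fps_compose S (geo ?u)) j * (1 / \<theta> s) ^ j" for j
      using fps_nonneg_compose[OF S(1) geo_nonneg[of ?u]] \<theta>[of s] by (simp add: fps_nonneg_def)
    have "fps_nth (fps_compose S (geo ?u)) n * (1 / \<theta> s) ^ n \<le> K"
      using s1 sum_le_suminf[of _ "{n}", OF sums_summable[OF s1]] nn by (simp add: sums_iff)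
    moreover have "fps_nth (fps_compose S (geo ?u)) n = P n s"
      unfolding P_def compose_nth_atMost[OF geo_0 order_refl]
    proof (rule sum.cong)
      fix k assume "k \<in> {..n}"
      have "fps_nth (geo ?u ^ k) n = V k n * (?u ^ n / ?u ^ k)"
        using geo_power_nth[of ?u k n] by (simp add: V_def field_simps)
      also have "?u ^ n / ?u ^ k = exp (s * (real n - real k))"
        by (simp add: exp_of_nat_mult[symmetric] exp_diff right_diff_distrib mult.commute)
      finally show "fps_nth S k * fps_nth (geo ?u ^ k) n = d k * V k n * exp (s * (real n - real k))"
        by (simp add: d_def)
    qed simp
    ultimately show ?thesis using \<theta>[of s] by (simp add: field_simps power_divide)
  qed
  define m where "m = (\<lambda>n. real (n - 1) * c (n - 1) / c n)"
  have mean: "(\<Sum>k\<le>n. d k * V k n * (real n - real k)) = m n * c n" if n: "0 < n" for n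
  proof -
    obtain l where l: "n = Suc l" using n by (cases n) auto
    have "(\<Sum>k\<le>n. d k * V k n * (real n - real k)) = (\<Sum>k\<le>n. real l * (d k * V k l))"
      using geo_power_rec[of l] by (intro sum.cong) (auto simp: l V_def algebra_simps)
    also have "\<dots> = real l * c l"
      unfolding cV' l by (simp only: sum_distrib_left)
    finally show ?thesis using ge1[OF n] by (simp add: m_def l)
  qed
  have jensen: "c n * exp (s * m n) \<le> P n s" if n: "0 < n" for n s
  proof -
    have "(\<Sum>k\<le>n. d k * V k n * (exp (s * m n) * (1 + s * (real n - real k - m n)))) \<le> P n s"
      unfolding P_def
    proof (rule sum_mono)
      fix k
      \<comment> \<open>the tangent of the exponential function at the mean\<close>
      have "exp (s * m n) * (1 + s * (real n - real k - m n))
          \<le> exp (s * m n) * exp (s * (real n - real k - m n))"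
        by (intro mult_left_mono exp_ge_add_one_self) auto
      also have "\<dots> = exp (s * (real n - real k))" by (simp add: exp_add[symmetric] algebra_simps)
      finally show "d k * V k n * (exp (s * m n) * (1 + s * (real n - real k - m n)))
          \<le> d k * V k n * exp (s * (real n - real k))"
        using d0 V0 by (intro mult_left_mono) auto
    qed
    also have "(\<Sum>k\<le>n. d k * V k n * (exp (s * m n) * (1 + s * (real n - real k - m n))))
        = (\<Sum>k\<le>n. exp (s * m n) * ((1 - s * m n) * (d k * V k n)
            + s * (d k * V k n * (real n - real k))))"
      by (intro sum.cong) (auto simp: algebra_simps)
    also have "\<dots> = exp (s * m n) * ((1 - s * m n) * (\<Sum>k\<le>n. d k * V k n)
            + s * (\<Sum>k\<le>n. d k * V k n * (real n - real k)))"
      by (simp only: sum_distrib_left[symmetric] sum.distrib)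
    also have "\<dots> = c n * exp (s * m n)"
      unfolding mean[OF n] cV[symmetric] by (simp add: algebra_simps)
    finally show ?thesis .
  qed
  define q where "q = (\<lambda>n. m n / real n)"
  define h where "h = (\<lambda>s. ln (1 - \<rho> + \<rho> * exp s))"
  have hpos: "0 < 1 - \<rho> + \<rho> * exp s" for s using \<rho> \<rho>1 by (simp add: add_pos_pos)
  have key: "eventually (\<lambda>n. s * q n < h s + \<epsilon>) sequentially" if \<epsilon>: "0 < \<epsilon>" for s \<epsilon>
  proof -
    define r where "r = \<rho> * exp (\<epsilon> / 2)"
    have r: "\<rho> < r" using \<rho> \<epsilon> by (simp add: r_def)
    have growth: "eventually (\<lambda>n. (1 / r) ^ n \<le> c n) sequentially"
    proof (rule supermult_growth[OF _ \<phi>(4) _ \<rho>(1) _ r])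
      show "0 < c n" if "0 < n" for n using ge1[OF that] by simp
      show "fps_nth \<phi> 2 * c m * c n \<le> c (Suc (m + n))" for m n
        using tree_series_supermult(1)[OF T \<phi>(1)] by (simp add: c_def)
      show "\<not> summable (\<lambda>k. c k * z ^ k)" if "\<rho> < z" for z
        using radius[OF that] by (simp add: c_def)
    qed
    define K' where "K' = max K 1"
    have "(\<lambda>n. ln K' / real n) \<longlonglongrightarrow> 0" by (rule lim_const_over_n)
    then have "eventually (\<lambda>n. ln K' / real n < \<epsilon> / 2) sequentially"
      using \<epsilon> by (intro order_tendstoD(2)) auto
    with growth show ?thesis
      using eventually_gt_at_top[of 0]
    proof eventually_elim
      case (elim n)
      have "(1 / r) ^ n * exp (s * m n) \<le> c n * exp (s * m n)"
        using elim by (intro mult_right_mono) auto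
      also have "\<dots> \<le> K * \<theta> s ^ n" using jensen[of n s] Pu[of n s] elim by simp
      also have "\<dots> \<le> K' * \<theta> s ^ n" using \<theta>[of s] by (intro mult_right_mono) (auto simp: K'_def)
      finally have "exp (s * m n) \<le> K' * (r * \<theta> s) ^ n"
        using r \<rho> by (simp add: power_divide power_mult_distrib field_simps)
      also have "r * \<theta> s = exp (\<epsilon> / 2) * (1 - \<rho> + \<rho> * exp s)"
        using \<rho> by (simp add: r_def \<theta>_def field_simps)
      finally have "exp (s * m n) \<le> K' * (exp (\<epsilon> / 2) * (1 - \<rho> + \<rho> * exp s)) ^ n" .
      then have "ln (exp (s * m n)) \<le> ln (K' * (exp (\<epsilon> / 2) * (1 - \<rho> + \<rho> * exp s)) ^ n)"
        by (intro ln_mono) (auto intro!: mult_pos_pos simp: K'_def hpos)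
      also have "\<dots> = ln K' + real n * (\<epsilon> / 2 + h s)"
        using hpos[of s] by (simp add: ln_mult ln_realpow K'_def h_def)
      finally have "s * m n \<le> ln K' + real n * (\<epsilon> / 2 + h s)" by simp
      then have "s * q n \<le> ln K' / real n + (\<epsilon> / 2 + h s)"
        using elim by (simp add: q_def field_simps)
      then show ?case using elim by linarith
    qed
  qed
  have dh: "(h has_real_derivative \<rho>) (at 0)"
    unfolding h_def by (rule derivative_eq_intros refl | simp)+
  have lim_h: "((\<lambda>s. h s / s) \<longlongrightarrow> \<rho>) (at 0)"
    using dh unfolding has_field_derivative_iff by (simp add: h_def)
  have "q \<longlonglongrightarrow> \<rho>"
  proof (rule order_tendstoI)
    fix a assume a: "\<rho> < a"
    have "eventually (\<lambda>s. h s / s < a) (at_right 0)"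
      using order_tendstoD(2)[OF lim_h a] unfolding eventually_at_split by blast
    then have "eventually (\<lambda>s. h s / s < a \<and> 0 < s) (at_right 0)"
      using eventually_at_right_less[of 0] by (rule eventually_conj)
    then obtain s where s: "h s / s < a" "0 < s"
      using eventually_happens'[OF trivial_limit_at_right_real[of "0 :: real"]] by blast
    have "0 < s * a - h s" using s by (simp add: field_simps)
    from key[OF this, of s] show "eventually (\<lambda>n. q n < a) sequentially"
      using s by (auto elim!: eventually_mono)
  next
    fix a assume a: "a < \<rho>"
    have "eventually (\<lambda>s. a < h s / s) (at_left 0)"
      using order_tendstoD(1)[OF lim_h a] unfolding eventually_at_split by blast
    then have "eventually (\<lambda>s. a < h s / s \<and> s < 0) (at_left 0)"
      by (rule eventually_conj) (simp add: eventually_at_filter)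
    then obtain s where s: "a < h s / s" "s < 0"
      using eventually_happens'[OF trivial_limit_at_left_real[of "0 :: real"]] by blast
    have "0 < s * a - h s" using s by (simp add: field_simps)
    from key[OF this, of s] show "eventually (\<lambda>n. a < q n) sequentially"
      using s by (auto elim!: eventually_mono)
  qed
  then have "(\<lambda>n. q (Suc n)) \<longlonglongrightarrow> \<rho>" by (rule LIMSEQ_Suc)
  moreover have "(\<lambda>n. real (Suc n) / real n) \<longlonglongrightarrow> 1"
    using LIMSEQ_Suc_n_over_n by simp
  ultimately have "(\<lambda>n. q (Suc n) * (real (Suc n) / real n)) \<longlonglongrightarrow> \<rho> * 1"
    by (intro tendsto_mult)
  moreover have "eventually (\<lambda>n. q (Suc n) * (real (Suc n) / real n) = c n / c (Suc n)) sequentially"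
    using eventually_gt_at_top[of 0]
  proof eventually_elim
    case (elim n)
    have "q (Suc n) * real (Suc n) = real n * (c n / c (Suc n))" by (simp add: q_def m_def)
    then show ?case using elim by simp
  qed
  ultimately show ?thesis unfolding c_def[symmetric] mult_1_right
    by (rule Lim_transform_eventually)
qed

section \<open>Reachability and connectedness\<close>

lemma graph_eq_iff: "G = H \<longleftrightarrow> verts G = verts H \<and> edges G = edges H"
  by (cases G; cases H) auto

lemma sgraph_edge:
  assumes "sgraph G" "{a, b} \<in> edges G"
  shows "a \<in> verts G" "b \<in> verts G" "a \<noteq> b"
proof -
  have c: "card {a, b} = 2" and "{a, b} \<subseteq> verts G" using bspec[OF assms(1)[unfolded sgraph_def] assms(2)] by simp_all
  then show "a \<in> verts G" "b \<in> verts G" by simp_all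
  show "a \<noteq> b" using c by auto
qed

lemma sgraph_subset: "sgraph G \<Longrightarrow> e \<in> edges G \<Longrightarrow> e \<subseteq> verts G"
  by (simp add: sgraph_def)

lemma sgraph_edge_obtain:
  assumes "sgraph G" "e \<in> edges G"
  obtains a b where "e = {a, b}" "a \<noteq> b" "a \<in> verts G" "b \<in> verts G"
proof -
  have "card e = 2" using assms by (simp add: sgraph_def)
  then obtain a b where ab: "e = {a, b}" "a \<noteq> b" by (auto simp: card_2_iff)
  then show ?thesis using that[OF ab] sgraph_edge[OF assms(1), of a b] assms(2) by simp
qed

lemma adj_iff: "(a, b) \<in> adj G \<longleftrightarrow> {a, b} \<in> edges G"
  by (simp add: adj_def)

lemma sym_adj: "sym (adj G)"
  by (simp add: sym_def adj_def insert_commute)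

lemma reach_sym: "(a, b) \<in> (adj G)\<^sup>* \<Longrightarrow> (b, a) \<in> (adj G)\<^sup>*"
  using sym_rtrancl[OF sym_adj, of G] by (auto simp: sym_def)

lemma reach_mono:
  assumes "(a, b) \<in> (adj G)\<^sup>*" "edges G \<subseteq> edges H"
  shows "(a, b) \<in> (adj H)\<^sup>*"
proof -
  have "adj G \<subseteq> adj H" using assms(2) by (auto simp: adj_def)
  then show ?thesis using rtrancl_mono[of "adj G" "adj H"] assms(1) by blast
qed

lemma reach_closed:
  assumes "(u, v) \<in> (adj G)\<^sup>*" "u \<in> S"
    and "\<And>a b. a \<in> S \<Longrightarrow> {a, b} \<in> edges G \<Longrightarrow> b \<in> S"
  shows "v \<in> S"
  using assms(1,2)
proof (induction rule: rtrancl_induct)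
  case (step y z)
  show ?case using assms(3)[of y z] step by (simp add: adj_iff)
qed

lemma gconnected_closed:
  assumes "gconnected G" "u \<in> verts G" "u \<in> S"
    and "\<And>a b. a \<in> S \<Longrightarrow> {a, b} \<in> edges G \<Longrightarrow> b \<in> S"
  shows "verts G \<subseteq> S"
proof
  fix v assume "v \<in> verts G"
  then have "(u, v) \<in> (adj G)\<^sup>*" using assms(1,2) by (simp add: gconnected_def)
  from reach_closed[OF this assms(3,4)] show "v \<in> S" .
qed

lemma gconnectedI:
  assumes "w \<in> verts G" "\<And>u. u \<in> verts G \<Longrightarrow> (w, u) \<in> (adj G)\<^sup>*"
  shows "gconnected G"
  unfolding gconnected_def
proof (intro conjI ballI)
  fix u v assume u: "u \<in> verts G" and v: "v \<in> verts G"
  show "(u, v) \<in> (adj G)\<^sup>*"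
    using reach_sym[OF assms(2)[OF u]] assms(2)[OF v] by (rule rtrancl_trans)
qed (use assms(1) in blast)

lemma gconnected_reach:
  "gconnected G \<Longrightarrow> u \<in> verts G \<Longrightarrow> v \<in> verts G \<Longrightarrow> (u, v) \<in> (adj G)\<^sup>*"
  by (simp add: gconnected_def)

definition gunion :: "'v graph \<Rightarrow> 'v graph \<Rightarrow> 'v graph" where
  "gunion G H = Graph (verts G \<union> verts H) (edges G \<union> edges H)"

lemma gunion_simps [simp]:
  "verts (gunion G H) = verts G \<union> verts H" "edges (gunion G H) = edges G \<union> edges H"
  by (simp_all add: gunion_def)

lemma gunion_commute: "gunion G H = gunion H G"
  by (auto simp: gunion_def)

lemma sgraph_gunion: "sgraph G \<Longrightarrow> sgraph H \<Longrightarrow> sgraph (gunion G H)"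
  unfolding sgraph_def by auto

lemma induced_simps [simp]:
  "verts (induced G S) = verts G \<inter> S" "edges (induced G S) = {e \<in> edges G. e \<subseteq> S}"
  by (simp_all add: induced_def)

lemma induced_all: "sgraph G \<Longrightarrow> verts G \<subseteq> S \<Longrightarrow> induced G S = G"
  by (auto simp: graph_eq_iff sgraph_def)

lemma subgraph_trans: "subgraph H G \<Longrightarrow> subgraph G K \<Longrightarrow> subgraph H K"
  by (auto simp: subgraph_def)

lemma subgraph_antisym: "subgraph H G \<Longrightarrow> subgraph G H \<Longrightarrow> H = G"
  by (auto simp: subgraph_def graph_eq_iff)

lemma two_connected_minus:
  assumes "two_connected D" "sgraph D"
  shows "gconnected (induced D (verts D - {w}))"
proof (cases "w \<in> verts D")
  case False
  then show ?thesis using assms by (simp add: induced_all two_connected_def)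
qed (use assms in \<open>auto simp: two_connected_def\<close>)

section \<open>Graphs that share one vertex\<close>

text \<open>If the subgraph had vertices other than the shared one on both sides, deletion of the shared vertex would disconnect it.\<close>

lemma two_connected_one_side:
  assumes G: "sgraph G1" "sgraph G2" "verts G1 \<inter> verts G2 = {w}"
    and D: "subgraph D (gunion G1 G2)" "two_connected D"
  shows "subgraph D G1 \<or> subgraph D G2"
proof -
  have sD: "sgraph D" using D by (simp add: subgraph_def)
  have side: "subgraph D K1" if K: "sgraph K1" "sgraph K2" "verts K1 \<inter> verts K2 = {w}"
    "subgraph D (gunion K1 K2)" and vD: "verts D \<subseteq> verts K1" for K1 K2
  proof -
    have "e \<in> edges K1" if e: "e \<in> edges D" for e
    proof (rule ccontr)
      assume "e \<notin> edges K1"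
      moreover have "edges D \<subseteq> edges K1 \<union> edges K2" using K(4) by (simp add: subgraph_def)
      ultimately have eK: "e \<in> edges K2" using e by blast
      obtain a b where ab: "e = {a, b}" "a \<noteq> b" "a \<in> verts K2" "b \<in> verts K2"
        by (rule sgraph_edge_obtain[OF K(2) eK])
      have "e \<subseteq> verts D" by (rule sgraph_subset[OF sD e])
      then have "{a, b} \<subseteq> verts K1 \<inter> verts K2" using ab vD by auto
      then show False using ab(2) unfolding K(3) by simp
    qed
    then show ?thesis using sD vD by (auto simp: subgraph_def)
  qed
  show ?thesis
  proof (cases "\<exists>u\<in>verts D. u \<in> verts G1 \<and> u \<noteq> w")
    case True
    then obtain u where u: "u \<in> verts D" "u \<in> verts G1" "u \<noteq> w" by blast
    let ?D = "induced D (verts D - {w})"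
    have "verts ?D \<subseteq> verts G1 - {w}"
    proof (rule gconnected_closed[OF two_connected_minus[OF D(2) sD]])
      show "u \<in> verts ?D" "u \<in> verts G1 - {w}" using u by auto
    next
      fix a b assume ab: "a \<in> verts G1 - {w}" "{a, b} \<in> edges ?D"
      then have "{a, b} \<in> edges G1 \<union> edges G2" "b \<noteq> w"
        using D(1) by (auto simp: subgraph_def)
      then show "b \<in> verts G1 - {w}"
        using ab G sgraph_edge[of G1 a b] sgraph_edge[of G2 a b] by auto
    qed
    then have "verts D \<subseteq> verts G1" using G(3) by auto
    then show ?thesis using side[OF G D(1)] by simp
  next
    case False
    then have "verts D \<subseteq> verts G2" using D(1) G(3) by (auto simp: subgraph_def)
    then show ?thesis using side[of G2 G1] G D(1) by (auto simp: gunion_commute Int_commute)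
  qed
qed

definition K1 :: "'v \<Rightarrow> 'v graph" where
  "K1 v = Graph {v} {}"

lemma K1_simps [simp]: "verts (K1 v) = {v}" "edges (K1 v) = {}"
  by (simp_all add: K1_def)

lemma gconnected_K1: "gconnected (K1 v)"
  by (auto simp: gconnected_def)

lemma two_connected_ne: 
  assumes "two_connected B"
  shows "finite (verts B)" "verts B \<noteq> {}" "\<not> verts B \<subseteq> {v}"
proof -
  have c: "2 \<le> card (verts B)" using assms by (simp add: two_connected_def)
  then show "finite (verts B)" "verts B \<noteq> {}" by (auto intro: card_ge_0_finite)
  show "\<not> verts B \<subseteq> {v}" using c card_mono[of "{v}" "verts B"] by auto
qed

lemma subgraph_refl: "sgraph G \<Longrightarrow> subgraph G G"
  by (simp add: subgraph_def)

definition attach :: "'v graph \<Rightarrow> ('v \<Rightarrow> 'v graph) \<Rightarrow> 'v set \<Rightarrow> 'v graph" where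
  "attach B H I = Graph (verts B \<union> (\<Union>v\<in>I. verts (H v))) (edges B \<union> (\<Union>v\<in>I. edges (H v)))"

lemma attach_simps [simp]:
  "verts (attach B H I) = verts B \<union> (\<Union>v\<in>I. verts (H v))"
  "edges (attach B H I) = edges B \<union> (\<Union>v\<in>I. edges (H v))"
  by (simp_all add: attach_def)

lemma sgraph_attach:
  assumes "sgraph B" "\<And>v. v \<in> I \<Longrightarrow> sgraph (H v)"
  shows "sgraph (attach B H I)"
  unfolding sgraph_def
proof
  fix e assume "e \<in> edges (attach B H I)"
  then consider "e \<in> edges B" | v where "v \<in> I" "e \<in> edges (H v)" by auto
  then show "e \<subseteq> verts (attach B H I) \<and> card e = 2"
  proof cases
    case 1
    then show ?thesis using assms(1) by (auto simp: sgraph_def)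
  next
    case 2
    then have "e \<subseteq> verts (H v) \<and> card e = 2" using assms(2)[OF 2(1)] by (simp add: sgraph_def)
    then show ?thesis using 2(1) by auto
  qed
qed

definition minus_block :: "nat graph \<Rightarrow> nat graph \<Rightarrow> nat graph" where
  "minus_block G B = Graph (verts G) (edges G - edges B)"

lemma minus_block_simps [simp]:
  "verts (minus_block G B) = verts G" "edges (minus_block G B) = edges G - edges B"
  by (simp_all add: minus_block_def)

locale stable_class =
  fixes \<G> :: "nat graph set"
  assumes stable: "block_stable \<G>"
begin

lemma is_graph_class: "graph_class \<G>"
  using stable by (rule block_stable_def[THEN iffD1, THEN conjunct1])

lemma in_class_fin: "G \<in> \<G> \<Longrightarrow> fin_sgraph G"
  using is_graph_class[unfolded graph_class_def, THEN conjunct1] by (rule bspec)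

lemma in_class_sgraph: "G \<in> \<G> \<Longrightarrow> sgraph G"
  using in_class_fin by (auto simp: fin_sgraph_def)

lemma in_class_iso: "G \<in> \<G> \<Longrightarrow> graph_iso f G H \<Longrightarrow> H \<in> \<G>"
  by (rule is_graph_class[unfolded graph_class_def, THEN conjunct2, THEN bspec, THEN spec, THEN spec, THEN mp])

lemma in_class_iff: "fin_sgraph G \<Longrightarrow> G \<in> \<G> \<longleftrightarrow> (\<forall>H. is_block_of H G \<longrightarrow> H \<in> \<G>)"
  by (rule block_stable_def[THEN iffD1, THEN conjunct2, THEN conjunct2, OF stable, THEN spec, THEN mp])

lemma K1_in_class: "K1 v \<in> \<G>"
proof -
  have "\<not> is_block_of H (K1 v)" for H
    using two_connected_ne(3)[of H v] by (auto simp: is_block_of_def subgraph_def)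
  then show ?thesis by (subst in_class_iff) (auto simp: fin_sgraph_def sgraph_def)
qed

text \<open>Gluing at a single vertex creates no 2-connected subgraph across the two sides, so a block of one part remains a block
  of the union.\<close>

lemma gunion_parts_in_class:
  assumes G: "gunion G1 G2 \<in> \<G>" and s: "sgraph G1" "sgraph G2" "verts G1 \<inter> verts G2 = {w}"
  shows "G1 \<in> \<G>"
proof -
  have fin: "fin_sgraph G1" using in_class_fin[OF G] s by (auto simp: fin_sgraph_def)
  have "H \<in> \<G>" if H: "is_block_of H G1" for H
  proof -
    have H1: "subgraph H G1" "two_connected H" using H by (auto simp: is_block_of_def)
    have "is_block_of H (gunion G1 G2)"
      unfolding is_block_of_def
    proof (intro conjI allI impI)
      show "subgraph H (gunion G1 G2)" using H1 by (auto simp: subgraph_def)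
      fix H' assume H': "subgraph H' (gunion G1 G2) \<and> two_connected H' \<and> subgraph H H'"
      consider "subgraph H' G1" | "subgraph H' G2"
        using two_connected_one_side[OF s] H' by blast
      then show "H' = H"
      proof cases
        case 1
        then show ?thesis using H H' by (auto simp: is_block_of_def)
      next
        case 2
        then have "verts H \<subseteq> verts G1 \<inter> verts G2" using H1 H' by (auto simp: subgraph_def)
        then show ?thesis using two_connected_ne(3)[OF H1(2)] unfolding s(3) by blast
      qed
    qed (use H1 in auto)
    then show ?thesis using G in_class_iff[OF in_class_fin[OF G]] by blast
  qed
  then show ?thesis using in_class_iff[OF fin] by blast
qed

text \<open>A maximal 2-connected subgraph of \<open>G\<close> that lies in a subgraph \<open>K\<close> of \<open>G\<close> is also maximal in \<open>K\<close>, so it belongs to the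
  class if \<open>K\<close> does.\<close>

lemma in_class_if_blocks_covered:
  assumes fin: "fin_sgraph G"
    and cover: "\<And>D. subgraph D G \<Longrightarrow> two_connected D \<Longrightarrow> \<exists>K\<in>\<G>. subgraph D K \<and> subgraph K G"
  shows "G \<in> \<G>"
proof -
  have "H \<in> \<G>" if H: "is_block_of H G" for H
  proof -
    have H1: "subgraph H G" "two_connected H" using H by (auto simp: is_block_of_def)
    then obtain K where K: "K \<in> \<G>" "subgraph H K" "subgraph K G" using cover by blast
    have "is_block_of H K"
      using H K unfolding is_block_of_def by (blast intro: subgraph_trans)
    then show ?thesis using K(1) in_class_iff[OF in_class_fin[OF K(1)]] by blast
  qed
  then show ?thesis using in_class_iff[OF fin] by blast
qed

lemma conn_classD:
  assumes "G \<in> conn_class \<G>"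
  shows "G \<in> \<G>" "gconnected G" "sgraph G" "finite (verts G)"
  using assms in_class_fin by (auto simp: conn_class_def fin_sgraph_def)

lemma block_classD:
  assumes "G \<in> block_class \<G>"
  shows "G \<in> \<G>" "two_connected G" "sgraph G" "finite (verts G)" "gconnected G"
  using assms in_class_fin by (auto simp: block_class_def fin_sgraph_def two_connected_def)

lemma K1_in_conn_class: "K1 v \<in> conn_class \<G>"
  by (simp add: conn_class_def K1_in_class gconnected_K1)

section \<open>Decomposition of a connected graph along a block\<close>

text \<open>All vertices of the block carry a piece here. A link is the case in which the piece at the sink is the one-vertex graph,
  and gluing a graph to the sink only replaces this piece; so one statement on existence and one on uniqueness serve links and rooted graphs
  alike.\<close>

definition decomp :: "nat graph \<Rightarrow> nat graph \<Rightarrow> (nat \<Rightarrow> nat graph) \<Rightarrow> bool" where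
  "decomp G B H \<longleftrightarrow> B \<in> block_class \<G> \<and>
     (\<forall>v\<in>verts B. H v \<in> conn_class \<G> \<and> verts (H v) \<inter> verts B = {v}) \<and>
     disjoint_family_on (\<lambda>v. verts (H v)) (verts B) \<and> G = attach B H (verts B)"

lemma decompD:
  assumes "decomp G B H"
  shows "B \<in> block_class \<G>" "\<And>v. v \<in> verts B \<Longrightarrow> H v \<in> conn_class \<G>"
    "\<And>v. v \<in> verts B \<Longrightarrow> verts (H v) \<inter> verts B = {v}"
    "\<And>v w u. v \<in> verts B \<Longrightarrow> w \<in> verts B \<Longrightarrow> u \<in> verts (H v) \<Longrightarrow> u \<in> verts (H w) \<Longrightarrow> v = w"
    "verts G = (\<Union>v\<in>verts B. verts (H v))"
    "edges G = edges B \<union> (\<Union>v\<in>verts B. edges (H v))"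
    "\<And>v. v \<in> verts B \<Longrightarrow> v \<in> verts (H v)"
proof -
  show 3: "verts (H v) \<inter> verts B = {v}" if "v \<in> verts B" for v
    using assms that by (auto simp: decomp_def)
  then show 7: "v \<in> verts (H v)" if "v \<in> verts B" for v using that by blast
  show "verts G = (\<Union>v\<in>verts B. verts (H v))" using assms 7 by (auto simp: decomp_def)
  show "v = w" if "v \<in> verts B" "w \<in> verts B" "u \<in> verts (H v)" "u \<in> verts (H w)" for v w u
  proof (rule ccontr)
    assume "v \<noteq> w"
    moreover have "disjoint_family_on (\<lambda>v. verts (H v)) (verts B)" using assms by (simp add: decomp_def)
    ultimately have "verts (H v) \<inter> verts (H w) = {}" using that unfolding disjoint_family_on_def by metis
    then show False using that by auto
  qed
qed (use assms in \<open>auto simp: decomp_def\<close>)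

lemma decomp_gunion:
  assumes d: "decomp G B H" and t: "t \<in> verts B"
  shows "G = gunion (attach B H (verts B - {t})) (H t)"
    "verts (attach B H (verts B - {t})) \<inter> verts (H t) = {t}"
    "sgraph (attach B H (verts B - {t}))"
proof -
  show "G = gunion (attach B H (verts B - {t})) (H t)"
    using d t by (auto simp: decomp_def gunion_def attach_def)
  show "verts (attach B H (verts B - {t})) \<inter> verts (H t) = {t}"
    using decompD(3,4,7)[OF d] t by auto
  show "sgraph (attach B H (verts B - {t}))"
    using block_classD(3)[OF decompD(1)[OF d]] conn_classD(3)[OF decompD(2)[OF d]]
    by (intro sgraph_attach) auto
qed

lemma decomp_sgraph:
  assumes d: "decomp G B H"
  shows "sgraph G" "finite (verts G)"
proof -
  have "G = attach B H (verts B)" using d by (simp add: decomp_def)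
  moreover have "sgraph (attach B H (verts B))"
    using block_classD(3)[OF decompD(1)[OF d]] conn_classD(3)[OF decompD(2)[OF d]]
    by (intro sgraph_attach) auto
  ultimately show "sgraph G" by simp
  show "finite (verts G)" unfolding decompD(5)[OF d]
    using block_classD(4)[OF decompD(1)[OF d]] conn_classD(4)[OF decompD(2)[OF d]] by blast
qed

text \<open>For every vertex \<open>v\<close> of the block, \<open>G\<close> is the piece at \<open>v\<close> glued at \<open>v\<close> to the rest. A 2-connected subgraph that is contained in no
  piece lies in the rest for all \<open>v\<close>, and only the block is left.\<close>

lemma decomp_two_connected:
  assumes d: "decomp G B H" and D: "subgraph D G" "two_connected D"
  shows "subgraph D B \<or> (\<exists>v\<in>verts B. subgraph D (H v))"
proof (rule disjCI)
  assume no: "\<not> (\<exists>v\<in>verts B. subgraph D (H v))"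
  have rest: "subgraph D (attach B H (verts B - {v}))" if v: "v \<in> verts B" for v
    using two_connected_one_side[OF decomp_gunion(3)[OF d v] conn_classD(3)[OF decompD(2)[OF d v]]
      decomp_gunion(2)[OF d v]] D decomp_gunion(1)[OF d v] no v by metis
  have vs: "u \<in> verts B" if u: "u \<in> verts D" for u
  proof -
    obtain v where v: "v \<in> verts B" "u \<in> verts (H v)"
      using u D(1) decompD(5)[OF d] by (auto simp: subgraph_def)
    then show ?thesis
      using rest[OF v(1)] decomp_gunion(2)[OF d v(1)] u by (auto simp: subgraph_def)
  qed
  moreover have "e \<in> edges B" if e: "e \<in> edges D" for e
  proof (rule ccontr)
    assume "e \<notin> edges B"
    then obtain v where v: "v \<in> verts B" "e \<in> edges (H v)"
      using e D(1) decompD(6)[OF d] by (auto simp: subgraph_def)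
    obtain a b where ab: "e = {a, b}" "a \<noteq> b" "a \<in> verts (H v)" "b \<in> verts (H v)"
      by (rule sgraph_edge_obtain[OF conn_classD(3)[OF decompD(2)[OF d v(1)]] v(2)])
    have "e \<subseteq> verts D" using e D(1) sgraph_subset by (auto simp: subgraph_def)
    then have "{a, b} \<subseteq> verts (H v) \<inter> verts B" using vs ab by auto
    then show False using ab(2) unfolding decompD(3)[OF d v(1)] by simp
  qed
  ultimately show "subgraph D B" using D(1) by (auto simp: subgraph_def)
qed

lemma decomp_in_conn_class:
  assumes d: "decomp G B H"
  shows "G \<in> conn_class \<G>"
proof -
  have "G \<in> \<G>"
  proof (rule in_class_if_blocks_covered)
    show "fin_sgraph G" using decomp_sgraph[OF d] by (simp add: fin_sgraph_def)
  next
    fix D assume "subgraph D G" "two_connected D"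
    from decomp_two_connected[OF d this]
    show "\<exists>K\<in>\<G>. subgraph D K \<and> subgraph K G"
    proof
      assume "subgraph D B"
      moreover have "subgraph B G" using d block_classD(3)[OF decompD(1)[OF d]]
        by (auto simp: subgraph_def decomp_def)
      ultimately show ?thesis using block_classD(1)[OF decompD(1)[OF d]] by blast
    next
      assume "\<exists>v\<in>verts B. subgraph D (H v)"
      then obtain v where v: "v \<in> verts B" "subgraph D (H v)" by blast
      moreover have "subgraph (H v) G" using d v conn_classD(3)[OF decompD(2)[OF d v(1)]]
        by (auto simp: subgraph_def decomp_def)
      ultimately show ?thesis using conn_classD(1)[OF decompD(2)[OF d v(1)]] by blast
    qed
  qed
  moreover have "gconnected G"
  proof -
    obtain b where b: "b \<in> verts B" using two_connected_ne(2)[OF block_classD(2)[OF decompD(1)[OF d]]] by blast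
    show ?thesis
    proof (rule gconnectedI[of b])
      show "b \<in> verts G" using b d by (auto simp: decomp_def)
      fix u assume "u \<in> verts G"
      then obtain v where v: "v \<in> verts B" "u \<in> verts (H v)" using decompD(5)[OF d] by auto
      have "(b, v) \<in> (adj G)\<^sup>*"
        using gconnected_reach[OF block_classD(5)[OF decompD(1)[OF d]] b v(1)]
        by (rule reach_mono) (auto simp: decompD(6)[OF d])
      also have "(v, u) \<in> (adj G)\<^sup>*"
        using gconnected_reach[OF conn_classD(2)[OF decompD(2)[OF d v(1)]] decompD(7)[OF d v(1)] v(2)]
        by (rule reach_mono) (use v(1) in \<open>auto simp: decompD(6)[OF d]\<close>)
      finally show "(b, u) \<in> (adj G)\<^sup>*" .
    qed
  qed
  ultimately show ?thesis by (simp add: conn_class_def)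
qed

lemma decomp_is_block:
  assumes d: "decomp G B H"
  shows "is_block_of B G"
  unfolding is_block_of_def
proof (intro conjI allI impI)
  show "subgraph B G" using d block_classD(3)[OF decompD(1)[OF d]]
    by (auto simp: subgraph_def decomp_def)
  show 2: "two_connected B" using block_classD(2)[OF decompD(1)[OF d]] .
  fix D assume D: "subgraph D G \<and> two_connected D \<and> subgraph B D"
  show "D = B"
  proof (rule ccontr)
    assume "D \<noteq> B"
    then obtain v where v: "v \<in> verts B" "subgraph D (H v)"
      using decomp_two_connected[OF d, of D] D subgraph_antisym by blast
    then have "verts B \<subseteq> verts (H v) \<inter> verts B" using D by (auto simp: subgraph_def)
    then have "verts B \<subseteq> {v}" unfolding decompD(3)[OF d v(1)] .
    then show False using two_connected_ne(3)[OF 2] by blast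
  qed
qed

lemma decomp_piece_edge:
  assumes d: "decomp G B H" and v: "v \<in> verts B" and e: "e \<in> edges (H v)"
  shows "e \<in> edges G - edges B"
proof -
  obtain a b where ab: "e = {a, b}" "a \<noteq> b" "a \<in> verts (H v)" "b \<in> verts (H v)"
    by (rule sgraph_edge_obtain[OF conn_classD(3)[OF decompD(2)[OF d v]] e])
  have "e \<notin> edges B"
  proof
    assume "e \<in> edges B"
    then have "{a, b} \<subseteq> verts (H v) \<inter> verts B"
      using sgraph_subset[OF block_classD(3)[OF decompD(1)[OF d]]] ab by auto
    then show False using ab(2) unfolding decompD(3)[OF d v] by simp
  qed
  then show ?thesis using e v by (auto simp: decompD(6)[OF d])
qed

lemma decomp_piece_closed:
  assumes d: "decomp G B H" and v: "v \<in> verts B" and "a \<in> verts (H v)" "{a, b} \<in> edges G - edges B"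
  shows "b \<in> verts (H v)" "{a, b} \<in> edges (H v)"
proof -
  obtain w where w: "w \<in> verts B" "{a, b} \<in> edges (H w)"
    using assms by (auto simp: decompD(6)[OF d])
  then have "a \<in> verts (H w)" "b \<in> verts (H w)"
    using sgraph_edge[OF conn_classD(3)[OF decompD(2)[OF d w(1)]]] by auto
  moreover from this have "w = v" using decompD(4)[OF d] assms w by blast
  ultimately show "b \<in> verts (H v)" "{a, b} \<in> edges (H v)" using w by auto
qed

text \<open>Deletion of the edges of the block separates the pieces, so they can be read off from the graph and the block.\<close>

lemma decomp_piece_verts:
  assumes d: "decomp G B H" and v: "v \<in> verts B"
  shows "verts (H v) = {u. (v, u) \<in> (adj (minus_block G B))\<^sup>*}"
proof safe
  fix u assume "u \<in> verts (H v)"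
  then have "(v, u) \<in> (adj (H v))\<^sup>*"
    using gconnected_reach[OF conn_classD(2)[OF decompD(2)[OF d v]] decompD(7)[OF d v]] by simp
  then show "(v, u) \<in> (adj (minus_block G B))\<^sup>*"
    by (rule reach_mono) (use decomp_piece_edge[OF d v] in auto)
next
  fix u assume "(v, u) \<in> (adj (minus_block G B))\<^sup>*"
  then show "u \<in> verts (H v)"
    by (rule reach_closed) (use decompD(7)[OF d v] decomp_piece_closed[OF d v] in auto)
qed

lemma decomp_pieces_unique:
  assumes d: "decomp G B H" "decomp G B H'" and v: "v \<in> verts B"
  shows "H v = H' v"
proof -
  have V: "verts (H v) = verts (H' v)"
    using decomp_piece_verts[OF d(1) v] decomp_piece_verts[OF d(2) v] by simp
  have "edges (H v) \<subseteq> edges (H' v)"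
    if d: "decomp G B H" "decomp G B H'" and V: "verts (H v) = verts (H' v)" for H H'
  proof
    fix e assume e: "e \<in> edges (H v)"
    obtain a b where ab: "e = {a, b}" "a \<noteq> b" "a \<in> verts (H v)" "b \<in> verts (H v)"
      by (rule sgraph_edge_obtain[OF conn_classD(3)[OF decompD(2)[OF d(1) v]] e])
    then show "e \<in> edges (H' v)"
      using decomp_piece_closed(2)[OF d(2) v, of a b] decomp_piece_edge[OF d(1) v e] V by simp
  qed
  then show ?thesis using d V by (auto simp: graph_eq_iff)
qed

text \<open>Of two different blocks at \<open>x\<close>, the second lies in the piece of the first at \<open>x\<close>. So a vertex that
  the first block sees through another vertex is seen by the second block through \<open>x\<close>.\<close>

lemma decomp_block_unique:
  assumes d: "decomp G B H" and d': "decomp G B' H'"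
    and x: "x \<in> verts B" "x \<in> verts B'"
    and t: "t \<in> verts B" "t \<noteq> x" "v \<in> verts (H t)"
    and t': "t' \<in> verts B'" "t' \<noteq> x" "v \<in> verts (H' t')"
  shows "B = B'"
proof (rule ccontr)
  assume ne: "B \<noteq> B'"
  note b = decomp_is_block[OF d] and b' = decomp_is_block[OF d']
  have "\<not> subgraph B' B" using ne b b' unfolding is_block_of_def by metis
  then obtain w where w: "w \<in> verts B" "subgraph B' (H w)"
    using decomp_two_connected[OF d, of B'] b' by (auto simp: is_block_of_def)
  then have "w = x" using x decompD(3)[OF d w(1)] by (auto simp: subgraph_def)
  then have B': "subgraph B' (H x)" using w by simp
  have nB': "e \<notin> edges B'" if "a \<in> e" "a \<notin> verts (H x)" for e a
    using that B' conn_classD(3)[OF decompD(2)[OF d x(1)]] by (auto simp: subgraph_def sgraph_def)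
  have "(v, t) \<in> (adj (H t))\<^sup>*"
    using gconnected_reach[OF conn_classD(2)[OF decompD(2)[OF d t(1)]] t(3) decompD(7)[OF d t(1)]] .
  then have "(v, t) \<in> (adj (minus_block G B'))\<^sup>*"
  proof (rule reach_mono)
    show "edges (H t) \<subseteq> edges (minus_block G B')"
    proof
      fix e assume e: "e \<in> edges (H t)"
      obtain a c where ab: "e = {a, c}" "a \<noteq> c" "a \<in> verts (H t)" "c \<in> verts (H t)"
        by (rule sgraph_edge_obtain[OF conn_classD(3)[OF decompD(2)[OF d t(1)]] e])
      then have "a \<notin> verts (H x)" using decompD(4)[OF d t(1) x(1)] t(2) by blast
      then show "e \<in> edges (minus_block G B')"
        using nB'[of a e] ab decomp_piece_edge[OF d t(1) e] by auto
    qed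
  qed
  also have "(t, x) \<in> (adj (minus_block G B'))\<^sup>*"
    using gconnected_reach[OF block_classD(5)[OF decompD(1)[OF d]] t(1) x(1)]
  proof (rule reach_mono)
    show "edges B \<subseteq> edges (minus_block G B')"
    proof
      fix e assume e: "e \<in> edges B"
      obtain a c where ab: "e = {a, c}" "a \<noteq> c" "a \<in> verts B" "c \<in> verts B"
        by (rule sgraph_edge_obtain[OF block_classD(3)[OF decompD(1)[OF d]] e])
      have "a \<notin> verts (H x) \<or> c \<notin> verts (H x)"
      proof (rule ccontr)
        assume "\<not> (a \<notin> verts (H x) \<or> c \<notin> verts (H x))"
        then have "{a, c} \<subseteq> verts (H x) \<inter> verts B" using ab by auto
        then show False using ab(2) unfolding decompD(3)[OF d x(1)] by simp
      qed
      then show "e \<in> edges (minus_block G B')"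
        using nB'[of a e] nB'[of c e] ab e by (auto simp: decompD(6)[OF d])
    qed
  qed
  finally have "v \<in> verts (H' x)" using decomp_piece_verts[OF d' x(2)] reach_sym by auto
  then show False using decompD(4)[OF d' x(2) t'(1)] t' by auto
qed

end

section \<open>Existence of the decomposition\<close>

text \<open>A block together with a path between two of its vertices is 2-connected: after deletion of one
  vertex each vertex of the path still reaches one of the two ends along the path.\<close>

lemma ear_two_connected:
  fixes B :: "nat graph"
  assumes B: "two_connected B" "sgraph B" and f: "inj_on f {..k}" "f 0 \<in> verts B" "f k \<in> verts B"
    and D: "D = Graph (verts B \<union> f ` {..k}) (edges B \<union> (\<lambda>i. {f i, f (Suc i)}) ` {..<k})"
  shows "two_connected D" "sgraph D"
proof -
  have vD: "verts D = verts B \<union> f ` {..k}" and eD: "edges D = edges B \<union> (\<lambda>i. {f i, f (Suc i)}) ` {..<k}"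
    using D by simp_all
  show sD: "sgraph D"
    unfolding sgraph_def
  proof
    fix e assume "e \<in> edges D"
    then consider "e \<in> edges B" | i where "i < k" "e = {f i, f (Suc i)}" unfolding eD by auto
    then show "e \<subseteq> verts D \<and> card e = 2"
    proof cases
      case 1
      then show ?thesis using B(2) by (auto simp: sgraph_def vD)
    next
      case 2
      then have "f i \<noteq> f (Suc i)" using inj_onD[OF f(1), of i "Suc i"] by auto
      then show ?thesis using 2 by (auto simp: vD)
    qed
  qed
  have minus: "gconnected (induced D (verts D - {v}))" for v
  proof -
    let ?D = "induced D (verts D - {v})"
    obtain b where b: "b \<in> verts B" "b \<noteq> v" using two_connected_ne(3)[OF B(1), of v] by blast
    have reach_B: "(b, u) \<in> (adj ?D)\<^sup>*" if u: "u \<in> verts B" "u \<noteq> v" for u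
    proof -
      have "(b, u) \<in> (adj (induced B (verts B - {v})))\<^sup>*"
        using two_connected_minus[OF B, of v] b u by (intro gconnected_reach) auto
      then show ?thesis by (rule reach_mono) (auto simp: vD eD)
    qed
    have step: "(f i, f (Suc i)) \<in> adj ?D" if "i < k" "f i \<noteq> v" "f (Suc i) \<noteq> v" for i
      using that by (auto simp: adj_iff eD vD)
    have down: "i \<le> k \<Longrightarrow> v \<notin> f ` {..i} \<Longrightarrow> (f 0, f i) \<in> (adj ?D)\<^sup>*" for i
    proof (induction i)
      case (Suc i)
      have "(f 0, f i) \<in> (adj ?D)\<^sup>*" using Suc by (auto simp: atMost_Suc)
      moreover have "(f i, f (Suc i)) \<in> adj ?D" using Suc.prems by (intro step) auto
      ultimately show ?case by (rule rtrancl_into_rtrancl)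
    qed simp
    have up: "i + m \<le> k \<Longrightarrow> v \<notin> f ` {i..i + m} \<Longrightarrow> (f i, f (i + m)) \<in> (adj ?D)\<^sup>*" for i m
    proof (induction m)
      case (Suc m)
      have "f ` {i..i + m} \<subseteq> f ` {i..i + Suc m}" by (intro image_mono) auto
      then have "v \<notin> f ` {i..i + m}" using Suc.prems(2) by blast
      then have "(f i, f (i + m)) \<in> (adj ?D)\<^sup>*" using Suc by simp
      moreover have "(f (i + m), f (Suc (i + m))) \<in> adj ?D"
        using Suc.prems by (intro step) auto
      ultimately show ?case by (simp add: rtrancl_into_rtrancl)
    qed simp
    show ?thesis
    proof (rule gconnectedI[of b])
      show "b \<in> verts ?D" using b by (simp add: vD)
      fix u assume u: "u \<in> verts ?D"
      show "(b, u) \<in> (adj ?D)\<^sup>*"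
      proof (cases "u \<in> verts B")
        case True
        then show ?thesis using reach_B u by simp
      next
        case False
        then obtain i where i: "i \<le> k" "u = f i" using u by (auto simp: vD)
        show ?thesis
        proof (cases "v \<in> f ` {..i}")
          case False
          then have "f 0 \<noteq> v" by auto
          from rtrancl_trans[OF reach_B[OF f(2) this] down[OF i(1) False]] show ?thesis
            by (simp add: i(2))
        next
          case True
          then obtain j where j: "j \<le> i" "v = f j" by auto
          have "j \<noteq> i" using u i j by auto
          have no: "v \<notin> f ` {i..k}"
          proof
            assume "v \<in> f ` {i..k}"
            then obtain l where l: "i \<le> l" "l \<le> k" "f j = f l" using j(2) by auto
            then show False using inj_onD[OF f(1) l(3)] j(1) \<open>j \<noteq> i\<close> by simp
          qed
          then have "f k \<noteq> v" using i(1) by auto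
          moreover have "(f i, f k) \<in> (adj ?D)\<^sup>*" using up[of i "k - i"] no i(1) by simp
          ultimately show ?thesis
            using rtrancl_trans[OF reach_B[OF f(3)] reach_sym] i(2) by simp
        qed
      qed
    qed
  qed
  have fin: "finite (verts D)" using two_connected_ne(1)[OF B(1)] by (simp add: vD)
  obtain v where "v \<notin> verts D" using ex_new_if_finite[OF infinite_UNIV_nat fin] by blast
  then have "gconnected D" using minus[of v] sD by (simp add: induced_all)
  moreover have "2 \<le> card (verts D)"
    using B(1) card_mono[OF fin, of "verts B"] by (simp add: two_connected_def vD)
  ultimately show "two_connected D" using minus by (simp add: two_connected_def)
qed

lemma shortest_path:
  assumes "(a, b) \<in> R\<^sup>*"
  obtains f k where "f 0 = a" "f k = b" "\<And>i. i < k \<Longrightarrow> (f i, f (Suc i)) \<in> R" "inj_on f {..k::nat}"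
proof -
  obtain n where "(a, b) \<in> R ^^ n" using assms by (auto simp: rtrancl_is_UN_relpow)
  define k where "k = (LEAST n. (a, b) \<in> R ^^ n)"
  have k: "(a, b) \<in> R ^^ k" unfolding k_def by (rule LeastI) fact
  have least: "k \<le> m" if "(a, b) \<in> R ^^ m" for m unfolding k_def by (rule Least_le) fact
  obtain f where f: "f 0 = a" "f k = b" "\<And>i. i < k \<Longrightarrow> (f i, f (Suc i)) \<in> R"
    using k unfolding relpow_fun_conv by blast
  have no: "f i \<noteq> f j" if "i < j" "j \<le> k" for i j
  proof
    assume eq: "f i = f j"
    have "(a, f i) \<in> R ^^ i"
      unfolding relpow_fun_conv using f that by (intro exI[of _ f]) auto
    moreover have "(f j, b) \<in> R ^^ (k - j)"
      unfolding relpow_fun_conv using f that by (intro exI[of _ "\<lambda>l. f (j + l)"]) auto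
    ultimately have "(a, b) \<in> R ^^ (i + (k - j))" unfolding eq relpow_add by auto
    then have "k \<le> i + (k - j)" by (rule least)
    then show False using that by simp
  qed
  have "inj_on f {..k}"
    unfolding inj_on_def using no by (metis atMost_iff linorder_neqE_nat)
  with f show ?thesis by (rule that)
qed

text \<open>A path outside the block between two of its vertices would extend the block by an ear, against its maximality. The path is
  taken shortest, so that it does not repeat vertices.\<close>

lemma block_gate_unique:
  assumes B: "is_block_of B (G :: nat graph)" and G: "sgraph G"
    and ab: "a \<in> verts B" "b \<in> verts B" "(a, b) \<in> (adj (minus_block G B))\<^sup>*"
  shows "a = b"
proof (rule ccontr)
  assume ne: "a \<noteq> b"
  obtain f k where f: "f 0 = a" "f k = b" "\<And>i. i < k \<Longrightarrow> (f i, f (Suc i)) \<in> adj (minus_block G B)"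
    "inj_on f {..k}" using shortest_path[OF ab(3)] by blast
  define D where "D = Graph (verts B \<union> f ` {..k}) (edges B \<union> (\<lambda>i. {f i, f (Suc i)}) ` {..<k})"
  have B2: "two_connected B" "sgraph B" "subgraph B G" using B by (auto simp: is_block_of_def subgraph_def)
  note D2 = ear_two_connected[OF B2(1,2) f(4) _ _ D_def, unfolded f(1,2), OF ab(1,2)]
  have k: "0 < k" using ne f by (cases k) auto
  have e: "{f i, f (Suc i)} \<in> edges G" if "i < k" for i using f(3)[OF that] by (simp add: adj_iff)
  have "f i \<in> verts G" if "i \<le> k" for i
  proof (cases i)
    case 0
    then show ?thesis using f(1) ab(1) B2(3) by (auto simp: subgraph_def)
  next
    case (Suc j)
    then show ?thesis using e[of j] sgraph_edge(2)[OF G, of "f j" "f i"] that by simp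
  qed
  then have "subgraph D G" using B2(3) e D2(2) by (auto simp: subgraph_def D_def)
  moreover have "subgraph B D" using B2(2) by (auto simp: subgraph_def D_def)
  ultimately have "D = B" using B D2(1) by (auto simp: is_block_of_def)
  moreover have "{f 0, f (Suc 0)} \<in> edges D" unfolding D_def using k by auto
  ultimately show False using f(3)[OF k] by (simp add: adj_iff)
qed

lemma block_extends:
  assumes G: "fin_sgraph G" and D: "subgraph D G" "two_connected D"
  obtains B where "is_block_of B G" "subgraph D B"
proof -
  let ?P = "\<lambda>K. subgraph K G \<and> two_connected K \<and> subgraph D K"
  let ?m = "\<lambda>K. card (verts K) + card (edges K)"
  have fin: "finite (verts G)" "finite (edges G)"
    using G finite_subset[of "edges G" "Pow (verts G)"] by (auto simp: fin_sgraph_def sgraph_def)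
  have le: "card (verts K) \<le> card (verts K') \<and> card (edges K) \<le> card (edges K')"
    if "subgraph K K'" "subgraph K' G" for K K'
    using that fin by (auto simp: subgraph_def intro: card_mono finite_subset)
  have "sgraph D" using D by (simp add: subgraph_def)
  then have PD: "?P D" using D by (simp add: subgraph_refl)
  have bound: "\<forall>K. ?P K \<longrightarrow> ?m K < Suc (?m G)"
  proof (intro allI impI)
    fix K assume "?P K"
    moreover have "subgraph G G" using G by (simp add: subgraph_refl fin_sgraph_def)
    ultimately show "?m K < Suc (?m G)" using le[of K G] by simp
  qed
  obtain B where PB: "?P B \<and> (\<forall>K. ?P K \<longrightarrow> ?m K \<le> ?m B)"
    using ex_has_greatest_nat[of ?P D ?m "Suc (?m G)", OF PD bound] ..
  have B: "?P B" "\<And>K. ?P K \<Longrightarrow> ?m K \<le> ?m B" using PB by simp_all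
  have "is_block_of B G"
    unfolding is_block_of_def
  proof (intro conjI allI impI)
    fix K assume K: "subgraph K G \<and> two_connected K \<and> subgraph B K"
    then have "?P K" using B(1) subgraph_trans by blast
    then have "?m K \<le> ?m B" by (rule B(2))
    with le[of B K] K have c: "card (verts K) = card (verts B)" "card (edges K) = card (edges B)" by auto
    have sub: "verts K \<subseteq> verts G" "edges K \<subseteq> edges G" "verts B \<subseteq> verts K" "edges B \<subseteq> edges K"
      using K by (auto simp: subgraph_def)
    have "verts B = verts K" "edges B = edges K"
      using card_subset_eq[OF finite_subset[OF sub(1) fin(1)] sub(3)]
        card_subset_eq[OF finite_subset[OF sub(2) fin(2)] sub(4)] c by simp_all
    then show "K = B" by (simp add: graph_eq_iff)
  qed (use B in auto)
  then show ?thesis using that B(1) by blast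
qed

context stable_class
begin

text \<open>The piece at \<open>w\<close> is the component of \<open>w\<close> after deletion of the edges of the block. By uniqueness of gates, different vertices of the block have
  different components, and connectedness of \<open>G\<close> makes the components cover it.\<close>

lemma decomp_exists:
  assumes G: "G \<in> conn_class \<G>" and B: "is_block_of B G"
  obtains H where "decomp G B H"
proof -
  note G' = conn_classD[OF G]
  have B2: "two_connected B" "sgraph B" "verts B \<subseteq> verts G" "edges B \<subseteq> edges G"
    using B by (auto simp: is_block_of_def subgraph_def)
  have Bc: "B \<in> block_class \<G>"
    using in_class_iff[OF in_class_fin[OF G'(1)]] B G'(1) B2(1) by (auto simp: block_class_def)
  let ?M = "minus_block G B"
  define C where "C = (\<lambda>w. {u. (w, u) \<in> (adj ?M)\<^sup>*})"
  define H where "H = (\<lambda>w. Graph (C w) {e \<in> edges G - edges B. e \<subseteq> C w})"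
  have vH: "verts (H w) = C w" and eH: "edges (H w) = {e \<in> edges G - edges B. e \<subseteq> C w}" for w
    by (simp_all add: H_def)
  have CG: "C w \<subseteq> verts G" if w: "w \<in> verts B" for w
  proof
    fix u assume "u \<in> C w"
    then show "u \<in> verts G" unfolding C_def mem_Collect_eq
    proof (rule reach_closed)
      show "w \<in> verts G" using w B2(3) by blast
      show "b \<in> verts G" if "{a, b} \<in> edges ?M" for a b
        using that sgraph_edge(2)[OF G'(3), of a b] by simp
    qed
  qed
  have Cw: "w \<in> C w" for w by (simp add: C_def)
  have CB: "C w \<inter> verts B = {w}" if w: "w \<in> verts B" for w
    using block_gate_unique[OF B G'(3) w] w Cw by (auto simp: C_def)
  have disj: "C w \<inter> C w' = {}" if "w \<in> verts B" "w' \<in> verts B" "w \<noteq> w'" for w w'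
  proof (rule ccontr)
    assume "C w \<inter> C w' \<noteq> {}"
    then obtain u where "(w, u) \<in> (adj ?M)\<^sup>*" "(w', u) \<in> (adj ?M)\<^sup>*" by (auto simp: C_def)
    then have "(w, w') \<in> (adj ?M)\<^sup>*" by (blast intro: rtrancl_trans reach_sym)
    then show False using block_gate_unique[OF B G'(3)] that by blast
  qed
  have Cstep: "b \<in> C w" if "a \<in> C w" "{a, b} \<in> edges G - edges B" for a b w
    using that by (auto simp: C_def adj_iff intro: rtrancl_into_rtrancl)
  have sH: "sgraph (H w)" for w
    using G'(3) by (auto simp: sgraph_def eH vH)
  have cH: "gconnected (H w)" for w
  proof (rule gconnectedI[of w])
    show "w \<in> verts (H w)" by (simp add: vH Cw)
    fix u assume "u \<in> verts (H w)"
    then have "(w, u) \<in> (adj ?M)\<^sup>*" by (simp add: vH C_def)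
    then show "(w, u) \<in> (adj (H w))\<^sup>*"
    proof (induction rule: rtrancl_induct)
      case (step y z)
      have "y \<in> C w" using step(1) by (simp add: C_def)
      moreover have yz: "{y, z} \<in> edges G - edges B" using step(2) by (simp add: adj_iff)
      ultimately have "(y, z) \<in> adj (H w)" using Cstep[of y w z] by (simp add: adj_iff eH)
      with step(3) show ?case by (rule rtrancl_into_rtrancl)
    qed simp
  qed
  have cover: "verts G \<subseteq> (\<Union>w\<in>verts B. C w)"
  proof -
    obtain b where b: "b \<in> verts B" using two_connected_ne(2)[OF B2(1)] by blast
    show ?thesis
    proof (rule gconnected_closed[OF G'(2)])
      show "b \<in> verts G" using b B2(3) by blast
      show "b \<in> (\<Union>w\<in>verts B. C w)" using b Cw by blast
      fix a c assume a: "a \<in> (\<Union>w\<in>verts B. C w)" and e: "{a, c} \<in> edges G"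
      show "c \<in> (\<Union>w\<in>verts B. C w)"
      proof (cases "{a, c} \<in> edges B")
        case True
        then have "c \<in> verts B" by (rule sgraph_edge(2)[OF B2(2)])
        then show ?thesis using Cw by blast
      next
        case False
        then show ?thesis using a e Cstep[of a _ c] by auto
      qed
    qed
  qed
  have GA: "G = attach B H (verts B)"
    unfolding graph_eq_iff
  proof
    show "verts G = verts (attach B H (verts B))"
      using cover CG B2(3) by (auto simp: vH)
    show "edges G = edges (attach B H (verts B))"
    proof
      show "edges (attach B H (verts B)) \<subseteq> edges G" using B2(4) by (auto simp: eH)
      show "edges G \<subseteq> edges (attach B H (verts B))"
      proof
        fix e assume e: "e \<in> edges G"
        show "e \<in> edges (attach B H (verts B))"
        proof (cases "e \<in> edges B")
          case False
          obtain a b where ab: "e = {a, b}" "a \<noteq> b" "a \<in> verts G" "b \<in> verts G"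
            by (rule sgraph_edge_obtain[OF G'(3) e])
          then obtain w where w: "w \<in> verts B" "a \<in> C w" using cover by blast
          then have "e \<in> edges (H w)" using Cstep[of a w b] ab e False by (auto simp: eH)
          then show ?thesis using w by auto
        qed auto
      qed
    qed
  qed
  have HG: "H w \<in> \<G>" if w: "w \<in> verts B" for w
  proof (rule gunion_parts_in_class)
    let ?R = "attach B H (verts B - {w})"
    show "gunion (H w) ?R \<in> \<G>"
    proof -
      have "G = gunion (H w) ?R" using GA w by (auto simp: gunion_def attach_def)
      then show ?thesis using G'(1) by simp
    qed
    show "sgraph (H w)" "sgraph ?R" using sH B2(2) by (auto intro: sgraph_attach)
    show "verts (H w) \<inter> verts ?R = {w}"
      using CB[OF w] disj[OF w] Cw[of w] w unfolding attach_simps vH by blast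
  qed
  have "decomp G B H"
    unfolding decomp_def disjoint_family_on_def
    using Bc HG cH CB disj GA by (auto simp: conn_class_def vH)
  then show ?thesis by (rule that)
qed

lemma edge_two_connected:
  assumes "x \<noteq> y"
  shows "two_connected (Graph {x, y} {{x, y}})"
proof -
  have "(x, y) \<in> adj (Graph {x, y} {{x, y}})" by (simp add: adj_iff)
  then have 1: "gconnected (Graph {x, y} {{x, y}})"
    by (intro gconnectedI[of x]) auto
  have 2: "gconnected (induced (Graph {x, y} {{x, y}}) ({x, y} - {v}))" if "v \<in> {x, y}" for v
  proof -
    have "verts (induced (Graph {x, y} {{x, y}}) ({x, y} - {v})) = {if v = x then y else x}"
      using that assms by auto
    then show ?thesis by (simp add: gconnected_def)
  qed
  show ?thesis using 1 2 assms by (simp add: two_connected_def)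
qed

text \<open>The block of \<open>x\<close> in direction of \<open>v\<close> is the one with the first edge of a path that never
  returns to \<open>x\<close>.\<close>

lemma decomp_exists_towards:
  assumes G: "G \<in> conn_class \<G>" and x: "x \<in> verts G" and v: "v \<in> verts G" "x \<noteq> v"
  obtains B H t where "decomp G B H" "x \<in> verts B" "t \<in> verts B" "t \<noteq> x" "v \<in> verts (H t)"
proof -
  note G' = conn_classD[OF G]
  obtain f k where f: "f 0 = x" "f k = v" "\<And>i. i < k \<Longrightarrow> (f i, f (Suc i)) \<in> adj G" "inj_on f {..k::nat}"
    using shortest_path[OF gconnected_reach[OF G'(2) x v(1)]] by blast
  have k: "0 < k" using v(2) f by (cases k) auto
  define y where "y = f (Suc 0)"
  have xy: "{x, y} \<in> edges G" using f(3)[OF k] f(1) by (simp add: adj_iff y_def)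
  note xy' = sgraph_edge[OF G'(3) xy]
  have "subgraph (Graph {x, y} {{x, y}}) G"
    using xy xy' by (auto simp: subgraph_def sgraph_def)
  then obtain B where B: "is_block_of B G" "subgraph (Graph {x, y} {{x, y}}) B"
    using block_extends[OF in_class_fin[OF G'(1)] _ edge_two_connected[OF xy'(3)]] by blast
  then have xB: "x \<in> verts B" "y \<in> verts B" by (auto simp: subgraph_def)
  obtain H where d: "decomp G B H" using decomp_exists[OF G B(1)] .
  obtain t where t: "t \<in> verts B" "v \<in> verts (H t)" using v(1) decompD(5)[OF d] by auto
  have "t \<noteq> x"
  proof
    assume tx: "t = x"
    have fx: "f i \<noteq> x" if "0 < i" "i \<le> k" for i
    proof
      assume "f i = x"
      then have "f i = f 0" using f(1) by simp
      then show False using f(4) that by (auto dest: inj_onD)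
    qed
    have along: "f (k - i) \<in> verts (H x)" if "i < k" for i
      using that
    proof (induction i)
      case 0
      then show ?case using f(2) t(2) tx by simp
    next
      case (Suc i)
      define j where "j = k - Suc i"
      have j: "Suc j = k - i" "j < k" "0 < j" using Suc.prems by (auto simp: j_def)
      have IH: "f (Suc j) \<in> verts (H x)" using Suc j by simp
      have e: "{f (Suc j), f j} \<in> edges G" using f(3)[OF j(2)] by (simp add: adj_iff insert_commute)
      have "{f (Suc j), f j} \<notin> edges B"
      proof
        assume "{f (Suc j), f j} \<in> edges B"
        then have "f (Suc j) \<in> verts (H x) \<inter> verts B"
          using IH sgraph_edge(1)[OF block_classD(3)[OF decompD(1)[OF d]]] by blast
        then have "f (Suc j) = x" unfolding decompD(3)[OF d xB(1)] by simp
        then show False using fx[of "Suc j"] j(2) by simp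
      qed
      then show ?case using decomp_piece_closed(1)[OF d xB(1) IH] e by (simp add: j_def[symmetric])
    qed
    have "y \<in> verts (H x) \<inter> verts B" using along[of "k - 1"] k xB by (simp add: y_def)
    then show False using decompD(3)[OF d xB(1)] xy'(3) by auto
  qed
  then show ?thesis using that d xB(1) t by blast
qed

end

section \<open>Transport along injections\<close>

definition gmap :: "('v \<Rightarrow> 'w) \<Rightarrow> 'v graph \<Rightarrow> 'w graph" where
  "gmap f G = Graph (f ` verts G) ((`) f ` edges G)"

lemma gmap_simps [simp]: "verts (gmap f G) = f ` verts G" "edges (gmap f G) = (`) f ` edges G"
  by (simp_all add: gmap_def)

lemma graph_iso_iff: "graph_iso f G H \<longleftrightarrow> inj_on f (verts G) \<and> H = gmap f G"
  by (auto simp: graph_iso_def bij_betw_def graph_eq_iff)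

lemma gmap_comp: "gmap g (gmap f G) = gmap (g \<circ> f) G"
  by (auto simp: graph_eq_iff image_comp image_image)

lemma gmap_cong:
  assumes "sgraph G" "\<And>v. v \<in> verts G \<Longrightarrow> f v = g v"
  shows "gmap f G = gmap g G"
proof -
  have "f ` e = g ` e" if "e \<in> edges G" for e
    using sgraph_subset[OF assms(1) that] assms(2) by (intro image_cong) auto
  then show ?thesis using assms(2) by (auto simp: graph_eq_iff)
qed

lemma gmap_ident:
  assumes "sgraph G" "\<And>v. v \<in> verts G \<Longrightarrow> f v = v"
  shows "gmap f G = G"
  using gmap_cong[OF assms(1), of f "\<lambda>v. v"] assms(2) by (simp add: graph_eq_iff)

lemma gmap_inv:
  assumes "sgraph G" "inj_on f (verts G)"
  shows "gmap (inv_into (verts G) f) (gmap f G) = G"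
  unfolding gmap_comp using assms by (intro gmap_ident) auto

lemma sgraph_gmap:
  assumes "sgraph G" "inj_on f (verts G)"
  shows "sgraph (gmap f G)"
  unfolding sgraph_def
proof
  fix e assume "e \<in> edges (gmap f G)"
  then obtain e' where e': "e' \<in> edges G" "e = f ` e'" by auto
  have "e' \<subseteq> verts G" "card e' = 2" using e'(1) assms(1) by (auto simp: sgraph_def)
  then show "e \<subseteq> verts (gmap f G) \<and> card e = 2"
    using card_image[OF inj_on_subset[OF assms(2)]] e'(2) by auto
qed

lemma gmap_edge: "{u, v} \<in> edges G \<Longrightarrow> {f u, f v} \<in> edges (gmap f G)"
  by (auto intro!: image_eqI[of _ _ "{u, v}"])

lemma gmap_reach: "(u, v) \<in> (adj G)\<^sup>* \<Longrightarrow> (f u, f v) \<in> (adj (gmap f G))\<^sup>*"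
proof (induction rule: rtrancl_induct)
  case (step y z)
  then have "(f y, f z) \<in> adj (gmap f G)" using gmap_edge[of y z G f] by (simp add: adj_iff)
  with step.IH show ?case by (rule rtrancl_into_rtrancl)
qed simp

lemma gconnected_gmap:
  assumes "gconnected G"
  shows "gconnected (gmap f G)"
proof -
  obtain w where w: "w \<in> verts G" using assms by (auto simp: gconnected_def)
  show ?thesis
    using w gmap_reach[OF gconnected_reach[OF assms w], of _ f] by (intro gconnectedI[of "f w"]) auto
qed

lemma gmap_induced:
  assumes "sgraph G" "inj_on f (verts G)" "S \<subseteq> verts G"
  shows "induced (gmap f G) (f ` S) = gmap f (induced G S)"
proof -
  have "f ` e \<subseteq> f ` S \<longleftrightarrow> e \<subseteq> S" if "e \<in> edges G" for e
    using inj_on_image_subset_iff[OF assms(2) sgraph_subset[OF assms(1) that] assms(3)] .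
  moreover have "f ` verts G \<inter> f ` S = f ` (verts G \<inter> S)"
    using assms(2,3) by (intro inj_on_image_Int[symmetric, OF assms(2)]) auto
  ultimately show ?thesis by (auto simp: graph_eq_iff)
qed

lemma two_connected_gmap:
  assumes "two_connected G" "sgraph G" "inj_on f (verts G)"
  shows "two_connected (gmap f G)"
  unfolding two_connected_def
proof (intro conjI ballI)
  show "2 \<le> card (verts (gmap f G))" using assms by (simp add: card_image two_connected_def)
  show "gconnected (gmap f G)" using assms gconnected_gmap by (auto simp: two_connected_def)
  fix w assume "w \<in> verts (gmap f G)"
  then obtain v where v: "v \<in> verts G" "w = f v" by auto
  then have "verts (gmap f G) - {w} = f ` (verts G - {v})"
    using inj_on_image_set_diff[OF assms(3), of "verts G" "{v}"] by auto
  then show "gconnected (induced (gmap f G) (verts (gmap f G) - {w}))"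
    using gmap_induced[OF assms(2,3), of "verts G - {v}"]
      gconnected_gmap[OF two_connected_minus[OF assms(1,2), of v], of f] by simp
qed

lemma gmap_gunion: "gmap f (gunion G H) = gunion (gmap f G) (gmap f H)"
  by (auto simp: graph_eq_iff)

lemma gmap_K1: "gmap f (K1 v) = K1 (f v)"
  by (simp add: graph_eq_iff)

lemma attach_cong: "(\<And>v. v \<in> I \<Longrightarrow> H v = H' v) \<Longrightarrow> attach B H I = attach B H' I"
  by (simp add: attach_def)

lemma attach_K1: "t \<in> verts B \<Longrightarrow> H t = K1 t \<Longrightarrow> attach B H I = attach B H (insert t I)"
  by (simp add: attach_def insert_absorb)

lemma gunion_attach: "gunion (attach B H I) (H t) = attach B H (insert t I)"
  by (auto simp: attach_def gunion_def)

lemma finite_graphs_on: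
  assumes "finite V"
  shows "finite {G. sgraph G \<and> verts G = V}"
proof (rule finite_subset)
  show "{G. sgraph G \<and> verts G = V} \<subseteq> Graph V ` Pow (Pow V)"
  proof
    fix G assume "G \<in> {G. sgraph G \<and> verts G = V}"
    then have "G = Graph V (edges G)" "edges G \<in> Pow (Pow V)"
      using sgraph_subset[of G] by (auto simp: graph_eq_iff)
    then show "G \<in> Graph V ` Pow (Pow V)" by blast
  qed
qed (use assms in simp)

context stable_class
begin

lemma in_class_gmap: "G \<in> \<G> \<Longrightarrow> inj_on f (verts G) \<Longrightarrow> gmap f G \<in> \<G>"
  by (rule in_class_iso[of G f]) (simp_all add: graph_iso_iff)

lemma conn_class_gmap: "G \<in> conn_class \<G> \<Longrightarrow> inj_on f (verts G) \<Longrightarrow> gmap f G \<in> conn_class \<G>"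
  by (simp add: conn_class_def in_class_gmap gconnected_gmap)

lemma block_class_gmap: "G \<in> block_class \<G> \<Longrightarrow> inj_on f (verts G) \<Longrightarrow> gmap f G \<in> block_class \<G>"
  by (simp add: block_class_def in_class_gmap two_connected_gmap in_class_sgraph)

lemma decomp_gmap:
  assumes d: "decomp G B H" and f: "inj_on f (verts G)"
  shows "decomp (gmap f G) (gmap f B) (\<lambda>w. gmap f (H (inv_into (verts B) f w)))"
proof -
  have BG: "verts B \<subseteq> verts G" and HG: "\<And>v. v \<in> verts B \<Longrightarrow> verts (H v) \<subseteq> verts G"
    using d decompD(5)[OF d] by (auto simp: decomp_def)
  have inv: "inv_into (verts B) f (f v) = v" if "v \<in> verts B" for v
    using inv_into_f_f[OF inj_on_subset[OF f BG] that] .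
  have int: "f ` verts (H v) \<inter> f ` verts B = {f v}" if "v \<in> verts B" for v
    using inj_on_image_Int[OF f HG[OF that] BG] decompD(3)[OF d that] by simp
  have dis: "f ` verts (H v) \<inter> f ` verts (H w) = {}" if "v \<in> verts B" "w \<in> verts B" "f v \<noteq> f w" for v w
  proof -
    have "verts (H v) \<inter> verts (H w) = {}" using decompD(4)[OF d that(1,2)] that(3) by auto
    then show ?thesis using inj_on_image_Int[OF f HG[OF that(1)] HG[OF that(2)]] by simp
  qed
  have "gmap f G = gmap f (attach B H (verts B))" using d by (simp add: decomp_def)
  also have "\<dots> = attach (gmap f B) (\<lambda>w. gmap f (H (inv_into (verts B) f w))) (f ` verts B)"
    by (auto simp: graph_eq_iff inv)
  finally show ?thesis
    unfolding decomp_def disjoint_family_on_def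
    using block_class_gmap[OF decompD(1)[OF d] inj_on_subset[OF f BG]]
      conn_class_gmap[OF decompD(2)[OF d] inj_on_subset[OF f HG]] int dis
    by (auto simp: inv)
qed

section \<open>Links\<close>

text \<open>The one-vertex graph as the piece at the sink leaves the union unchanged.\<close>

lemma is_link_iff:
  "is_link \<G> (G, s, t) \<longleftrightarrow>
    (\<exists>B H. decomp G B H \<and> s \<in> verts B \<and> t \<in> verts B \<and> s \<noteq> t \<and> H t = K1 t)"
proof
  assume "is_link \<G> (G, s, t)"
  then obtain B H where B: "B \<in> block_class \<G>" "s \<in> verts B" "t \<in> verts B" "s \<noteq> t"
    and H: "\<And>v. v \<in> verts B - {t} \<Longrightarrow> H v \<in> conn_class \<G> \<and> verts (H v) \<inter> verts B = {v}"
    and dis: "disjoint_family_on (\<lambda>v. verts (H v)) (verts B - {t})"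
    and G: "G = attach B H (verts B - {t})"
    unfolding is_link_def attach_def by auto
  let ?H = "H(t := K1 t)"
  have tH: "t \<notin> verts (H v)" if "v \<in> verts B - {t}" for v
    using H[OF that] that B(3) by auto
  have "G = attach B ?H (verts B - {t})" unfolding G by (rule attach_cong) auto
  also have "\<dots> = attach B ?H (insert t (verts B - {t}))" using B(3) by (intro attach_K1) auto
  finally have "G = attach B ?H (verts B)" using B(3) by (simp add: insert_absorb)
  moreover have "disjoint_family_on (\<lambda>v. verts (?H v)) (verts B)"
    using dis tH unfolding disjoint_family_on_def by auto
  ultimately have "decomp G B ?H"
    unfolding decomp_def using B H K1_in_conn_class by auto
  then show "\<exists>B H. decomp G B H \<and> s \<in> verts B \<and> t \<in> verts B \<and> s \<noteq> t \<and> H t = K1 t"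
    using B(2-4) by (intro exI[of _ B] exI[of _ ?H]) auto
next
  assume "\<exists>B H. decomp G B H \<and> s \<in> verts B \<and> t \<in> verts B \<and> s \<noteq> t \<and> H t = K1 t"
  then obtain B H where d: "decomp G B H" and st: "s \<in> verts B" "t \<in> verts B" "s \<noteq> t" "H t = K1 t" by blast
  have "G = attach B H (insert t (verts B - {t}))" using d st(2) by (simp add: decomp_def insert_absorb)
  also have "\<dots> = attach B H (verts B - {t})" using st(2,4) by (intro attach_K1[symmetric]) auto
  finally have G: "G = attach B H (verts B - {t})" .
  have "disjoint_family_on (\<lambda>v. verts (H v)) (verts B - {t})"
    using d by (intro disjoint_family_on_mono[of "verts B - {t}" "verts B"]) (auto simp: decomp_def)
  then show "is_link \<G> (G, s, t)"
    unfolding is_link_def prod.case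
    using conn_classD(1)[OF decomp_in_conn_class[OF d]] decompD(1,2,3)[OF d] st(1-3) G
    by (intro conjI exI[of _ B] exI[of _ H]) (auto simp: attach_def)
qed

lemma is_linkD:
  assumes "is_link \<G> (G, s, t)"
  shows "G \<in> conn_class \<G>" "s \<in> verts G" "t \<in> verts G" "s \<noteq> t"
proof -
  obtain B H where d: "decomp G B H" and st: "s \<in> verts B" "t \<in> verts B" "s \<noteq> t" "H t = K1 t"
    using assms unfolding is_link_iff by blast
  show "G \<in> conn_class \<G>" by (rule decomp_in_conn_class[OF d])
  show "s \<in> verts G" "t \<in> verts G" "s \<noteq> t" using d st by (auto simp: decomp_def)
qed

lemma is_link_gmap:
  assumes l: "is_link \<G> (G, s, t)" and f: "inj_on f (verts G)"
  shows "is_link \<G> (gmap f G, f s, f t)"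
proof -
  obtain B H where d: "decomp G B H" and st: "s \<in> verts B" "t \<in> verts B" "s \<noteq> t" "H t = K1 t"
    using l unfolding is_link_iff by blast
  have "verts B \<subseteq> verts G" using d by (auto simp: decomp_def)
  then have "inv_into (verts B) f (f t) = t" using inj_on_subset[OF f] st(2) by (simp add: inv_into_f_f)
  moreover have "f s \<noteq> f t" using inj_onD[OF f] is_linkD[OF l] by blast
  ultimately show ?thesis
    unfolding is_link_iff using decomp_gmap[OF d f] st
    by (intro exI[of _ "gmap f B"] exI[of _ "\<lambda>w. gmap f (H (inv_into (verts B) f w))"])
      (auto simp: gmap_K1)
qed

definition links_on :: "nat set \<Rightarrow> nat \<Rightarrow> (nat graph \<times> nat) set" where
  "links_on U t = {(G, s). is_link \<G> (G, s, t) \<and> verts G = insert t U}"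

definition birooted :: "nat set \<Rightarrow> (nat graph \<times> nat \<times> nat) set" where
  "birooted V = {(G, x, v). G \<in> conn_class \<G> \<and> verts G = V \<and> x \<in> V \<and> v \<in> V}"

lemma finite_links_on: "finite U \<Longrightarrow> finite (links_on U t)"
proof -
  assume "finite U"
  then have "finite ({G. sgraph G \<and> verts G = insert t U} \<times> insert t U)"
    using finite_graphs_on[of "insert t U"] by simp
  moreover have "links_on U t \<subseteq> {G. sgraph G \<and> verts G = insert t U} \<times> insert t U"
    using is_linkD(1,2) conn_classD(3) by (auto simp: links_on_def)
  ultimately show ?thesis by (rule finite_subset[rotated])
qed

lemma finite_birooted: "finite V \<Longrightarrow> finite (birooted V)"
proof -
  assume "finite V"
  then have "finite ({G. sgraph G \<and> verts G = V} \<times> V \<times> V)" by (intro finite_cartesian_product finite_graphs_on)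
  moreover have "birooted V \<subseteq> {G. sgraph G \<and> verts G = V} \<times> V \<times> V"
    using conn_classD(3) by (auto simp: birooted_def)
  ultimately show ?thesis by (rule finite_subset[rotated])
qed

lemma decomp_glue:
  assumes d: "decomp G1 B H" and t: "t \<in> verts B" "H t = K1 t"
    and G2: "G2 \<in> conn_class \<G>" "verts G1 \<inter> verts G2 = {t}"
  shows "decomp (gunion G1 G2) B (H(t := G2))"
proof -
  have G1: "verts G1 = (\<Union>v\<in>verts B. verts (H v))" "edges G1 = edges B \<union> (\<Union>v\<in>verts B. edges (H v))"
    by (rule decompD(5)[OF d], rule decompD(6)[OF d])
  have BG: "verts B \<subseteq> verts G1" using d by (auto simp: decomp_def)
  have t2: "t \<in> verts G2" using G2(2) by blast
  have "verts G2 \<inter> verts B = {t}" using G2(2) BG t(1) by blast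
  moreover have "verts (H v) \<inter> verts G2 = {}" if v: "v \<in> verts B" "v \<noteq> t" for v
  proof -
    have "verts (H v) \<inter> verts G2 \<subseteq> {t}" using G2(2) G1(1) v(1) by blast
    moreover have "t \<notin> verts (H v)"
    proof
      assume "t \<in> verts (H v)"
      then have "t \<in> verts (H v) \<inter> verts B" using t(1) by simp
      then show False unfolding decompD(3)[OF d v(1)] using v(2) by simp
    qed
    ultimately show ?thesis by blast
  qed
  moreover have "gunion G1 G2 = attach B (H(t := G2)) (verts B)"
  proof -
    let ?H = "H(t := G2)"
    have "G1 = attach B H (insert t (verts B - {t}))" using d t(1) by (simp add: decomp_def insert_absorb)
    also have "\<dots> = attach B H (verts B - {t})" using t by (intro attach_K1[symmetric]) auto
    also have "\<dots> = attach B ?H (verts B - {t})" by (rule attach_cong) auto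
    finally have "gunion G1 G2 = attach B ?H (insert t (verts B - {t}))"
      using gunion_attach[of B ?H "verts B - {t}" t] by simp
    then show ?thesis using t(1) by (simp add: insert_absorb)
  qed
  moreover have "disjoint_family_on (\<lambda>v. verts (H v)) (verts B)" using d by (simp add: decomp_def)
  ultimately show ?thesis
    unfolding decomp_def using decompD(1,2,3)[OF d] G2(1)
    by (auto simp: disjoint_family_on_def Int_commute)
qed

lemma decomp_split:
  assumes d: "decomp G B H" and x: "x \<in> verts B" and t: "t \<in> verts B" "t \<noteq> x"
  defines "G1 \<equiv> attach B H (verts B - {t})"
  shows "is_link \<G> (G1, x, t)"
proof -
  note g = decomp_gunion[OF d t(1), folded G1_def]
  have "gunion G1 (H t) \<in> \<G>"
    using conn_classD(1)[OF decomp_in_conn_class[OF d]] unfolding g(1)[symmetric] .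
  then have "G1 \<in> \<G>"
    using gunion_parts_in_class[OF _ g(3) conn_classD(3)[OF decompD(2)[OF d t(1)]] g(2)] by blast
  moreover have "disjoint_family_on (\<lambda>v. verts (H v)) (verts B - {t})"
    using d by (intro disjoint_family_on_mono[of "verts B - {t}" "verts B"]) (auto simp: decomp_def)
  ultimately show ?thesis
    unfolding is_link_def prod.case
    using decompD(1,2,3)[OF d] x t
    by (intro conjI exI[of _ B] exI[of _ H]) (auto simp: attach_def G1_def)
qed

text \<open>Surjectivity is the existence of a block at the first mark towards the second one, and injectivity is its uniqueness: block and gate determine
  the link, which ends at the gate, and the graph beyond it.\<close>

lemma bij_betw_glue:
  assumes V: "finite V"
  shows "bij_betw (\<lambda>(U, (G2, t, v), (G1, s)). (gunion G1 G2, s, v))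
    (SIGMA U:Pow V. SIGMA y:birooted (V - U). links_on U (fst (snd y)))
    {(G, x, v) \<in> birooted V. x \<noteq> v}" (is "bij_betw ?g ?A ?B")
proof -
  let ?P = "\<lambda>U G2 t v G1 s. U \<subseteq> V \<and> (G2, t, v) \<in> birooted (V - U) \<and> (G1, s) \<in> links_on U t"
  have dec: "\<exists>B H. decomp G1 B H \<and> s \<in> verts B \<and> t \<in> verts B \<and> s \<noteq> t \<and> H t = K1 t
      \<and> decomp (gunion G1 G2) B (H(t := G2)) \<and> v \<in> verts G2 \<and> verts G2 = V - U
      \<and> verts G1 = insert t U \<and> t \<in> V - U" if "?P U G2 t v G1 s" for U G2 t v G1 s
  proof -
    have l: "is_link \<G> (G1, s, t)" "verts G1 = insert t U" using that by (auto simp: links_on_def)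
    have G2: "G2 \<in> conn_class \<G>" "verts G2 = V - U" "t \<in> V - U" "v \<in> V - U"
      using that by (auto simp: birooted_def)
    obtain B H where d: "decomp G1 B H" "s \<in> verts B" "t \<in> verts B" "s \<noteq> t" "H t = K1 t"
      using l(1) unfolding is_link_iff by blast
    have "verts G1 \<inter> verts G2 = {t}" using l(2) G2 by auto
    then show ?thesis using d decomp_glue[OF d(1,3,5) G2(1)] G2 l(2) by blast
  qed
  show ?thesis
    unfolding bij_betw_def
  proof
    show "inj_on ?g ?A"
    proof (rule inj_onI)
      fix p p' assume p: "p \<in> ?A" and p': "p' \<in> ?A" and eq: "?g p = ?g p'"
      obtain U G2 t v G1 s where pd: "p = (U, (G2, t, v), (G1, s))" by (cases p) auto
      obtain U' G2' t' v' G1' s' where pd': "p' = (U', (G2', t', v'), (G1', s'))" by (cases p') auto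
      have P: "?P U G2 t v G1 s" using p pd by auto
      have P': "?P U' G2' t' v' G1' s'" using p' pd' by auto
      obtain B H where B: "decomp G1 B H" "s \<in> verts B" "t \<in> verts B" "s \<noteq> t" "H t = K1 t"
        "decomp (gunion G1 G2) B (H(t := G2))" "v \<in> verts G2" "verts G2 = V - U" "verts G1 = insert t U"
        "t \<in> V - U"
        using dec[OF P] by blast
      obtain B' H' where B': "decomp G1' B' H'" "s' \<in> verts B'" "t' \<in> verts B'" "s' \<noteq> t'" "H' t' = K1 t'"
        "decomp (gunion G1' G2') B' (H'(t' := G2'))" "v' \<in> verts G2'" "verts G2' = V - U'"
        "verts G1' = insert t' U'" "t' \<in> V - U'"
        using dec[OF P'] by blast
      have e: "gunion G1' G2' = gunion G1 G2" "s' = s" "v' = v" using eq pd pd' by auto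
      note d' = B'(6)[unfolded e(1)]
      have BB: "B = B'"
        by (rule decomp_block_unique[OF B(6) d' B(2) B'(2)[unfolded e(2)] B(3) _ _ B'(3), of v])
          (use B B' e in auto)
      have HH: "(H(t := G2)) u = (H'(t' := G2')) u" if "u \<in> verts B" for u
        using decomp_pieces_unique[OF B(6) _ that] d' BB by simp
      have tt: "t = t'"
      proof (rule decompD(4)[OF B(6)])
        show "t \<in> verts B" "t' \<in> verts B" using B(3) B'(3) BB by auto
        show "v \<in> verts ((H(t := G2)) t)" using B(7) by simp
        show "v \<in> verts ((H(t := G2)) t')" using HH[of t'] B'(3,7) BB e(3) by simp
      qed
      have GG: "G2 = G2'" using HH[OF B(3)] tt by simp
      have "H u = H' u" if "u \<in> verts B" for u
        using HH[OF that] tt B(5) B'(5) by (cases "u = t") auto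
      then have "attach B H (verts B) = attach B' H' (verts B')" unfolding BB[symmetric] attach_def by auto
      then have G1: "G1 = G1'" using B(1) B'(1) by (simp add: decomp_def)
      have "U = V - verts G2" "U' = V - verts G2'" using B(8) B'(8) P P' by auto
      then show "p = p'" using pd pd' e G1 GG tt by simp
    qed
    show "?g ` ?A = ?B"
    proof
      show "?g ` ?A \<subseteq> ?B"
      proof
        fix z assume "z \<in> ?g ` ?A"
        then obtain U G2 t v G1 s where P: "?P U G2 t v G1 s" and z: "z = (gunion G1 G2, s, v)" by auto
        obtain B H where B: "decomp G1 B H" "s \<in> verts B" "t \<in> verts B" "s \<noteq> t" "H t = K1 t"
          "decomp (gunion G1 G2) B (H(t := G2))" "v \<in> verts G2" "verts G2 = V - U" "verts G1 = insert t U"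
          "t \<in> V - U"
          using dec[OF P] by blast
        have "s \<in> verts G1" using B(1,2) by (auto simp: decomp_def)
        then have "s \<in> U" using B(4,9) by auto
        moreover have "verts (gunion G1 G2) = V" using B(8-10) P by auto
        ultimately show "z \<in> ?B" using B(7,8) decomp_in_conn_class[OF B(6)] P
          by (auto simp: z birooted_def)
      qed
      show "?B \<subseteq> ?g ` ?A"
      proof
        fix z assume "z \<in> ?B"
        then obtain G x v where z: "z = (G, x, v)" and G: "G \<in> conn_class \<G>" "verts G = V" "x \<in> V" "v \<in> V"
          and xv: "x \<noteq> v" by (auto simp: birooted_def)
        obtain B H t where d: "decomp G B H" "x \<in> verts B" "t \<in> verts B" "t \<noteq> x" "v \<in> verts (H t)"
          using decomp_exists_towards[OF G(1) _ _ xv] G(2-4) by blast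
        define G1 where "G1 = attach B H (verts B - {t})"
        note g = decomp_gunion[OF d(1,3), folded G1_def]
        define U where "U = verts G1 - {t}"
        have tG: "t \<in> verts G1" using g(2) by blast
        have vV: "verts G1 \<union> verts (H t) = V" using g(1) G(2) by (metis gunion_simps(1))
        have "V - U = verts (H t)" using vV g(2) by (auto simp: U_def)
        moreover have "insert t U = verts G1" using tG by (auto simp: U_def)
        moreover have "t \<in> verts (H t)" using decompD(7)[OF d(1,3)] .
        ultimately have "?P U (H t) t v G1 x"
          using decomp_split[OF d(1,2,3,4), folded G1_def] decompD(2)[OF d(1,3)] d(5) vV
          by (auto simp: links_on_def birooted_def U_def)
        then have "(U, (H t, t, v), (G1, x)) \<in> ?A" by auto
        moreover have "z = ?g (U, (H t, t, v), (G1, x))" using g(1) z by simp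
        ultimately show "z \<in> ?g ` ?A" by blast
      qed
    qed
  qed
qed

end

section \<open>Counting links\<close>

lemma sum_Pow_card:
  assumes "finite A"
  shows "(\<Sum>W\<in>Pow A. h (card W)) = (\<Sum>j\<le>card A. real (card A choose j) * (h j :: real))"
proof -
  have "(\<Sum>W\<in>Pow A. h (card W)) = (\<Sum>j\<le>card A. \<Sum>W\<in>{W \<in> Pow A. card W = j}. h (card W))"
    using assms by (intro sum.group[symmetric]) (auto intro: card_mono)
  also have "\<dots> = (\<Sum>j\<le>card A. real (card A choose j) * h j)"
  proof (rule sum.cong)
    fix j
    have "(\<Sum>W\<in>{W \<in> Pow A. card W = j}. h (card W)) = real (card {W. W \<subseteq> A \<and> card W = j}) * h j"
      by simp
    then show "(\<Sum>W\<in>{W \<in> Pow A. card W = j}. h (card W)) = real (card A choose j) * h j"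
      by (simp add: n_subsets[OF assms])
  qed simp
  finally show ?thesis .
qed

lemma fps_power_nth_small:
  "fps_nth (T :: real fps) 0 = 0 \<Longrightarrow> n < k \<Longrightarrow> fps_nth (T ^ k) n = 0"
  by (simp add: startsby_zero_power_prefix)

context stable_class
begin

definition conn_on :: "nat set \<Rightarrow> nat graph set" where
  "conn_on V = {G \<in> conn_class \<G>. verts G = V}"

definition blocks_on :: "nat set \<Rightarrow> nat graph set" where
  "blocks_on V = {G \<in> block_class \<G>. verts G = V}"

definition forests :: "nat set \<Rightarrow> nat set \<Rightarrow> (nat \<Rightarrow> nat graph) set" where
  "forests S U = {H \<in> extensional S. (\<forall>v\<in>S. H v \<in> conn_class \<G> \<and> verts (H v) \<inter> S = {v}) \<and>
     disjoint_family_on (\<lambda>v. verts (H v)) S \<and> (\<Union>v\<in>S. verts (H v)) = U}"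

lemma finite_conn_on: "finite V \<Longrightarrow> finite (conn_on V)"
  using conn_classD(3) by (auto simp: conn_on_def intro: finite_subset[OF _ finite_graphs_on])

lemma finite_blocks_on: "finite V \<Longrightarrow> finite (blocks_on V)"
  using block_classD(3) by (auto simp: blocks_on_def intro: finite_subset[OF _ finite_graphs_on])

lemma gmap_bij:
  assumes f: "bij_betw f V W"
    and A: "\<And>G. G \<in> A \<Longrightarrow> sgraph G" "\<And>G g. G \<in> A \<Longrightarrow> inj_on g (verts G) \<Longrightarrow> gmap g G \<in> A"
  shows "bij_betw (gmap f) {G \<in> A. verts G = V} {G \<in> A. verts G = W}"
proof (rule bij_betw_byWitness[of _ "gmap (inv_into V f)"])
  have inj: "inj_on f V" and im: "f ` V = W" using f by (auto simp: bij_betw_def)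
  note g = bij_betw_inv_into[OF f]
  have injg: "inj_on (inv_into V f) W" and img: "inv_into V f ` W = V" using g by (auto simp: bij_betw_def)
  show "\<forall>G\<in>{G \<in> A. verts G = V}. gmap (inv_into V f) (gmap f G) = G"
    using A(1) gmap_inv inj by blast
  show "\<forall>G\<in>{G \<in> A. verts G = W}. gmap f (gmap (inv_into V f) G) = G"
  proof
    fix G assume "G \<in> {G \<in> A. verts G = W}"
    then show "gmap f (gmap (inv_into V f) G) = G"
      unfolding gmap_comp using A(1) im by (intro gmap_ident) (auto simp: f_inv_into_f)
  qed
  show "gmap f ` {G \<in> A. verts G = V} \<subseteq> {G \<in> A. verts G = W}"
    using A(2) inj im by auto
  show "gmap (inv_into V f) ` {G \<in> A. verts G = W} \<subseteq> {G \<in> A. verts G = V}"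
    using A(2) injg img by auto
qed

lemma bij_betw_standard:
  assumes "finite V"
  obtains f where "bij_betw f V {1..card V}"
  using finite_same_card_bij[of V "{1..card V}"] assms by auto

definition nconn :: "nat \<Rightarrow> nat" where "nconn n = card (conn_on {1..n})"
definition nblocks :: "nat \<Rightarrow> nat" where "nblocks n = card (blocks_on {1..n})"

lemma card_conn_on:
  assumes V: "finite V"
  shows "card (conn_on V) = nconn (card V)"
proof -
  obtain f where "bij_betw f V {1..card V}" using bij_betw_standard[OF V] .
  from bij_betw_same_card[OF gmap_bij[OF this conn_classD(3) conn_class_gmap]]
  show ?thesis by (simp add: conn_on_def nconn_def)
qed

lemma card_blocks_on:
  assumes V: "finite V"
  shows "card (blocks_on V) = nblocks (card V)"
proof -
  obtain f where "bij_betw f V {1..card V}" using bij_betw_standard[OF V] .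
  from bij_betw_same_card[OF gmap_bij[OF this block_classD(3) block_class_gmap]]
  show ?thesis by (simp add: blocks_on_def nblocks_def)
qed

text \<open>Splitting off the piece at the root \<open>v\<close>; \<open>W\<close> consists of its vertices other than \<open>v\<close>. The value \<open>undefined\<close> at \<open>v\<close> keeps the
  remaining family in \<open>extensional S\<close>.\<close>

lemma bij_betw_forests_insert:
  assumes v: "v \<in> U" "v \<notin> S" and S: "S \<subseteq> U"
  shows "bij_betw (\<lambda>(W, G, H). H(v := G))
    (SIGMA W:Pow (U - insert v S). conn_on (insert v W) \<times> forests S (U - insert v W))
    (forests (insert v S) U)" (is "bij_betw ?g ?A ?B")
proof (rule bij_betw_byWitness[of _ "\<lambda>H. (verts (H v) - {v}, H v, H(v := undefined))"])
  show "\<forall>a\<in>?A. (\<lambda>H. (verts (H v) - {v}, H v, H(v := undefined))) (?g a) = a"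
  proof
    fix a assume "a \<in> ?A"
    then obtain W G H where a: "a = (W, G, H)" "W \<subseteq> U - insert v S" "G \<in> conn_on (insert v W)"
      "H \<in> forests S (U - insert v W)" by auto
    have "H v = undefined" using a(4) v(2) by (auto simp: forests_def extensional_def)
    then have "(H(v := G))(v := undefined) = H" by (auto simp: fun_eq_iff)
    then show "(\<lambda>H. (verts (H v) - {v}, H v, H(v := undefined))) (?g a) = a"
      using a by (auto simp: conn_on_def)
  qed
  show "\<forall>H\<in>?B. ?g (verts (H v) - {v}, H v, H(v := undefined)) = H"
    by (auto simp: fun_eq_iff)
  show "?g ` ?A \<subseteq> ?B"
  proof
    fix z assume "z \<in> ?g ` ?A"
    then obtain W G H where z: "z = H(v := G)" and W: "W \<subseteq> U - insert v S"
      and G: "G \<in> conn_class \<G>" "verts G = insert v W"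
      and H: "H \<in> extensional S" "\<And>u. u \<in> S \<Longrightarrow> H u \<in> conn_class \<G> \<and> verts (H u) \<inter> S = {u}"
      "disjoint_family_on (\<lambda>v. verts (H v)) S" "(\<Union>v\<in>S. verts (H v)) = U - insert v W"
      by (auto simp: conn_on_def forests_def)
    have sub: "verts (H u) \<subseteq> U - insert v W" if "u \<in> S" for u using H(4) that by blast
    have "z \<in> extensional (insert v S)" using H(1) by (auto simp: z extensional_def)
    moreover have "z u \<in> conn_class \<G> \<and> verts (z u) \<inter> insert v S = {u}" if "u \<in> insert v S" for u
      using that H(2)[of u] sub[of u] G W v by (cases "u = v") (auto simp: z)
    moreover have "disjoint_family_on (\<lambda>u. verts (z u)) (insert v S)"
      unfolding disjoint_family_on_def
    proof (intro ballI impI)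
      fix a b assume ab: "a \<in> insert v S" "b \<in> insert v S" "a \<noteq> b"
      show "verts (z a) \<inter> verts (z b) = {}"
      proof (cases "a = v \<or> b = v")
        case True
        then show ?thesis using ab sub[of a] sub[of b] G(2) unfolding z by auto
      next
        case False
        then show ?thesis using ab H(3) by (auto simp: z disjoint_family_on_def)
      qed
    qed
    moreover have "(\<Union>u\<in>insert v S. verts (z u)) = U"
    proof -
      have "(\<Union>u\<in>S. verts (z u)) = (\<Union>u\<in>S. verts (H u))"
        using v(2) by (intro SUP_cong) (auto simp: z)
      then have "(\<Union>u\<in>insert v S. verts (z u)) = verts G \<union> (\<Union>u\<in>S. verts (H u))" by (simp add: z)
      then show ?thesis unfolding H(4) G(2) using W v(1) by auto
    qed
    ultimately show "z \<in> ?B" by (simp add: forests_def)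
  qed
  show "(\<lambda>H. (verts (H v) - {v}, H v, H(v := undefined))) ` ?B \<subseteq> ?A"
  proof
    fix z assume "z \<in> (\<lambda>H. (verts (H v) - {v}, H v, H(v := undefined))) ` ?B"
    then obtain H where z: "z = (verts (H v) - {v}, H v, H(v := undefined))"
      and H: "H \<in> extensional (insert v S)"
      "\<And>u. u \<in> insert v S \<Longrightarrow> H u \<in> conn_class \<G> \<and> verts (H u) \<inter> insert v S = {u}"
      "disjoint_family_on (\<lambda>v. verts (H v)) (insert v S)" "(\<Union>u\<in>insert v S. verts (H u)) = U"
      by (auto simp: forests_def)
    have vH: "v \<in> verts (H v)" using H(2)[of v] by blast
    then have ins: "insert v (verts (H v) - {v}) = verts (H v)" by blast
    have dis: "verts (H u) \<inter> verts (H v) = {}" if "u \<in> S" for u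
      using H(3) that v(2) unfolding disjoint_family_on_def by auto
    have "verts (H v) - {v} \<in> Pow (U - insert v S)"
    proof -
      have "verts (H v) \<subseteq> U" using H(4) by auto
      moreover have "x \<notin> S" if "x \<in> verts (H v) - {v}" for x
      proof
        assume "x \<in> S"
        then have "x \<in> verts (H v) \<inter> insert v S" using that by simp
        then show False using H(2)[of v] that by auto
      qed
      ultimately show ?thesis by auto
    qed
    moreover have "H v \<in> conn_on (verts (H v))" using H(2)[of v] by (simp add: conn_on_def)
    moreover have "H(v := undefined) \<in> forests S (U - verts (H v))"
    proof -
      have "(\<Union>u\<in>S. verts ((H(v := undefined)) u)) = (\<Union>u\<in>S. verts (H u))"
        using v(2) by (intro SUP_cong) auto
      also have "\<dots> = U - verts (H v)" using H(4) dis by auto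
      finally have 1: "(\<Union>u\<in>S. verts ((H(v := undefined)) u)) = U - verts (H v)" .
      have 2: "disjoint_family_on (\<lambda>u. verts ((H(v := undefined)) u)) S"
        using H(3) v(2) by (auto simp: disjoint_family_on_def)
      have 3: "verts (H u) \<inter> S = {u}" if "u \<in> S" for u
      proof -
        have "verts (H u) \<inter> S \<subseteq> {u}" "u \<in> verts (H u)" using H(2)[of u] that by auto
        then show ?thesis using that by auto
      qed
      have 4: "H(v := undefined) \<in> extensional S" using H(1) v(2) by (auto simp: extensional_def)
      have 5: "(H(v := undefined)) u = H u" if "u \<in> S" for u using that v(2) by auto
      show ?thesis unfolding forests_def using 1 2 3 4 H(2) v(2) by (simp add: 5)
    qed
    ultimately show "z \<in> ?A" unfolding z using ins by simp
  qed
qed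

abbreviation T :: "real fps" where "T \<equiv> rooted_egf \<G>"

lemma conn_egf_nth: "fps_nth (egf (conn_class \<G>)) n = real (nconn n) / fact n"
  by (simp add: egf_def nconn_def conn_on_def)

lemma block_egf_nth: "fps_nth (egf (block_class \<G>)) n = real (nblocks n) / fact n"
  by (simp add: egf_def nblocks_def blocks_on_def)

lemma T_0: "fps_nth T 0 = 0"
  by (simp add: rooted_egf_def)

lemma T_nth: "fps_nth T n = real n * real (nconn n) / fact n"
  by (cases n) (simp_all add: rooted_egf_def conn_egf_nth)

lemma T_nth_Suc: "fps_nth T (Suc n) = real (nconn (Suc n)) / fact n"
  unfolding T_nth fact_Suc by (simp add: divide_simps del: of_nat_Suc)

lemma finite_forests:
  assumes "finite U" "S \<subseteq> U"
  shows "finite (forests S U)"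
proof (rule finite_subset)
  show "forests S U \<subseteq> (\<Pi>\<^sub>E v\<in>S. \<Union>V\<in>Pow U. conn_on V)"
  proof
    fix H assume H: "H \<in> forests S U"
    then have "H v \<in> (\<Union>V\<in>Pow U. conn_on V)" if "v \<in> S" for v
      using that by (auto simp: forests_def conn_on_def)
    then show "H \<in> (\<Pi>\<^sub>E v\<in>S. \<Union>V\<in>Pow U. conn_on V)" using H by (auto simp: forests_def PiE_iff)
  qed
  show "finite (\<Pi>\<^sub>E v\<in>S. \<Union>V\<in>Pow U. conn_on V)"
    using assms finite_subset by (intro finite_PiE finite_UN_I finite_conn_on) auto
qed

text \<open>Each of the \<open>k\<close> roots carries a rooted connected graph counted by \<open>T\<close>; prescribing the labels of the roots amounts to division by
  \<open>m! / (m - k)!\<close>.\<close>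

lemma card_forests:
  assumes "finite U" "S \<subseteq> U"
  shows "real (card (forests S U)) = fact (card U - card S) * fps_nth (T ^ card S) (card U)"
proof -
  have "finite S" using assms finite_subset by blast
  then show ?thesis using assms
  proof (induction S arbitrary: U rule: finite_induct)
    case empty
    have "forests {} U = (if U = {} then {\<lambda>_. undefined} else {})"
      by (auto simp: forests_def disjoint_family_on_def)
    then show ?case using empty(1) by (auto simp: fps_one_nth)
  next
    case (insert v S)
    define m where "m = card U"
    define k where "k = card S"
    have U: "finite U" "v \<in> U" "v \<notin> S" "S \<subseteq> U" using insert by auto
    have cR: "card (U - insert v S) = m - Suc k"
      using U insert(1) by (subst card_Diff_subset) (auto simp: m_def k_def)
    have mk: "Suc k \<le> m"
      using card_mono[of U "insert v S"] U insert(1) by (simp add: m_def k_def)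
    define h where "h = (\<lambda>j. real (nconn (Suc j)) * (fact (m - Suc j - k) * fps_nth (T ^ k) (m - Suc j)))"
    have "real (card (forests (insert v S) U))
        = real (card (SIGMA W:Pow (U - insert v S). conn_on (insert v W) \<times> forests S (U - insert v W)))"
      using bij_betw_same_card[OF bij_betw_forests_insert[OF U(2-4)]] by simp
    also have "\<dots> = (\<Sum>W\<in>Pow (U - insert v S). h (card W))"
    proof (subst card_SigmaI)
      show "finite (Pow (U - insert v S))" using U by simp
      show "\<forall>W\<in>Pow (U - insert v S). finite (conn_on (insert v W) \<times> forests S (U - insert v W))"
        using U finite_subset[of _ "U - insert v S"]
        by (auto intro!: finite_cartesian_product finite_conn_on finite_forests)
      have "real (card (conn_on (insert v W) \<times> forests S (U - insert v W))) = h (card W)"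
        if W: "W \<in> Pow (U - insert v S)" for W
      proof -
        have fW: "finite W" using W U finite_subset[of W "U - insert v S"] by auto
        have "v \<notin> W" using W by auto
        then have cW: "card (insert v W) = Suc (card W)" using fW by simp
        have cU: "card (U - insert v W) = m - Suc (card W)"
          using W U fW cW by (subst card_Diff_subset) (auto simp: m_def)
        have "S \<subseteq> U - insert v W" using W U by auto
        then have "real (card (forests S (U - insert v W)))
            = fact (m - Suc (card W) - k) * fps_nth (T ^ k) (m - Suc (card W))"
          using insert.IH[of "U - insert v W"] U cU by (simp add: k_def)
        moreover have "card (conn_on (insert v W)) = nconn (Suc (card W))"
          using card_conn_on[of "insert v W"] fW cW by simp
        ultimately show ?thesis by (simp add: card_cartesian_product h_def)
      qed
      then show "real (\<Sum>W\<in>Pow (U - insert v S). card (conn_on (insert v W) \<times> forests S (U - insert v W)))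
          = (\<Sum>W\<in>Pow (U - insert v S). h (card W))" by simp
    qed
    also have "\<dots> = (\<Sum>j\<le>m - Suc k. real (m - Suc k choose j) * h j)"
      using sum_Pow_card[of "U - insert v S" h] U cR by simp
    also have "\<dots> = (\<Sum>j\<le>m - Suc k. fact (m - Suc k) * (fps_nth T (Suc j) * fps_nth (T ^ k) (m - Suc j)))"
    proof (rule sum.cong)
      fix j assume "j \<in> {..m - Suc k}"
      then have "real (m - Suc k choose j) = fact (m - Suc k) / (fact j * fact (m - Suc k - j))"
        by (simp add: binomial_fact)
      moreover have "m - Suc k - j = m - Suc j - k" by simp
      ultimately show "real (m - Suc k choose j) * h j
          = fact (m - Suc k) * (fps_nth T (Suc j) * fps_nth (T ^ k) (m - Suc j))"
        unfolding h_def T_nth_Suc by simp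
    qed simp
    also have "\<dots> = fact (m - Suc k) * (\<Sum>j\<le>m - Suc k. fps_nth T (Suc j) * fps_nth (T ^ k) (m - Suc j))"
      by (simp add: sum_distrib_left)
    also have "(\<Sum>j\<le>m - Suc k. fps_nth T (Suc j) * fps_nth (T ^ k) (m - Suc j))
        = (\<Sum>j\<le>m - 1. fps_nth T (Suc j) * fps_nth (T ^ k) (m - Suc j))"
    proof (rule sum.mono_neutral_left)
      show "\<forall>i\<in>{..m - 1} - {..m - Suc k}. fps_nth T (Suc i) * fps_nth (T ^ k) (m - Suc i) = 0"
        using mk by (auto intro!: fps_power_nth_small T_0)
    qed auto
    also have "\<dots> = fps_nth (T * T ^ k) m"
    proof -
      obtain m' where m': "m = Suc m'" using mk by (cases m) auto
      have "fps_nth (T * T ^ k) m = (\<Sum>i\<le>Suc m'. fps_nth T i * fps_nth (T ^ k) (m - i))"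
        by (simp add: fps_mult_nth atLeast0AtMost m')
      also have "\<dots> = (\<Sum>j\<le>m'. fps_nth T (Suc j) * fps_nth (T ^ k) (m - Suc j))"
        by (subst sum.atMost_Suc_shift) (simp add: T_0)
      finally show ?thesis by (simp add: m')
    qed
    finally show ?case using insert(1,2) by (simp add: m_def k_def)
  qed
qed

text \<open>The block of a link is determined by source and sink: the sink serves as its own mark in the uniqueness of the block.\<close>

lemma bij_betw_link_parts:
  assumes t: "t \<notin> U"
  shows "bij_betw (\<lambda>(S, B, s, H). (attach B H S, s))
    (SIGMA S:Pow U. blocks_on (insert t S) \<times> S \<times> forests S U) (links_on U t)"
    (is "bij_betw ?g ?A ?B")
proof -
  have dec: "decomp (attach B H S) B (H(t := K1 t))"
    if "S \<subseteq> U" "B \<in> blocks_on (insert t S)" "H \<in> forests S U" for S B H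
  proof -
    have B: "B \<in> block_class \<G>" "verts B = insert t S" using that(2) by (auto simp: blocks_on_def)
    have H: "\<And>u. u \<in> S \<Longrightarrow> H u \<in> conn_class \<G>" "\<And>u. u \<in> S \<Longrightarrow> verts (H u) \<inter> S = {u}"
      "disjoint_family_on (\<lambda>v. verts (H v)) S" "(\<Union>v\<in>S. verts (H v)) = U"
      using that(3) by (auto simp: forests_def)
    have tS: "t \<notin> S" using t that(1) by auto
    have tH: "t \<notin> verts (H u)" if "u \<in> S" for u using H(4) that t by auto
    have "attach B H S = attach B (H(t := K1 t)) S" using tS by (intro attach_cong) auto
    also have "\<dots> = attach B (H(t := K1 t)) (verts B)"
      unfolding B(2) by (rule attach_K1) (simp_all add: B(2))
    finally have 1: "attach B H S = attach B (H(t := K1 t)) (verts B)" .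
    have 2: "disjoint_family_on (\<lambda>v. verts ((H(t := K1 t)) v)) (verts B)"
      unfolding B(2) disjoint_family_on_def
      using H(3) tH tS by (auto simp: disjoint_family_on_def)
    have 3: "(H(t := K1 t)) v \<in> conn_class \<G> \<and> verts ((H(t := K1 t)) v) \<inter> verts B = {v}"
      if "v \<in> verts B" for v
      using that H(1,2) tH tS K1_in_conn_class unfolding B(2) by (cases "v = t") auto
    show ?thesis unfolding decomp_def using B(1) 1 2 3 by blast
  qed
  show ?thesis
    unfolding bij_betw_def
  proof
    show "inj_on ?g ?A"
    proof (rule inj_onI)
      fix p p' assume p: "p \<in> ?A" and p': "p' \<in> ?A" and eq: "?g p = ?g p'"
      obtain S B s H where pd: "p = (S, B, s, H)" by (cases p) auto
      obtain S' B' s' H' where pd': "p' = (S', B', s', H')" by (cases p') auto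
      have P: "S \<subseteq> U" "B \<in> blocks_on (insert t S)" "s \<in> S" "H \<in> forests S U" using p pd by auto
      have P': "S' \<subseteq> U" "B' \<in> blocks_on (insert t S')" "s' \<in> S'" "H' \<in> forests S' U" using p' pd' by auto
      have vB: "verts B = insert t S" "verts B' = insert t S'" using P(2) P'(2) by (auto simp: blocks_on_def)
      have tS: "t \<notin> S" "t \<notin> S'" using t P(1) P'(1) by auto
      have e: "attach B' H' S' = attach B H S" "s' = s" using eq pd pd' by auto
      note d = dec[OF P(1,2,4)] and d' = dec[OF P'(1,2,4), unfolded e(1)]
      have BB: "B = B'"
        by (rule decomp_block_unique[OF d d', of s t t t]) (use P(3) P'(3) tS e(2) in \<open>auto simp: vB\<close>)
      then have SS: "S = S'" using vB insert_ident[OF tS] by simp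
      have HH: "H u = H' u" if "u \<in> S" for u
      proof -
        have "u \<noteq> t" "u \<in> verts B" using that tS vB(1) by auto
        then show ?thesis using decomp_pieces_unique[OF d, of "H'(t := K1 t)" u] d' BB by simp
      qed
      have "H = H'"
      proof
        fix u show "H u = H' u"
          using HH[of u] P(4) P'(4) SS by (cases "u \<in> S") (auto simp: forests_def extensional_def)
      qed
      then show "p = p'" using pd pd' e BB SS by simp
    qed
    show "?g ` ?A = ?B"
    proof
      show "?g ` ?A \<subseteq> ?B"
      proof
        fix z assume "z \<in> ?g ` ?A"
        then obtain S B s H where P: "S \<subseteq> U" "B \<in> blocks_on (insert t S)" "s \<in> S" "H \<in> forests S U"
          and z: "z = (attach B H S, s)" by auto
        have vB: "verts B = insert t S" using P(2) by (auto simp: blocks_on_def)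
        have "t \<notin> S" using t P(1) by auto
        then have "is_link \<G> (attach B H S, s, t)"
          unfolding is_link_iff using dec[OF P(1,2,4)] P(3) vB
          by (intro exI[of _ B] exI[of _ "H(t := K1 t)"]) auto
        moreover have "verts (attach B H S) = insert t U"
        proof -
          have "(\<Union>v\<in>S. verts (H v)) = U" using P(4) by (simp add: forests_def)
          then show ?thesis using vB P(1) by auto
        qed
        ultimately show "z \<in> ?B" by (simp add: z links_on_def)
      qed
      show "?B \<subseteq> ?g ` ?A"
      proof
        fix z assume "z \<in> ?B"
        then obtain G s where z: "z = (G, s)" "is_link \<G> (G, s, t)" and vG: "verts G = insert t U"
          by (auto simp: links_on_def)
        obtain B H where d: "decomp G B H" and st: "s \<in> verts B" "t \<in> verts B" "s \<noteq> t" "H t = K1 t"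
          using z(2) unfolding is_link_iff by blast
        define S where "S = verts B - {t}"
        have vB: "verts B = insert t S" and tS: "t \<notin> S" using st(2) by (auto simp: S_def)
        have "G = attach B H (insert t S)" using d vB by (simp add: decomp_def)
        also have "\<dots> = attach B H S" using st(2,4) by (intro attach_K1[symmetric])
        also have "\<dots> = attach B (restrict H S) S" by (rule attach_cong) simp
        finally have G: "G = attach B (restrict H S) S" .
        have tH: "t \<notin> verts (H u)" if "u \<in> S" for u
          using decompD(4)[OF d, of t u t] that st(2,4) tS vB by auto
        have "restrict H S \<in> forests S U"
          unfolding forests_def
        proof (intro CollectI conjI ballI)
          fix v assume v: "v \<in> S"
          then have vB': "v \<in> verts B" by (simp add: S_def)
          show "restrict H S v \<in> conn_class \<G>" using decompD(2)[OF d vB'] v by simp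
          have "verts (H v) \<inter> S \<subseteq> verts (H v) \<inter> verts B" "v \<in> verts (H v) \<inter> S"
            using v decompD(7)[OF d vB'] by (auto simp: S_def)
          then show "verts (restrict H S v) \<inter> S = {v}" using decompD(3)[OF d vB'] v by auto
        next
          show "disjoint_family_on (\<lambda>v. verts (restrict H S v)) S"
            using d by (auto simp: decomp_def disjoint_family_on_def S_def)
          have "verts G = insert t (\<Union>v\<in>S. verts (H v))"
            using decompD(5)[OF d] st(4) vB by auto
          then have "(\<Union>v\<in>S. verts (H v)) = U" using vG t tH by (metis Diff_insert_absorb UN_iff)
          then show "(\<Union>v\<in>S. verts (restrict H S v)) = U" by simp
        qed simp
        moreover have "S \<subseteq> U" using d vG by (auto simp: decomp_def S_def)
        moreover have "B \<in> blocks_on (insert t S)" using decompD(1)[OF d] vB by (simp add: blocks_on_def)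
        moreover have "s \<in> S" using st(1,3) by (simp add: S_def)
        ultimately have "(S, B, s, restrict H S) \<in> ?A" by simp
        moreover have "z = ?g (S, B, s, restrict H S)" using z G by simp
        ultimately show "z \<in> ?g ` ?A" by blast
      qed
    qed
  qed
qed

definition nlinks :: "nat \<Rightarrow> nat" where "nlinks m = card (links_on {1..m} 0)"

definition L :: "real fps" where "L = Abs_fps (\<lambda>m. real (nlinks m) / fact m)"

abbreviation B' :: "real fps" where "B' \<equiv> fps_deriv (egf (block_class \<G>))"

text \<open>There are \<open>k\<close> choices for the source among the \<open>k\<close> vertices of the block other than the sink, hence the factor \<open>k\<close>, which turns
  \<open>B'\<close> into \<open>X B''\<close>.\<close>

lemma card_links_on:
  assumes U: "finite U" and t: "t \<notin> U"
  shows "real (card (links_on U t))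
    = (\<Sum>k\<le>card U. fact (card U) * (real k * fps_nth B' k * fps_nth (T ^ k) (card U)))"
proof -
  define m where "m = card U"
  define h where "h = (\<lambda>k. real (nblocks (Suc k)) * (real k * (fact (m - k) * fps_nth (T ^ k) m)))"
  have "real (card (links_on U t)) = real (card (SIGMA S:Pow U. blocks_on (insert t S) \<times> S \<times> forests S U))"
    using bij_betw_same_card[OF bij_betw_link_parts[OF t]] by simp
  also have "\<dots> = (\<Sum>S\<in>Pow U. h (card S))"
  proof (subst card_SigmaI)
    show "finite (Pow U)" using U by simp
    show "\<forall>S\<in>Pow U. finite (blocks_on (insert t S) \<times> S \<times> forests S U)"
      using U finite_subset[of _ U] by (auto intro!: finite_cartesian_product finite_blocks_on finite_forests)
    have "real (card (blocks_on (insert t S) \<times> S \<times> forests S U)) = h (card S)" if S: "S \<in> Pow U" for S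
    proof -
      have fS: "finite S" and tS: "t \<notin> S" using S U t finite_subset by auto
      have "card (blocks_on (insert t S)) = nblocks (Suc (card S))"
        using card_blocks_on[of "insert t S"] fS tS by simp
      then show ?thesis using card_forests[OF U, of S] S by (simp add: card_cartesian_product h_def m_def)
    qed
    then show "real (\<Sum>S\<in>Pow U. card (blocks_on (insert t S) \<times> S \<times> forests S U)) = (\<Sum>S\<in>Pow U. h (card S))"
      by simp
  qed
  also have "\<dots> = (\<Sum>k\<le>m. real (m choose k) * h k)"
    using sum_Pow_card[OF U, of h] by (simp add: m_def)
  also have "\<dots> = (\<Sum>k\<le>m. fact m * (real k * fps_nth B' k * fps_nth (T ^ k) m))"
  proof (rule sum.cong)
    fix k assume "k \<in> {..m}"
    then have "real (m choose k) = fact m / (fact k * fact (m - k))" by (simp add: binomial_fact)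
    moreover have "fps_nth B' k = real (nblocks (Suc k)) / fact k"
      unfolding fps_deriv_nth Suc_eq_plus1[symmetric] block_egf_nth fact_Suc
      by (simp add: divide_simps del: of_nat_Suc)
    ultimately show "real (m choose k) * h k = fact m * (real k * fps_nth B' k * fps_nth (T ^ k) m)"
      by (simp add: h_def)
  qed simp
  finally show ?thesis by (simp add: m_def)
qed

lemma L_eq: "L = T * fps_compose (fps_deriv B') T"
proof -
  have "L = fps_compose (fps_X * fps_deriv B') T"
  proof (rule fps_ext)
    fix m
    have "fps_nth L m = (\<Sum>k\<le>m. real k * fps_nth B' k * fps_nth (T ^ k) m)"
      using card_links_on[of "{1..m}" 0]
      by (simp add: L_def nlinks_def sum_distrib_left[symmetric])
    moreover have "fps_nth (fps_X * fps_deriv B') k = real k * fps_nth B' k" for k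
      by (cases k) simp_all
    ultimately show "fps_nth L m = fps_nth (fps_compose (fps_X * fps_deriv B') T) m"
      unfolding fps_compose_nth atLeast0AtMost by simp
  qed
  then show ?thesis by (simp add: fps_compose_mult_distrib T_0)
qed

end

context stable_class
begin

section \<open>The functional equation of rooted connected graphs\<close>

text \<open>The decomposition at the first link as an identity of sums with arbitrary weights: constant weights count, and weights that depend on a
  ball carry the convergence argument.\<close>

lemma sum_birooted_glue:
  fixes w :: "nat graph \<Rightarrow> nat \<Rightarrow> nat \<Rightarrow> real"
  assumes V: "finite V"
  shows "(\<Sum>(G, x, v) \<in> {(G, x, v) \<in> birooted V. x \<noteq> v}. w G x v)
    = (\<Sum>U\<in>Pow V. \<Sum>(G2, t, v)\<in>birooted (V - U). \<Sum>(G1, s)\<in>links_on U t. w (gunion G1 G2) s v)"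
proof -
  have finU: "finite U" if "U \<in> Pow V" for U using V that finite_subset by auto
  have "(\<Sum>(G, x, v) \<in> {(G, x, v) \<in> birooted V. x \<noteq> v}. w G x v)
    = (\<Sum>p\<in>(SIGMA U:Pow V. SIGMA y:birooted (V - U). links_on U (fst (snd y))).
        (\<lambda>(G, x, v). w G x v) ((\<lambda>(U, (G2, t, v), (G1, s)). (gunion G1 G2, s, v)) p))"
    by (rule sum.reindex_bij_betw[OF bij_betw_glue[OF V], symmetric])
  also have "\<dots> = (\<Sum>(U, q)\<in>(SIGMA U:Pow V. SIGMA y:birooted (V - U). links_on U (fst (snd y))).
        (\<lambda>((G2, t, v), (G1, s)). w (gunion G1 G2) s v) q)"
    by (intro sum.cong) auto
  also have "\<dots> = (\<Sum>U\<in>Pow V. \<Sum>q\<in>(SIGMA y:birooted (V - U). links_on U (fst (snd y))).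
        (\<lambda>((G2, t, v), (G1, s)). w (gunion G1 G2) s v) q)"
    using V finU by (intro sum.Sigma[symmetric])
      (auto intro!: finite_SigmaI finite_birooted finite_links_on)
  also have "\<dots> = (\<Sum>U\<in>Pow V. \<Sum>(G2, t, v)\<in>birooted (V - U). \<Sum>(G1, s)\<in>links_on U t. w (gunion G1 G2) s v)"
  proof (rule sum.cong)
    fix U assume U: "U \<in> Pow V"
    have "(\<Sum>q\<in>(SIGMA y:birooted (V - U). links_on U (fst (snd y))).
          (\<lambda>((G2, t, v), (G1, s)). w (gunion G1 G2) s v) q)
        = (\<Sum>(y, z)\<in>(SIGMA y:birooted (V - U). links_on U (fst (snd y))).
          (\<lambda>(G1, s). w (gunion G1 (fst y)) s (snd (snd y))) z)"
      by (intro sum.cong) auto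
    also have "\<dots> = (\<Sum>y\<in>birooted (V - U). \<Sum>z\<in>links_on U (fst (snd y)).
          (\<lambda>(G1, s). w (gunion G1 (fst y)) s (snd (snd y))) z)"
      using V finU[OF U] by (intro sum.Sigma[symmetric]) (auto intro!: finite_birooted finite_links_on)
    also have "\<dots> = (\<Sum>(G2, t, v)\<in>birooted (V - U). \<Sum>(G1, s)\<in>links_on U t. w (gunion G1 G2) s v)"
      by (intro sum.cong) auto
    finally show "(\<Sum>q\<in>(SIGMA y:birooted (V - U). links_on U (fst (snd y))).
          (\<lambda>((G2, t, v), (G1, s)). w (gunion G1 G2) s v) q)
        = (\<Sum>(G2, t, v)\<in>birooted (V - U). \<Sum>(G1, s)\<in>links_on U t. w (gunion G1 G2) s v)" .
  qed simp
  finally show ?thesis .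
qed

lemma birooted_eq: "birooted V = conn_on V \<times> V \<times> V"
  by (auto simp: birooted_def conn_on_def)

lemma card_birooted:
  assumes "finite V"
  shows "real (card (birooted V)) = fact (card V) * (real (card V) * fps_nth T (card V))"
  using card_conn_on[OF assms] by (simp add: birooted_eq card_cartesian_product T_nth)

lemma card_links_on_eq:
  assumes "finite U" "t \<notin> U"
  shows "real (card (links_on U t)) = fact (card U) * fps_nth L (card U)"
  using card_links_on[OF assms] card_links_on[of "{1..card U}" 0]
  by (simp add: L_def nlinks_def)

lemma pointed_equation: "fps_X * fps_deriv T = T + L * (fps_X * fps_deriv T)"
proof (rule fps_ext)
  fix n :: nat
  let ?A = "fps_X * fps_deriv T"
  have A: "fps_nth ?A k = real k * fps_nth T k" for k by (cases k) simp_all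
  define V where "V = {1..n}"
  have V: "finite V" "card V = n" by (simp_all add: V_def)
  let ?N = "{(G, x, v) \<in> birooted V. x \<noteq> v}" and ?D = "{(G, x, v) \<in> birooted V. x = v}"
  have "birooted V = ?D \<union> ?N" by auto
  then have "card (birooted V) = card ?D + card ?N"
    using finite_birooted[OF V(1)] by (subst card_Un_disjoint[symmetric]) (auto intro: finite_subset)
  moreover have "card ?D = nconn n * n"
  proof -
    have "?D = (\<lambda>(G, x). (G, x, x)) ` (conn_on V \<times> V)" by (auto simp: birooted_eq)
    moreover have "inj_on (\<lambda>(G, x). (G, x, x)) (conn_on V \<times> V)" by (auto simp: inj_on_def)
    ultimately have "card ?D = card (conn_on V \<times> V)" by (simp add: card_image)
    then show ?thesis using V card_conn_on[OF V(1)] by (simp add: card_cartesian_product)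
  qed
  moreover have "real (card ?N) = (\<Sum>m\<le>n. fact n * (fps_nth L m * fps_nth ?A (n - m)))"
  proof -
    define h where "h = (\<lambda>m. (fact m * fps_nth L m) * (fact (n - m) * fps_nth ?A (n - m)))"
    have "real (card ?N) = (\<Sum>(G, x, v)\<in>?N. 1)" by (simp add: case_prod_beta)
    also have "\<dots> = (\<Sum>U\<in>Pow V. \<Sum>(G2, t, v)\<in>birooted (V - U). \<Sum>(G1, s)\<in>links_on U t. 1)"
      by (rule sum_birooted_glue[OF V(1)])
    also have "\<dots> = (\<Sum>U\<in>Pow V. h (card U))"
    proof (rule sum.cong)
      fix U assume "U \<in> Pow V"
      then have U': "finite U" "U \<subseteq> V" using V(1) finite_subset[of U V] by auto
      then have U: "finite U" "finite (V - U)" "card (V - U) = n - card U"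
        using V by (auto simp: card_Diff_subset)
      have "(\<Sum>(G2, t, v)\<in>birooted (V - U). \<Sum>(G1, s)\<in>links_on U t. 1)
          = (\<Sum>(G2, t, v)\<in>birooted (V - U). fact (card U) * fps_nth L (card U))"
        using card_links_on_eq[OF U(1)]
        by (intro sum.cong) (auto simp: birooted_def case_prod_beta)
      also have "\<dots> = h (card U)"
        unfolding h_def A using card_birooted[OF U(2)] U(3) by (simp add: case_prod_beta)
      finally show "(\<Sum>(G2, t, v)\<in>birooted (V - U). \<Sum>(G1, s)\<in>links_on U t. 1) = h (card U)" .
    qed simp
    also have "\<dots> = (\<Sum>m\<le>n. real (n choose m) * h m)" using sum_Pow_card[OF V(1), of h] V(2) by simp
    also have "\<dots> = (\<Sum>m\<le>n. fact n * (fps_nth L m * fps_nth ?A (n - m)))"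
    proof (rule sum.cong)
      fix m assume "m \<in> {..n}"
      then have "real (n choose m) = fact n / (fact m * fact (n - m))" by (simp add: binomial_fact)
      then show "real (n choose m) * h m = fact n * (fps_nth L m * fps_nth ?A (n - m))"
        by (simp add: h_def)
    qed simp
    finally show ?thesis .
  qed
  moreover have "real (card (birooted V)) = fact n * fps_nth ?A n"
    unfolding A using card_birooted[OF V(1)] V(2) by simp
  moreover have "real (nconn n * n) = fact n * fps_nth T n" by (simp add: T_nth)
  ultimately have "fact n * fps_nth ?A n = fact n * fps_nth T n + fact n * fps_nth (L * ?A) n"
    by (simp only: fps_mult_nth[of L] atLeast0AtMost sum_distrib_left of_nat_add)
  then have "fact n * fps_nth ?A n = fact n * (fps_nth T n + fps_nth (L * ?A) n)"
    by (simp only: distrib_left)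
  then show "fps_nth ?A n = fps_nth (T + L * ?A) n" by simp
qed

lemma nconn_1: "nconn 1 = 1"
proof -
  have "conn_on {1} = {K1 1}"
  proof
    show "{K1 1} \<subseteq> conn_on {1}" by (simp add: conn_on_def K1_in_conn_class)
    show "conn_on {1} \<subseteq> {K1 1}"
    proof
      fix G assume "G \<in> conn_on {1}"
      then have G: "sgraph G" "verts G = {1}" using conn_classD(3) by (auto simp: conn_on_def)
      have "edges G = {}"
      proof (rule ccontr)
        assume "edges G \<noteq> {}"
        then obtain e where e: "e \<in> edges G" by blast
        obtain a b where "e = {a, b}" "a \<noteq> b" "a \<in> verts G" "b \<in> verts G"
          by (rule sgraph_edge_obtain[OF G(1) e])
        then show False using G(2) by simp
      qed
      then show "G \<in> {K1 1}" using G by (simp add: graph_eq_iff)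
    qed
  qed
  then show ?thesis by (simp add: nconn_def)
qed

lemma nblocks_1: "nblocks 1 = 0"
proof -
  have "blocks_on {1} = {}"
    using two_connected_ne(3) block_classD(2) by (fastforce simp: blocks_on_def)
  then show ?thesis by (simp add: nblocks_def)
qed

lemma nblocks_2: "0 < nblocks 2"
proof -
  have "Graph {1, 2} {{1, 2}} \<in> \<G>"
    using block_stable_def[THEN iffD1, THEN conjunct2, THEN conjunct1, OF stable] .
  moreover have "{1..2} = {1, 2 :: nat}" by auto
  ultimately have "Graph {1, 2} {{1, 2}} \<in> blocks_on {1..2}"
    using edge_two_connected[of 1 "2 :: nat"] by (simp add: blocks_on_def block_class_def)
  then show ?thesis unfolding nblocks_def using finite_blocks_on[of "{1..2}"] by (auto simp: card_gt_0_iff)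
qed

lemma B'_nth: "fps_nth B' k = real (nblocks (Suc k)) / fact k"
  unfolding fps_deriv_nth Suc_eq_plus1[symmetric] block_egf_nth fact_Suc
  by (simp add: divide_simps del: of_nat_Suc)

definition \<phi> :: "real fps" where "\<phi> = fps_compose (fps_exp 1) B'"

text \<open>The equation for links and doubly rooted graphs says that \<open>T / z\<close> and \<open>exp (B'(T))\<close> have the same logarithmic
  derivative.\<close>

lemma T_equation: "T = fps_X * fps_compose \<phi> T"
proof -
  define Q where "Q = fps_shift 1 T"
  define P where "P = fps_compose B' T"
  define \<psi> where "\<psi> = fps_compose (fps_exp 1) P"
  define R where "R = fps_deriv P"
  have B0: "fps_nth B' 0 = 0" using nblocks_1 unfolding B'_nth by simp
  have TQ: "T = fps_X * Q"
  proof (rule fps_ext)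
    fix n show "fps_nth T n = fps_nth (fps_X * Q) n" by (cases n) (simp_all add: Q_def T_0)
  qed
  have R: "R = fps_compose (fps_deriv B') T * fps_deriv T"
    unfolding R_def P_def by (rule fps_compose_deriv[OF T_0])
  have "fps_X * fps_deriv T = T + T * (fps_X * R)"
    using pointed_equation unfolding L_eq R by (simp only: mult_ac)
  moreover have "fps_deriv T = Q + fps_X * fps_deriv Q"
    unfolding TQ by simp
  ultimately have "fps_X * (Q + fps_X * fps_deriv Q) = fps_X * Q + fps_X * Q * (fps_X * R)"
    using TQ by (simp add: add.commute)
  then have "(fps_X * fps_X) * fps_deriv Q = (fps_X * fps_X) * (Q * R)"
    by (simp add: algebra_simps)
  then have dQ: "fps_deriv Q = Q * R" by simp
  have P0: "fps_nth P 0 = 0" using B0 by (simp add: P_def)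
  have d\<psi>: "fps_deriv \<psi> = \<psi> * R"
    unfolding \<psi>_def R_def by (subst fps_compose_deriv[OF P0]) simp
  have Q0: "fps_nth Q 0 = 1"
    using T_nth_Suc[of 0] nconn_1 by (simp add: Q_def)
  have \<psi>0: "fps_nth \<psi> 0 = 1" by (simp add: \<psi>_def)
  have "fps_nth Q n = fps_nth \<psi> n" for n
  proof (induction n rule: less_induct)
    case (less n)
    show ?case
    proof (cases n)
      case 0
      then show ?thesis using Q0 \<psi>0 by simp
    next
      case (Suc m)
      have "fps_nth (fps_deriv Q) m = fps_nth (fps_deriv \<psi>) m"
        unfolding dQ d\<psi> fps_mult_nth using less Suc by (intro sum.cong) auto
      then show ?thesis using Suc by (simp del: of_nat_Suc of_nat_add)
    qed
  qed
  then have "Q = \<psi>" by (rule fps_ext)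
  moreover have "\<psi> = fps_compose \<phi> T"
    unfolding \<psi>_def P_def \<phi>_def by (rule fps_compose_assoc[OF T_0 B0])
  ultimately show ?thesis using TQ by metis
qed

lemma B'_nonneg: "fps_nonneg B'"
  unfolding fps_nonneg_def B'_nth by simp

lemma \<phi>_nonneg: "fps_nonneg \<phi>"
  unfolding \<phi>_def using B'_nonneg by (intro fps_nonneg_compose) (auto simp: fps_nonneg_def)

lemma T_nonneg: "fps_nonneg T"
  by (simp add: fps_nonneg_def T_nth)

lemma \<phi>_coeffs: "fps_nth \<phi> 0 = 1" "1 \<le> fps_nth \<phi> 1" "0 < fps_nth \<phi> 2"
proof -
  have B1: "1 \<le> fps_nth B' 1" using nblocks_2 unfolding B'_nth by (simp add: numeral_2_eq_2)
  have e: "fps_nth (fps_exp 1) i * fps_nth (B' ^ i) k \<le> fps_nth \<phi> k" if "i \<le> k" for i k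
    unfolding \<phi>_def fps_compose_nth using that fps_nonneg_power[OF B'_nonneg]
    by (intro member_le_sum) (auto simp: fps_nonneg_def)
  show "fps_nth \<phi> 0 = 1" by (simp add: \<phi>_def)
  show "1 \<le> fps_nth \<phi> 1" using e[of 1 1] B1 by simp
  have "fps_nth f 1 * fps_nth f 1 \<le> fps_nth (f ^ 2) 2" if "fps_nonneg f" for f :: "real fps"
    using that by (simp add: power2_eq_square fps_mult_nth fps_nonneg_def numeral_2_eq_2)
  from this[OF B'_nonneg] mult_mono[OF B1 B1] have "0 < fps_nth (B' ^ 2) 2" using B1 by linarith
  then show "0 < fps_nth \<phi> 2" using e[of 2 2] by (simp add: numeral_2_eq_2)
qed

end

section \<open>Consequences of subcriticality\<close>

locale subcritical_class = stable_class +
  assumes subcritical: "subcritical \<G>"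
begin

definition \<rho> :: real where "\<rho> = real_of_ereal (conn_radius \<G>)"
definition \<tau> :: real where "\<tau> = (\<Sum>n. fps_nth T n * \<rho> ^ n)"

lemma \<phi>_summable:
  assumes "0 \<le> y" "ereal y < block_radius \<G>"
  shows "summable (\<lambda>k. fps_nth \<phi> k * y ^ k)"
proof -
  have "ereal y < fps_conv_radius B'"
    using less_le_trans[OF assms(2)[unfolded block_radius_def] fps_conv_radius_deriv] .
  then have "summable (\<lambda>k. fps_nth B' k * y ^ k)" using assms(1) summable_fps[of y B'] by simp
  then obtain b where b: "(\<lambda>k. fps_nth B' k * y ^ k) sums b" by (auto simp: summable_def)
  have "(\<lambda>k. fps_nth (fps_exp 1) k * b ^ k) sums eval_fps (fps_exp 1) b"
    by (rule sums_eval_fps) simp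
  then have "(\<lambda>k. fps_nth \<phi> k * y ^ k) sums eval_fps (fps_exp 1) b"
    unfolding \<phi>_def using B'_nonneg nblocks_1 b assms(1) B'_nth[of 0]
    by (intro compose_sums[where y = b]) (auto simp: fps_nonneg_def)
  then show ?thesis by (rule sums_summable)
qed

lemma conn_radius_ge:
  assumes "0 < z" "summable (\<lambda>k. fps_nth T k * z ^ k)"
  shows "ereal z \<le> conn_radius \<G>"
proof -
  have "summable (\<lambda>k. fps_nth (egf (conn_class \<G>)) k * z ^ k)"
  proof (rule summable_comparison_test'[of _ 1])
    fix k :: nat assume k: "1 \<le> k"
    have "real (nconn k) / fact k \<le> real k * real (nconn k) / fact k"
      using k mult_right_mono[of 1 "real k" "real (nconn k)"] by (intro divide_right_mono) auto
    then have "real (nconn k) / fact k * z ^ k \<le> real k * real (nconn k) / fact k * z ^ k"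
      using assms(1) by (intro mult_right_mono) auto
    then show "norm (fps_nth (egf (conn_class \<G>)) k * z ^ k) \<le> fps_nth T k * z ^ k"
      using assms(1) by (simp add: conn_egf_nth T_nth abs_mult)
  qed (rule assms(2))
  from conv_radius_geI[OF this] show ?thesis using assms(1) by (simp add: conn_radius_def fps_conv_radius_def)
qed

lemma e2ennreal_less: "e2ennreal a < e2ennreal b \<Longrightarrow> a < b"
  using e2ennreal_mono[of b a] by (meson leD not_le)

text \<open>A positive radius of convergence follows by domination at any point inside the disc of \<open>B\<close>; an infinite one contradicts
  subcriticality, as \<open>T\<close> has a positive coefficient.\<close>

lemma conn_radius_eq: "conn_radius \<G> = ereal \<rho>" "0 < \<rho>"
proof -
  let ?f = "\<lambda>n. ennreal (fps_nth T n) * e2ennreal (conn_radius \<G>) ^ n"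
  have "(0 :: ennreal) \<le> (\<Sum>n. ?f n)" by simp
  also have "\<dots> < e2ennreal (block_radius \<G>)" using subcritical by (simp add: subcritical_def)
  finally have "e2ennreal 0 < e2ennreal (block_radius \<G>)" by (simp add: e2ennreal_neg)
  then have "0 < block_radius \<G>" by (rule e2ennreal_less)
  then obtain y where y: "0 < ereal y" "ereal y < block_radius \<G>" using ereal_dense2[of 0] by auto
  define s where "s = (\<Sum>k. fps_nth \<phi> k * y ^ k)"
  have sm: "summable (\<lambda>k. fps_nth \<phi> k * y ^ k)" using y by (intro \<phi>_summable) auto
  have "fps_nth \<phi> 0 * y ^ 0 \<le> s"
    unfolding s_def using sum_le_suminf[OF sm, of "{0}"] \<phi>_nonneg y by (simp add: fps_nonneg_def)
  then have s: "1 \<le> s" using \<phi>_coeffs(1) by simp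
  have "summable (\<lambda>k. fps_nth T k * (y / s) ^ k)"
    using s y by (intro tree_series_summable[OF T_equation T_nonneg \<phi>_nonneg _ _ sm])
      (auto simp: s_def[symmetric])
  then have pos: "0 < conn_radius \<G>"
    using conn_radius_ge[of "y / s"] s y by (auto intro: less_le_trans[of 0 "ereal (y / s)"])
  have "?f 1 < e2ennreal (block_radius \<G>)"
    using subcritical unfolding subcritical_def by (rule ennreal_suminf_lessD)
  moreover have "fps_nth T 1 = 1" using T_nth_Suc[of 0] nconn_1 by simp
  ultimately have "e2ennreal (conn_radius \<G>) \<noteq> top" by auto
  then have "conn_radius \<G> \<noteq> \<infinity>" by auto
  then show "conn_radius \<G> = ereal \<rho>" using pos by (cases "conn_radius \<G>") (auto simp: \<rho>_def)
  then show "0 < \<rho>" using pos by simp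
qed

lemma T_sums: "(\<lambda>n. fps_nth T n * \<rho> ^ n) sums \<tau>" and \<tau>_less: "ereal \<tau> < block_radius \<G>"
proof -
  let ?f = "\<lambda>n. fps_nth T n * \<rho> ^ n"
  have nn: "0 \<le> ?f n" for n using T_nonneg conn_radius_eq(2) by (simp add: fps_nonneg_def)
  have "(\<lambda>n. ennreal (fps_nth T n) * e2ennreal (conn_radius \<G>) ^ n) = (\<lambda>n. ennreal (?f n))"
    using conn_radius_eq T_nonneg by (auto simp: fps_nonneg_def ennreal_mult ennreal_power)
  then have l: "(\<Sum>n. ennreal (?f n)) < e2ennreal (block_radius \<G>)"
    using subcritical by (simp add: subcritical_def)
  then have sm: "summable ?f" using nn by (intro summable_suminf_not_top) auto
  then show "?f sums \<tau>" unfolding \<tau>_def by (rule summable_sums)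
  have "(\<Sum>n. ennreal (?f n)) = e2ennreal (ereal \<tau>)"
    unfolding \<tau>_def using suminf_ennreal2[OF nn sm] by simp
  then show "ereal \<tau> < block_radius \<G>" using l e2ennreal_less by simp
qed

lemma T_radius: "\<rho> < z \<Longrightarrow> \<not> summable (\<lambda>k. fps_nth T k * z ^ k)"
  using conn_radius_ge[of z] conn_radius_eq by auto

lemma T_ratio: "(\<lambda>n. fps_nth T n / fps_nth T (Suc n)) \<longlonglongrightarrow> \<rho>"
  by (rule tree_series_ratio[OF T_equation \<phi>_nonneg \<phi>_coeffs conn_radius_eq(2) sums_summable[OF T_sums] T_radius])

text \<open>The derivative of \<open>\<phi> = exp B'\<close> is \<open>\<phi> B''\<close>, so the characteristic equation reads \<open>\<tau> B''(\<tau>) = 1\<close>, and the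
  left-hand side is the generating function of links at \<open>\<rho>\<close>.\<close>

lemma L_sums: "(\<lambda>m. fps_nth L m * \<rho> ^ m) sums 1"
proof -
  have \<tau>0: "0 \<le> \<tau>"
    unfolding \<tau>_def using T_nonneg conn_radius_eq(2)
    by (intro suminf_nonneg sums_summable[OF T_sums]) (simp add: fps_nonneg_def)
  obtain y where y: "ereal \<tau> < ereal y" "ereal y < block_radius \<G>" using ereal_dense2[OF \<tau>_less] by auto
  have "ereal (norm y) \<le> conv_radius (fps_nth \<phi>)"
    using y \<tau>0 by (intro conv_radius_geI \<phi>_summable) auto
  then have r\<phi>: "ereal \<tau> < fps_conv_radius \<phi>"
    using less_le_trans[of "ereal \<tau>" "ereal y"] y \<tau>0 by (simp add: fps_conv_radius_def)
  have rB: "ereal \<tau> < fps_conv_radius B'"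
    using less_le_trans[OF \<tau>_less[unfolded block_radius_def] fps_conv_radius_deriv] .
  have rB2: "ereal \<tau> < fps_conv_radius (fps_deriv B')"
    using less_le_trans[OF rB fps_conv_radius_deriv] .
  have "\<tau> * eval_fps (fps_deriv \<phi>) \<tau> = eval_fps \<phi> \<tau>"
    using \<phi>_coeffs(1)
    by (intro tree_series_characteristic_equation[OF T_equation T_nonneg \<phi>_nonneg _ conn_radius_eq(2) T_sums T_radius r\<phi>]) auto
  moreover have "fps_deriv \<phi> = \<phi> * fps_deriv B'"
  proof -
    have "fps_nth B' 0 = 0" using nblocks_1 unfolding B'_nth by simp
    then show ?thesis unfolding \<phi>_def by (subst fps_compose_deriv) simp_all
  qed
  ultimately have "\<tau> * (eval_fps \<phi> \<tau> * eval_fps (fps_deriv B') \<tau>) = eval_fps \<phi> \<tau>"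
    using eval_fps_mult[of \<tau> \<phi> "fps_deriv B'"] r\<phi> rB2 \<tau>0 by simp
  moreover have "eval_fps \<phi> \<tau> \<noteq> 0"
  proof -
    have sm: "summable (\<lambda>k. fps_nth \<phi> k * \<tau> ^ k)" using \<tau>0 \<tau>_less by (rule \<phi>_summable)
    have "fps_nth \<phi> 0 * \<tau> ^ 0 \<le> eval_fps \<phi> \<tau>"
      unfolding eval_fps_def using sum_le_suminf[OF sm, of "{0}"] \<phi>_nonneg \<tau>0 by (simp add: fps_nonneg_def)
    then show ?thesis using \<phi>_coeffs(1) by simp
  qed
  ultimately have char: "\<tau> * eval_fps (fps_deriv B') \<tau> = 1" by (simp add: field_simps)
  have "fps_nonneg (fps_deriv f)" if "fps_nonneg f" for f using that by (simp add: fps_nonneg_def)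
  then have dB: "fps_nonneg (fps_deriv B')" using B'_nonneg .
  let ?C = "fps_compose (fps_deriv B') T"
  have C: "(\<lambda>k. fps_nth ?C k * \<rho> ^ k) sums eval_fps (fps_deriv B') \<tau>"
  proof (rule compose_sums[OF dB T_nonneg T_0 less_imp_le[OF conn_radius_eq(2)] T_sums])
    show "(\<lambda>k. fps_nth (fps_deriv B') k * \<tau> ^ k) sums eval_fps (fps_deriv B') \<tau>"
      using rB2 \<tau>0 by (intro sums_eval_fps) simp
  qed
  have Cn: "fps_nonneg ?C" by (rule fps_nonneg_compose[OF dB T_nonneg])
  have "(\<lambda>k. \<Sum>i\<le>k. fps_nth T i * \<rho> ^ i * (fps_nth ?C (k - i) * \<rho> ^ (k - i)))
      sums ((\<Sum>k. fps_nth T k * \<rho> ^ k) * (\<Sum>k. fps_nth ?C k * \<rho> ^ k))"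
    using T_sums C T_nonneg Cn conn_radius_eq(2)
    by (intro Cauchy_product_sums) (auto simp: sums_iff fps_nonneg_def)
  then have "(\<lambda>k. fps_nth (T * ?C) k * \<rho> ^ k) sums (\<tau> * eval_fps (fps_deriv B') \<tau>)"
    unfolding mult_nth_times_power using T_sums C by (simp add: sums_iff)
  then show ?thesis using char by (simp add: L_eq)
qed

end

section \<open>Isomorphism classes of balls\<close>

lemma rooted_class_eq: "rooted_class (G, x) = {(gmap f G, f x) |f. inj_on f (verts G)}"
  by (auto simp: rooted_class_def graph_iso_iff)

lemma rooted_class_gmap:
  assumes G: "sgraph G" "inj_on f (verts G)" "x \<in> verts G"
  shows "rooted_class (gmap f G, f x) = rooted_class (G, x)"
proof
  show "rooted_class (gmap f G, f x) \<subseteq> rooted_class (G, x)"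
  proof
    fix z assume "z \<in> rooted_class (gmap f G, f x)"
    then obtain g where g: "inj_on g (f ` verts G)" "z = (gmap g (gmap f G), g (f x))"
      unfolding rooted_class_eq by auto
    have "z = (gmap (g \<circ> f) G, (g \<circ> f) x)" using g(2) by (simp add: gmap_comp)
    moreover have "inj_on (g \<circ> f) (verts G)" using G(2) g(1) by (rule comp_inj_on)
    ultimately show "z \<in> rooted_class (G, x)" unfolding rooted_class_eq by blast
  qed
  show "rooted_class (G, x) \<subseteq> rooted_class (gmap f G, f x)"
  proof
    fix z assume "z \<in> rooted_class (G, x)"
    then obtain g where g: "inj_on g (verts G)" "z = (gmap g G, g x)"
      unfolding rooted_class_eq by auto
    let ?h = "g \<circ> inv_into (verts G) f"
    have inv: "inv_into (verts G) f (f v) = v" if "v \<in> verts G" for v using G(2) that by simp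
    have "gmap ?h (gmap f G) = gmap g G"
      unfolding gmap_comp using G(1) by (rule gmap_cong) (simp add: inv)
    moreover have "?h (f x) = g x" using inv[OF G(3)] by simp
    moreover have "inj_on ?h (verts (gmap f G))"
    proof (rule inj_onI)
      fix a b assume ab: "a \<in> verts (gmap f G)" "b \<in> verts (gmap f G)" "?h a = ?h b"
      then obtain u v where uv: "a = f u" "b = f v" "u \<in> verts G" "v \<in> verts G" by auto
      then have "g u = g v" using ab(3) inv by simp
      then have "u = v" using inj_onD[OF g(1) _ uv(3,4)] by blast
      then show "a = b" using uv(1,2) by simp
    qed
    ultimately show "z \<in> rooted_class (gmap f G, f x)"       unfolding rooted_class_eq g(2) by (intro CollectI exI[of _ ?h]) simp
  qed
qed

text \<open>Countability lets both graphs be compared through copies with vertices in \<^typ>\<open>nat\<close>.\<close>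

lemma rooted_class_eqD:
  fixes G :: "'v :: countable graph" and G' :: "'w :: countable graph"
  assumes eq: "rooted_class (G, x) = rooted_class (G', x')" and G': "sgraph G'" "x' \<in> verts G'"
  obtains f where "inj_on f (verts G)" "gmap f G = G'" "f x = x'"
proof -
  have "(gmap to_nat G, to_nat x) \<in> rooted_class (G, x)"
    unfolding rooted_class_eq by (blast intro: inj_on_subset[OF inj_to_nat])
  then obtain j where j: "inj_on j (verts G')" "gmap to_nat G = gmap j G'" "to_nat x = j x'"
    unfolding eq unfolding rooted_class_eq by auto
  let ?f = "inv_into (verts G') j \<circ> to_nat"
  have "gmap ?f G = gmap (inv_into (verts G') j) (gmap j G')"
    unfolding gmap_comp[symmetric] j(2) ..
  also have "\<dots> = G'" by (rule gmap_inv[OF G'(1) j(1)])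
  finally have "gmap ?f G = G'" .
  moreover have "?f x = x'" using j(1,3) G'(2) by simp
  moreover have "inj_on ?f (verts G)"
  proof (rule comp_inj_on)
    have "to_nat ` verts G = j ` verts G'" using j(2) by (metis gmap_simps(1))
    then show "inj_on (inv_into (verts G') j) (to_nat ` verts G)"
      by (simp add: inj_on_inv_into)
  qed (rule inj_on_subset[OF inj_to_nat], simp)
  ultimately show ?thesis using that by blast
qed

definition ballset :: "nat \<Rightarrow> 'v graph \<Rightarrow> 'v \<Rightarrow> 'v set" where
  "ballset r G x = {v. \<exists>k\<le>r. (x, v) \<in> adj G ^^ k}"

lemma rball_eq: "rball r (G, x) = (induced G (ballset r G x), x)"
  by (simp add: rball_def ballset_def)

lemma ballset_center: "x \<in> ballset r G x"
  by (auto simp: ballset_def intro: exI[of _ 0])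

lemma relpow_in_verts:
  assumes "sgraph G" "x \<in> verts G" "(x, v) \<in> adj G ^^ k"
  shows "v \<in> verts G"
  using assms(2,3)
proof (induction k arbitrary: v)
  case (Suc k)
  then obtain u where "(u, v) \<in> adj G" by auto
  then show ?case using sgraph_edge(2)[OF assms(1)] by (simp add: adj_iff)
qed simp

lemma ballset_subset: "sgraph G \<Longrightarrow> x \<in> verts G \<Longrightarrow> ballset r G x \<subseteq> verts G"
  using relpow_in_verts by (fastforce simp: ballset_def)

lemma relpow_gmap:
  assumes G: "sgraph G" "inj_on f (verts G)" "x \<in> verts G"
  shows "(f x, w) \<in> adj (gmap f G) ^^ k \<longleftrightarrow> (\<exists>v. w = f v \<and> (x, v) \<in> adj G ^^ k)"
proof (induction k arbitrary: w)
  case 0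
  then show ?case by auto
next
  case (Suc k)
  show ?case
  proof
    assume "(f x, w) \<in> adj (gmap f G) ^^ Suc k"
    then obtain w' where w': "(f x, w') \<in> adj (gmap f G) ^^ k" "(w', w) \<in> adj (gmap f G)" by auto
    then obtain u where u: "w' = f u" "(x, u) \<in> adj G ^^ k" using Suc by blast
    have uG: "u \<in> verts G" by (rule relpow_in_verts[OF G(1,3) u(2)])
    have "{f u, w} \<in> (`) f ` edges G" using w'(2) u(1) by (simp add: adj_iff)
    then obtain e where e: "e \<in> edges G" "{f u, w} = f ` e" by blast
    obtain a b where ab: "e = {a, b}" "a \<noteq> b" "a \<in> verts G" "b \<in> verts G"
      by (rule sgraph_edge_obtain[OF G(1) e(1)])
    have "{f u, w} = {f a, f b}" using e(2) ab(1) by simp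
    then consider "f u = f a" "w = f b" | "f u = f b" "w = f a" by (auto simp: doubleton_eq_iff)
    then obtain v where v: "{u, v} \<in> edges G" "w = f v"
    proof cases
      case 1
      then have "u = a" using inj_onD[OF G(2)] uG ab by blast
      then show ?thesis using that[of b] e(1) ab(1) 1 by simp
    next
      case 2
      then have "u = b" using inj_onD[OF G(2)] uG ab by blast
      then show ?thesis using that[of a] e(1) ab(1) 2 by (simp add: insert_commute)
    qed
    then have "(x, v) \<in> adj G ^^ Suc k" using u(2) by (auto simp: adj_iff)
    then show "\<exists>v. w = f v \<and> (x, v) \<in> adj G ^^ Suc k" using v(2) by blast
  next
    assume "\<exists>v. w = f v \<and> (x, v) \<in> adj G ^^ Suc k"
    then obtain u v where uv: "w = f v" "(x, u) \<in> adj G ^^ k" "(u, v) \<in> adj G" by auto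
    then have "(f u, f v) \<in> adj (gmap f G)" using gmap_edge[of u v G f] by (simp add: adj_iff)
    then show "(f x, w) \<in> adj (gmap f G) ^^ Suc k" using Suc[of "f u"] uv by auto
  qed
qed

lemma ballset_gmap:
  "sgraph G \<Longrightarrow> inj_on f (verts G) \<Longrightarrow> x \<in> verts G \<Longrightarrow> ballset r (gmap f G) (f x) = f ` ballset r G x"
  unfolding ballset_def by (auto simp: relpow_gmap)

lemma sgraph_induced: "sgraph G \<Longrightarrow> sgraph (induced G S)"
  by (auto simp: sgraph_def)

lemma ball_class_gmap:
  assumes G: "sgraph G" "inj_on f (verts G)" "x \<in> verts G"
  shows "ball_class r (gmap f G, f x) = ball_class r (G, x)"
proof -
  let ?K = "induced G (ballset r G x)"
  have "induced (gmap f G) (f ` ballset r G x) = gmap f ?K"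
    using gmap_induced[OF G(1,2) ballset_subset[OF G(1,3)]] .
  then have "ball_class r (gmap f G, f x) = rooted_class (gmap f ?K, f x)"
    by (simp add: ball_class_def rball_eq ballset_gmap[OF G])
  also have "\<dots> = rooted_class (?K, x)"
    using inj_on_subset[OF G(2)] ballset_center G by (intro rooted_class_gmap sgraph_induced) auto
  finally show ?thesis by (simp add: ball_class_def rball_eq)
qed

section \<open>Balls in a glued graph\<close>

lemma ballset_induced:
  assumes S: "ballset r G x \<subseteq> S"
  shows "ballset r (induced G S) x = ballset r G x"
proof
  have "adj (induced G S) \<subseteq> adj G" by (auto simp: adj_def)
  then have "adj (induced G S) ^^ k \<subseteq> adj G ^^ k" for k
    by (induction k) (auto intro: relcomp_mono)
  then show "ballset r (induced G S) x \<subseteq> ballset r G x" by (auto simp: ballset_def)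
  have "(x, v) \<in> adj G ^^ k \<Longrightarrow> k \<le> r \<Longrightarrow> (x, v) \<in> adj (induced G S) ^^ k" for k v
  proof (induction k arbitrary: v)
    case (Suc k)
    then obtain u where u: "(x, u) \<in> adj G ^^ k" "(u, v) \<in> adj G" by auto
    have "u \<in> ballset r G x" using u(1) Suc.prems(2) by (auto simp: ballset_def intro!: exI[of _ k])
    moreover have "v \<in> ballset r G x" using Suc.prems by (auto simp: ballset_def intro!: exI[of _ "Suc k"])
    ultimately have "(u, v) \<in> adj (induced G S)" using u(2) S by (auto simp: adj_iff)
    then show ?case using Suc.IH[OF u(1)] Suc.prems(2) by auto
  qed simp
  then show "ballset r G x \<subseteq> ballset r (induced G S) x" by (auto simp: ballset_def)
qed

lemma rball_induced:
  assumes S: "ballset r G x \<subseteq> S"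
  shows "rball r (induced G S, x) = rball r (G, x)"
  unfolding rball_eq ballset_induced[OF S] using S by (auto simp: graph_eq_iff)

lemma ballset_gunion:
  assumes G: "sgraph G1" "sgraph G2" "verts G1 \<inter> verts G2 = {t}" and x: "x \<in> verts G1" "x \<noteq> t"
  shows "ballset (Suc r) (gunion G1 G2) x \<subseteq> verts G1 \<union> ballset r G2 t"
proof -
  have inv: "(x, v) \<in> adj (gunion G1 G2) ^^ k \<Longrightarrow>
      v \<in> verts G1 \<or> (0 < k \<and> (\<exists>l\<le>k - 1. (t, v) \<in> adj G2 ^^ l))" for k v
  proof (induction k arbitrary: v)
    case 0
    then show ?case using x by simp
  next
    case (Suc k)
    then obtain u where u: "(x, u) \<in> adj (gunion G1 G2) ^^ k" "(u, v) \<in> adj (gunion G1 G2)" by auto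
    show ?case
    proof (cases "v \<in> verts G1")
      case False
      then have uv: "{u, v} \<in> edges G2"
        using u(2) sgraph_edge(2)[OF G(1), of u v] by (auto simp: adj_iff)
      have k: "0 < k"
      proof (rule ccontr)
        assume "\<not> 0 < k"
        then have "u = x" using u(1) by simp
        then have "x \<in> verts G1 \<inter> verts G2" using x sgraph_edge(1)[OF G(2) uv] by simp
        then show False unfolding G(3) using x(2) by simp
      qed
      from Suc.IH[OF u(1)] show ?thesis
      proof
        assume "u \<in> verts G1"
        then have "u \<in> verts G1 \<inter> verts G2" using sgraph_edge(1)[OF G(2) uv] by simp
        then have "u = t" unfolding G(3) by simp
        then have "(t, v) \<in> adj G2 ^^ 1" using uv by (simp add: adj_iff)
        then show ?thesis using k by (intro disjI2 conjI exI[of _ 1]) auto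
      next
        assume "0 < k \<and> (\<exists>l\<le>k - 1. (t, u) \<in> adj G2 ^^ l)"
        then obtain l where l: "l \<le> k - 1" "(t, u) \<in> adj G2 ^^ l" by blast
        have "(t, v) \<in> adj G2 ^^ Suc l" using l(2) uv by (auto simp: adj_iff)
        then show ?thesis using k l(1) by (intro disjI2 conjI exI[of _ "Suc l"]) auto
      qed
    qed simp
  qed
  show ?thesis
  proof
    fix v assume "v \<in> ballset (Suc r) (gunion G1 G2) x"
    then obtain k where k: "k \<le> Suc r" "(x, v) \<in> adj (gunion G1 G2) ^^ k" by (auto simp: ballset_def)
    from inv[OF k(2)] show "v \<in> verts G1 \<union> ballset r G2 t"
    proof
      assume "0 < k \<and> (\<exists>l\<le>k - 1. (t, v) \<in> adj G2 ^^ l)"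
      then obtain l where "l \<le> k - 1" "(t, v) \<in> adj G2 ^^ l" by blast
      then show ?thesis using k(1) by (auto simp: ballset_def intro!: exI[of _ l])
    qed simp
  qed
qed

text \<open>The distance from the source to the sink is at least 1, so beyond the sink only a ball of a smaller radius is visible.\<close>

lemma rball_gunion:
  assumes G: "sgraph G1" "sgraph G2" "verts G1 \<inter> verts G2 = {t}" and x: "x \<in> verts G1" "x \<noteq> t"
  shows "rball (Suc r) (gunion G1 G2, x) = rball (Suc r) (gunion G1 (induced G2 (ballset r G2 t)), x)"
proof -
  let ?S = "verts G1 \<union> ballset r G2 t"
  have t: "t \<in> verts G1" "t \<in> verts G2" using G(3) by auto
  have "gunion G1 (induced G2 (ballset r G2 t)) = induced (gunion G1 G2) ?S"
  proof -
    have "verts G1 \<union> verts G2 \<inter> ballset r G2 t = (verts G1 \<union> verts G2) \<inter> ?S" by blast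
    moreover have "edges G1 \<union> {e \<in> edges G2. e \<subseteq> ballset r G2 t} = {e \<in> edges G1 \<union> edges G2. e \<subseteq> ?S}"
    proof -
      have "e \<subseteq> ballset r G2 t" if e: "e \<in> edges G2" "e \<subseteq> ?S" for e
      proof
        fix v assume v: "v \<in> e"
        show "v \<in> ballset r G2 t"
        proof (cases "v \<in> verts G1")
          case True
          then have "v \<in> verts G1 \<inter> verts G2" using sgraph_subset[OF G(2) e(1)] v by blast
          then show ?thesis unfolding G(3) by (simp add: ballset_center)
        next
          case False
          then show ?thesis using e(2) v by blast
        qed
      qed
      moreover have "e \<subseteq> ?S" if "e \<in> edges G1" for e using sgraph_subset[OF G(1) that] by blast
      ultimately show ?thesis by blast
    qed
    ultimately show ?thesis by (simp add: graph_eq_iff)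
  qed
  then show ?thesis using rball_induced[OF ballset_gunion[OF assms]] by simp
qed

text \<open>An isomorphism of the first parts and one of the balls beyond the shared vertex agree at this vertex, so they combine.\<close>

lemma ball_class_gunion_cong:
  fixes G1 G2 :: "'v :: countable graph" and G1' G2' :: "'w :: countable graph"
  assumes G: "sgraph G1" "sgraph G2" "verts G1 \<inter> verts G2 = {t}" and x: "x \<in> verts G1" "x \<noteq> t"
    and G': "sgraph G2'" "verts G1' \<inter> verts G2' = {t'}"
    and f: "inj_on f (verts G1)" "G1' = gmap f G1" "t' = f t"
    and b: "ball_class r (G2, t) = ball_class r (G2', t')"
  shows "ball_class (Suc r) (gunion G1 G2, x) = ball_class (Suc r) (gunion G1' G2', f x)"
proof -
  have t: "t \<in> verts G1" "t \<in> verts G2" "t' \<in> verts G2'" using G(3) G'(2) by auto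
  let ?K = "induced G2 (ballset r G2 t)" and ?K' = "induced G2' (ballset r G2' t')"
  have sK: "sgraph ?K" "sgraph ?K'" using G(2) G'(1) by (simp_all add: sgraph_induced)
  have tK: "t \<in> verts ?K" "t' \<in> verts ?K'" using t by (simp_all add: ballset_center)
  obtain g where g: "inj_on g (verts ?K)" "gmap g ?K = ?K'" "g t = t'"
    using rooted_class_eqD[of ?K t ?K' t'] b sK(2) tK(2) by (auto simp: ball_class_def rball_eq)
  have int: "verts G1 \<inter> verts ?K = {t}" using G(3) tK(1) t(1) by auto
  have int': "verts G1' \<inter> verts ?K' = {t'}" using G'(2) tK(2) by auto
  define h where "h = (\<lambda>v. if v \<in> verts G1 then f v else g v)"
  have h1: "h v = f v" if "v \<in> verts G1" for v using that by (simp add: h_def)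
  have h2: "h v = g v" if "v \<in> verts ?K" for v
  proof (cases "v \<in> verts G1")
    case True
    then have "v \<in> verts G1 \<inter> verts ?K" using that by (rule IntI)
    then have "v = t" unfolding int by simp
    then show ?thesis using f(3) g(3) t by (simp add: h_def)
  qed (simp add: h_def)
  have "gmap h G1 = G1'" unfolding f(2) using G(1) h1 by (rule gmap_cong)
  moreover have "gmap h ?K = ?K'" unfolding g(2)[symmetric] using sK(1) h2 by (rule gmap_cong)
  ultimately have map: "gmap h (gunion G1 ?K) = gunion G1' ?K'" by (simp add: gmap_gunion)
  have inj: "inj_on h (verts (gunion G1 ?K))"
  proof -
    have mixed: "a = b" if ab: "a \<in> verts G1" "b \<in> verts ?K" "h a = h b" for a b
    proof -
      have "f a \<in> verts G1'" using ab(1) f(2) by simp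
      moreover have "g b \<in> verts ?K'" unfolding g(2)[symmetric] gmap_simps using ab(2) by (rule imageI)
      ultimately have "f a \<in> verts G1' \<inter> verts ?K'" using h1[OF ab(1)] h2[OF ab(2)] ab(3) by simp
      then have e: "f a = f t" "g b = g t" unfolding int' using f(3) g(3) h1[OF ab(1)] h2[OF ab(2)] ab(3) by simp_all
      have "a = t" using inj_onD[OF f(1) e(1) ab(1) t(1)] .
      moreover have "b = t" using inj_onD[OF g(1) e(2) ab(2) tK(1)] .
      ultimately show ?thesis by simp
    qed
    show ?thesis
    proof (rule inj_onI)
      fix a b assume ab: "a \<in> verts (gunion G1 ?K)" "b \<in> verts (gunion G1 ?K)" "h a = h b"
      consider "a \<in> verts G1" "b \<in> verts G1" | "a \<in> verts G1" "b \<in> verts ?K"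
        | "a \<in> verts ?K" "b \<in> verts G1" | "a \<in> verts ?K" "b \<in> verts ?K"
        using ab(1,2) unfolding gunion_simps by blast
      then show "a = b"
      proof cases
        case 1
        then show ?thesis using inj_onD[OF f(1)] h1 ab(3) by simp
      next
        case 2
        then show ?thesis using mixed ab(3) by blast
      next
        case 3
        then show ?thesis using mixed[of b a] ab(3) by simp
      next
        case 4
        then have "g a = g b" using h2 ab(3) by simp
        then show ?thesis using inj_onD[OF g(1) _ 4] by blast
      qed
    qed
  qed
  have fx: "f x \<in> verts G1'" "f x \<noteq> t'"
    using x f inj_onD[OF f(1) _ x(1) t(1)] by auto
  have "ball_class (Suc r) (gunion G1 G2, x) = ball_class (Suc r) (gunion G1 ?K, x)"
    using rball_gunion[OF G x] by (simp add: ball_class_def)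
  also have "\<dots> = ball_class (Suc r) (gmap h (gunion G1 ?K), h x)"
    using G(1) sK(1) x inj by (intro ball_class_gmap[symmetric] sgraph_gunion) auto
  also have "\<dots> = ball_class (Suc r) (gunion G1' ?K', f x)" unfolding map h1[OF x(1)] ..
  also have "\<dots> = ball_class (Suc r) (gunion G1' G2', f x)"
    using rball_gunion[OF sgraph_gmap[OF G(1) f(1), folded f(2)] G' fx] by (simp add: ball_class_def)
  finally show ?thesis .
qed

text \<open>The class of the ball around the source of a link with a graph glued to its sink depends on both parts only through their
  classes (\<open>glue_ball_eq\<close>), so an arbitrary choice of representatives defines a function of the classes.\<close>

definition glue_ball :: "nat \<Rightarrow> nat ended set \<Rightarrow> (nat graph \<times> nat) set \<Rightarrow> (nat graph \<times> nat) set" where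
  "glue_ball r E \<beta> = (SOME b. \<exists>G1 x t G2. (G1, x, t) \<in> E \<and> sgraph G1 \<and> sgraph G2 \<and>
     verts G1 \<inter> verts G2 = {t} \<and> x \<in> verts G1 \<and> x \<noteq> t \<and> ball_class r (G2, t) = \<beta> \<and>
     b = ball_class (Suc r) (gunion G1 G2, x))"

lemma ended_class_eq: "ended_class (G, s, t) = {(gmap f G, f s, f t) |f. inj_on f (verts G)}"
  by (auto simp: ended_class_def ended_iso_def graph_iso_iff)

lemma ended_class_self: "sgraph G \<Longrightarrow> (G, s, t) \<in> ended_class (G, s, t)"
  unfolding ended_class_eq by (auto intro!: exI[of _ "\<lambda>v. v"] simp: gmap_ident)

lemma glue_ball_eq:
  fixes G1 G2 :: "nat graph"
  assumes G: "sgraph G1" "sgraph G2" "verts G1 \<inter> verts G2 = {t}" and x: "x \<in> verts G1" "x \<noteq> t"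
  shows "glue_ball r (ended_class (G1, x, t)) (ball_class r (G2, t)) = ball_class (Suc r) (gunion G1 G2, x)"
  unfolding glue_ball_def
proof (rule some_equality)
  show "\<exists>H1 y u H2. (H1, y, u) \<in> ended_class (G1, x, t) \<and> sgraph H1 \<and> sgraph H2 \<and>
     verts H1 \<inter> verts H2 = {u} \<and> y \<in> verts H1 \<and> y \<noteq> u \<and> ball_class r (H2, u) = ball_class r (G2, t) \<and>
     ball_class (Suc r) (gunion G1 G2, x) = ball_class (Suc r) (gunion H1 H2, y)"
    using assms ended_class_self[OF G(1), of x t] by blast
next
  fix b assume "\<exists>H1 y u H2. (H1, y, u) \<in> ended_class (G1, x, t) \<and> sgraph H1 \<and> sgraph H2 \<and>
     verts H1 \<inter> verts H2 = {u} \<and> y \<in> verts H1 \<and> y \<noteq> u \<and> ball_class r (H2, u) = ball_class r (G2, t) \<and>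
     b = ball_class (Suc r) (gunion H1 H2, y)"
  then obtain H1 y u H2 where H: "(H1, y, u) \<in> ended_class (G1, x, t)" "sgraph H2"
     "verts H1 \<inter> verts H2 = {u}" "ball_class r (H2, u) = ball_class r (G2, t)"
     "b = ball_class (Suc r) (gunion H1 H2, y)" by blast
  obtain f where f: "inj_on f (verts G1)" "H1 = gmap f G1" "y = f x" "u = f t"
    using H(1) unfolding ended_class_eq by auto
  show "b = ball_class (Suc r) (gunion G1 G2, x)"
    using ball_class_gunion_cong[OF G x H(2,3) f(1,2,4) H(4)[symmetric]] H(5) f(3) by simp
qed

lemma ended_class_gmap:
  fixes G :: "nat graph"
  assumes G: "sgraph G" "s \<in> verts G" "t \<in> verts G" and f: "inj_on f (verts G)"
  shows "ended_class (gmap f G, f s, f t) = ended_class (G, s, t)"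
proof
  show "ended_class (gmap f G, f s, f t) \<subseteq> ended_class (G, s, t)"
  proof
    fix z assume "z \<in> ended_class (gmap f G, f s, f t)"
    then obtain g where g: "inj_on g (f ` verts G)" "z = (gmap g (gmap f G), g (f s), g (f t))"
      unfolding ended_class_eq by auto
    then have "z = (gmap (g \<circ> f) G, (g \<circ> f) s, (g \<circ> f) t)" by (simp add: gmap_comp)
    moreover have "inj_on (g \<circ> f) (verts G)" using f g(1) by (rule comp_inj_on)
    ultimately show "z \<in> ended_class (G, s, t)" unfolding ended_class_eq by blast
  qed
  show "ended_class (G, s, t) \<subseteq> ended_class (gmap f G, f s, f t)"
  proof
    fix z assume "z \<in> ended_class (G, s, t)"
    then obtain g where g: "inj_on g (verts G)" "z = (gmap g G, g s, g t)"
      unfolding ended_class_eq by auto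
    let ?h = "g \<circ> inv_into (verts G) f"
    have inv: "inv_into (verts G) f (f v) = v" if "v \<in> verts G" for v using f that by simp
    have "gmap ?h (gmap f G) = gmap g G"
      unfolding gmap_comp using G(1) by (rule gmap_cong) (simp add: inv)
    moreover have "inj_on ?h (verts (gmap f G))"
    proof (rule inj_onI)
      fix a b assume ab: "a \<in> verts (gmap f G)" "b \<in> verts (gmap f G)" "?h a = ?h b"
      then obtain u v where uv: "a = f u" "b = f v" "u \<in> verts G" "v \<in> verts G" by auto
      then have "g u = g v" using ab(3) inv by simp
      then have "u = v" using inj_onD[OF g(1) _ uv(3,4)] by blast
      then show "a = b" using uv(1,2) by simp
    qed
    ultimately show "z \<in> ended_class (gmap f G, f s, f t)"
      unfolding ended_class_eq g(2) using inv G by (intro CollectI exI[of _ ?h]) simp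
  qed
qed

context stable_class
begin

lemma sum_birooted_relabel:
  assumes V: "finite V"
  shows "(\<Sum>(G, x, v)\<in>birooted V. h (ball_class r (G, x)))
    = (\<Sum>(G, x, v)\<in>birooted {1..card V}. h (ball_class r (G, x)) :: real)"
proof -
  obtain f where f: "bij_betw f V {1..card V}" using bij_betw_standard[OF V] .
  have inj: "inj_on f V" using f by (simp add: bij_betw_def)
  have b: "bij_betw (map_prod (gmap f) (map_prod f f)) (birooted V) (birooted {1..card V})"
    unfolding birooted_eq conn_on_def
    by (intro bij_betw_map_prod gmap_bij f conn_classD(3) conn_class_gmap)
  have "(\<Sum>(G, x, v)\<in>birooted {1..card V}. h (ball_class r (G, x)))
      = (\<Sum>z\<in>birooted V. (\<lambda>(G, x, v). h (ball_class r (G, x))) (map_prod (gmap f) (map_prod f f) z))"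
    by (rule sum.reindex_bij_betw[OF b, symmetric])
  also have "\<dots> = (\<Sum>(G, x, v)\<in>birooted V. h (ball_class r (G, x)))"
  proof (intro sum.cong refl)
    fix z assume "z \<in> birooted V"
    then obtain G x v where z: "z = (G, x, v)" "G \<in> conn_class \<G>" "verts G = V" "x \<in> V"
      by (auto simp: birooted_def)
    then show "(\<lambda>(G, x, v). h (ball_class r (G, x))) (map_prod (gmap f) (map_prod f f) z)
        = (case z of (G, x, v) \<Rightarrow> h (ball_class r (G, x)))"
      using ball_class_gmap[of G f x r] inj conn_classD(3) by simp
  qed
  finally show ?thesis by simp
qed

lemma sum_links_relabel:
  assumes U: "finite U" "t \<notin> U"
  shows "(\<Sum>(G, s)\<in>links_on U t. h (ended_class (G, s, t)))
    = (\<Sum>(G, s)\<in>links_on {1..card U} 0. h (ended_class (G, s, 0)) :: real)"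
proof -
  obtain g where g: "bij_betw g U {1..card U}" using bij_betw_standard[OF U(1)] .
  define f where "f = g(t := 0)"
  have ft: "f t = 0" by (simp add: f_def)
  have "bij_betw f U {1..card U}"
    using g U(2) by (subst bij_betw_cong[of U f g]) (auto simp: f_def)
  then have f: "bij_betw f (insert t U) (insert 0 {1..card U})"
    using notIn_Un_bij_betw3[of t U f "{1..card U}"] U(2) ft by simp
  have inj: "inj_on f (insert t U)" using f by (simp add: bij_betw_def)
  have im: "f ` insert t U = insert 0 {1..card U}" using f by (simp add: bij_betw_def)
  let ?V = "insert t U" and ?W = "insert 0 {1..card U}"
  note i = bij_betw_inv_into[OF f]
  let ?i = "inv_into ?V f"
  have injI: "inj_on ?i ?W" and imI: "?i ` ?W = ?V" using i by (simp_all add: bij_betw_def)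
  have i0: "?i 0 = t" using inv_into_f_f[OF inj, of t] ft by simp
  let ?g = "map_prod (gmap f) f"
  have b: "bij_betw ?g (links_on U t) (links_on {1..card U} 0)"
  proof (rule bij_betw_byWitness[of _ "map_prod (gmap ?i) ?i"])
    show "\<forall>z\<in>links_on U t. map_prod (gmap ?i) ?i (?g z) = z"
    proof
      fix z assume "z \<in> links_on U t"
      then obtain G s where z: "z = (G, s)" "is_link \<G> (G, s, t)" "verts G = ?V" by (auto simp: links_on_def)
      have "gmap ?i (gmap f G) = G"
        using gmap_inv[of G f] inj conn_classD(3)[OF is_linkD(1)[OF z(2)]] z(3) by simp
      moreover have "?i (f s) = s" using is_linkD(2)[OF z(2)] z(3) inj by simp
      ultimately show "map_prod (gmap ?i) ?i (?g z) = z" by (simp add: z(1))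
    qed
    show "\<forall>z\<in>links_on {1..card U} 0. ?g (map_prod (gmap ?i) ?i z) = z"
    proof
      fix z assume "z \<in> links_on {1..card U} 0"
      then obtain G s where z: "z = (G, s)" "is_link \<G> (G, s, 0)" "verts G = ?W" by (auto simp: links_on_def)
      have fi: "f (?i v) = v" if "v \<in> ?W" for v
        using that im by (intro f_inv_into_f) simp
      have "gmap f (gmap ?i G) = G"
        unfolding gmap_comp using conn_classD(3)[OF is_linkD(1)[OF z(2)]] z(3) fi
        by (intro gmap_ident) auto
      moreover have "f (?i s) = s" using is_linkD(2)[OF z(2)] z(3) fi by blast
      ultimately show "?g (map_prod (gmap ?i) ?i z) = z" by (simp add: z(1))
    qed
    show "?g ` links_on U t \<subseteq> links_on {1..card U} 0"
    proof
      fix z assume "z \<in> ?g ` links_on U t"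
      then obtain G s where z: "z = (gmap f G, f s)" "is_link \<G> (G, s, t)" "verts G = ?V"
        by (auto simp: links_on_def)
      then show "z \<in> links_on {1..card U} 0"
        using is_link_gmap[OF z(2), of f] inj im ft by (simp add: links_on_def)
    qed
    show "map_prod (gmap ?i) ?i ` links_on {1..card U} 0 \<subseteq> links_on U t"
    proof
      fix z assume "z \<in> map_prod (gmap ?i) ?i ` links_on {1..card U} 0"
      then obtain G s where z: "z = (gmap ?i G, ?i s)" "is_link \<G> (G, s, 0)" "verts G = ?W"
        by (auto simp: links_on_def)
      then show "z \<in> links_on U t"
        using is_link_gmap[OF z(2), of ?i] injI imI i0 by (simp add: links_on_def)
    qed
  qed
  have "(\<Sum>(G, s)\<in>links_on {1..card U} 0. h (ended_class (G, s, 0)))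
      = (\<Sum>z\<in>links_on U t. (\<lambda>(G, s). h (ended_class (G, s, 0))) (?g z))"
    by (rule sum.reindex_bij_betw[OF b, symmetric])
  also have "\<dots> = (\<Sum>(G, s)\<in>links_on U t. h (ended_class (G, s, t)))"
  proof (intro sum.cong refl)
    fix z assume "z \<in> links_on U t"
    then obtain G s where z: "z = (G, s)" "is_link \<G> (G, s, t)" "verts G = ?V" by (auto simp: links_on_def)
    have "ended_class (gmap f G, f s, f t) = ended_class (G, s, t)"
      using conn_classD(3)[OF is_linkD(1)[OF z(2)]] is_linkD(2,3)[OF z(2)] inj z(3)
      by (intro ended_class_gmap) auto
    then show "(\<lambda>(G, s). h (ended_class (G, s, 0))) (?g z) = (case z of (G, s) \<Rightarrow> h (ended_class (G, s, t)))"
      by (simp add: z(1) ft)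
  qed
  finally show ?thesis by simp
qed

end

section \<open>The probability measure on links\<close>

lemma card_quotient_kernel:
  assumes R: "\<And>a b. (a, b) \<in> R \<longleftrightarrow> a \<in> A \<and> b \<in> A \<and> F a = F b"
  shows "card (A // R) = card (F ` A)"
proof -
  let ?h = "\<lambda>y. {a \<in> A. F a = y}"
  have c: "R `` {a} = ?h (F a)" if "a \<in> A" for a using that by (auto simp: R)
  have "A // R = ?h ` F ` A"
  proof -
    have "A // R = (\<lambda>a. R `` {a}) ` A" by (auto simp: quotient_def)
    also have "\<dots> = (\<lambda>a. ?h (F a)) ` A" using c by (intro image_cong) auto
    finally show ?thesis by (simp add: image_image)
  qed
  moreover have "inj_on ?h (F ` A)" by (auto simp: inj_on_def)
  ultimately show ?thesis by (simp add: card_image)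
qed

context stable_class
begin

lemma link_classD:
  assumes "E \<in> links \<G>" "(G, s, t) \<in> E"
  shows "is_link \<G> (G, s, t)" "ended_class (G, s, t) = E"
proof -
  obtain x where x: "is_link \<G> x" "E = ended_class x" using assms(1) by (auto simp: links_def)
  obtain G' s' t' where x': "x = (G', s', t')" by (cases x)
  note l = x(1)[unfolded x']
  obtain f where f: "inj_on f (verts G')" "G = gmap f G'" "s = f s'" "t = f t'"
    using assms(2) unfolding x(2) x' ended_class_eq by auto
  show "is_link \<G> (G, s, t)" unfolding f using is_link_gmap[OF l f(1)] .
  show "ended_class (G, s, t) = E"
    unfolding f(2-4) x(2) x'
    using ended_class_gmap[OF conn_classD(3)[OF is_linkD(1)[OF l]] is_linkD(2,3)[OF l] f(1)] .
qed

lemma link_class_of_link: "is_link \<G> x \<Longrightarrow> ended_class x \<in> links \<G>"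
  by (auto simp: links_def)

lemma link_rep_in:
  assumes "E \<in> links \<G>"
  shows "link_rep E \<in> E"
proof -
  obtain x where x: "is_link \<G> x" "E = ended_class x" using assms by (auto simp: links_def)
  obtain G s t where x': "x = (G, s, t)" by (cases x)
  have "(G, s, t) \<in> E"
    unfolding x(2) x' using ended_class_self[OF conn_classD(3)[OF is_linkD(1)[OF x(1)[unfolded x']]]] .
  then show ?thesis unfolding link_rep_def by (rule someI)
qed

text \<open>A labelling of the vertices other than the sink amounts to a relabelled copy of the link, and isomorphic
  labellings are those with the same copy.\<close>

lemma num_labellings_eq:
  assumes l: "is_link \<G> (G, s, t)"
  defines "m \<equiv> card (verts G - {t})"
  shows "num_labellings (G, s, t)
    = card {(G', s') \<in> links_on {1..m} 0. ended_class (G', s', 0) = ended_class (G, s, t)}"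
proof -
  have G: "sgraph G" "finite (verts G)" using conn_classD[OF is_linkD(1)[OF l]] by auto
  note st = is_linkD(2-4)[OF l]
  define A where "A = labellings (G, s, t)"
  have A: "\<phi> \<in> A \<longleftrightarrow> \<phi> \<in> extensional (verts G - {t}) \<and> bij_betw \<phi> (verts G - {t}) {1..m}" for \<phi>
    by (simp add: A_def labellings_def m_def)
  have inj: "inj_on (\<phi>(t := 0)) (verts G)" and im: "(\<phi>(t := 0)) ` verts G = insert 0 {1..m}"
    if "\<phi> \<in> A" for \<phi>
  proof -
    have b: "inj_on \<phi> (verts G - {t})" "\<phi> ` (verts G - {t}) = {1..m}"
      using that by (auto simp: A bij_betw_def)
    have i: "(\<phi>(t := 0)) ` (verts G - {t}) = {1..m}" using b(2) by (auto simp: image_def)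
    have "inj_on (\<phi>(t := 0)) (verts G - {t})"
      using b(1) by (rule inj_on_cong[THEN iffD1, rotated]) auto
    then have "inj_on (\<phi>(t := 0)) (insert t (verts G - {t}))"
      unfolding inj_on_insert Diff_idemp i by simp
    then show "inj_on (\<phi>(t := 0)) (verts G)" unfolding insert_Diff[OF st(2)] .
    have "(\<phi>(t := 0)) ` insert t (verts G - {t}) = insert 0 {1..m}" unfolding image_insert i by simp
    then show "(\<phi>(t := 0)) ` verts G = insert 0 {1..m}" unfolding insert_Diff[OF st(2)] .
  qed
  define F :: "(nat \<Rightarrow> nat) \<Rightarrow> nat graph \<times> nat" where "F = (\<lambda>\<phi>. (gmap (\<phi>(t := 0)) G, \<phi> s))"
  have "(\<phi>, \<psi>) \<in> labelling_iso (G, s, t) \<longleftrightarrow> \<phi> \<in> A \<and> \<psi> \<in> A \<and> F \<phi> = F \<psi>" for \<phi> \<psi>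
  proof
    assume "(\<phi>, \<psi>) \<in> labelling_iso (G, s, t)"
    then obtain \<alpha> where a: "\<phi> \<in> A" "\<psi> \<in> A" "inj_on \<alpha> (verts G)" "gmap \<alpha> G = G" "\<alpha> s = s" "\<alpha> t = t"
      "\<And>v. v \<in> verts G - {t} \<Longrightarrow> \<phi> v = \<psi> (\<alpha> v)"
      by (auto simp: labelling_iso_def A_def ended_iso_def graph_iso_iff)
    have "gmap (\<phi>(t := 0)) G = gmap (\<psi>(t := 0) \<circ> \<alpha>) G"
    proof (rule gmap_cong[OF G(1)])
      fix v assume v: "v \<in> verts G"
      show "(\<phi>(t := 0)) v = (\<psi>(t := 0) \<circ> \<alpha>) v"
      proof (cases "v = t")
        case True
        then show ?thesis using a(6) by simp
      next
        case False
        then have "\<alpha> v \<noteq> t" using inj_onD[OF a(3), of v t] v st(2) a(6) by auto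
        then show ?thesis using a(7)[of v] v False by simp
      qed
    qed
    also have "\<dots> = gmap (\<psi>(t := 0)) G" unfolding gmap_comp[symmetric] a(4) ..
    finally have "gmap (\<phi>(t := 0)) G = gmap (\<psi>(t := 0)) G" .
    moreover have "\<phi> s = \<psi> s" using a(7)[of s] a(5) st by simp
    ultimately show "\<phi> \<in> A \<and> \<psi> \<in> A \<and> F \<phi> = F \<psi>" using a(1,2) by (simp add: F_def)
  next
    assume "\<phi> \<in> A \<and> \<psi> \<in> A \<and> F \<phi> = F \<psi>"
    then have a: "\<phi> \<in> A" "\<psi> \<in> A" "gmap (\<phi>(t := 0)) G = gmap (\<psi>(t := 0)) G" "\<phi> s = \<psi> s"
      by (auto simp: F_def)
    let ?\<phi> = "\<phi>(t := 0)" and ?\<psi> = "\<psi>(t := 0)"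
    define \<alpha> where "\<alpha> = inv_into (verts G) ?\<psi> \<circ> ?\<phi>"
    have \<psi>\<alpha>: "?\<psi> (\<alpha> v) = ?\<phi> v" if "v \<in> verts G" for v
    proof -
      have "?\<phi> v \<in> ?\<psi> ` verts G" using that im[OF a(1)] im[OF a(2)] by blast
      then show ?thesis unfolding \<alpha>_def comp_def by (rule f_inv_into_f)
    qed
    have "gmap \<alpha> G = G"
      unfolding \<alpha>_def gmap_comp[symmetric] a(3) by (rule gmap_inv[OF G(1) inj[OF a(2)]])
    moreover have "inj_on \<alpha> (verts G)"
    proof (rule inj_onI)
      fix u v assume uv: "u \<in> verts G" "v \<in> verts G" "\<alpha> u = \<alpha> v"
      then have "?\<phi> u = ?\<phi> v" using \<psi>\<alpha>[OF uv(1)] \<psi>\<alpha>[OF uv(2)] by simp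
      then show "u = v" using inj_onD[OF inj[OF a(1)]] uv by blast
    qed
    moreover have "\<alpha> t = t"
    proof -
      have "\<alpha> t = inv_into (verts G) ?\<psi> (?\<psi> t)" by (simp add: \<alpha>_def)
      also have "\<dots> = t" by (rule inv_into_f_f[OF inj[OF a(2)] st(2)])
      finally show ?thesis .
    qed
    moreover have "\<alpha> s = s"
    proof -
      have "\<alpha> s = inv_into (verts G) ?\<psi> (?\<psi> s)" using a(4) st(3) by (simp add: \<alpha>_def)
      also have "\<dots> = s" by (rule inv_into_f_f[OF inj[OF a(2)] st(1)])
      finally show ?thesis .
    qed
    moreover have "\<phi> v = \<psi> (\<alpha> v)" if v: "v \<in> verts G - {t}" for v
    proof -
      have "\<alpha> v \<noteq> t"
        using calculation(2,3) inj_onD[of \<alpha> "verts G" v t] v st(2) by auto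
      then show ?thesis using \<psi>\<alpha>[of v] v by simp
    qed
    ultimately show "(\<phi>, \<psi>) \<in> labelling_iso (G, s, t)"
      using a(1,2) by (auto simp: labelling_iso_def A_def ended_iso_def graph_iso_iff intro!: exI[of _ \<alpha>])
  qed
  then have "num_labellings (G, s, t) = card (F ` A)"
    unfolding num_labellings_def A_def[symmetric] by (rule card_quotient_kernel)
  also have "F ` A = {(G', s') \<in> links_on {1..m} 0. ended_class (G', s', 0) = ended_class (G, s, t)}"
  proof
    show "F ` A \<subseteq> {(G', s') \<in> links_on {1..m} 0. ended_class (G', s', 0) = ended_class (G, s, t)}"
    proof
      fix z assume "z \<in> F ` A"
      then obtain \<phi> where \<phi>: "\<phi> \<in> A" "z = F \<phi>" by blast
      let ?\<phi> = "\<phi>(t := 0)"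
      have "z = (gmap ?\<phi> G, ?\<phi> s)" using \<phi>(2) st(3) by (simp add: F_def)
      moreover have "is_link \<G> (gmap ?\<phi> G, ?\<phi> s, 0)"
        using is_link_gmap[OF l inj[OF \<phi>(1)]] by simp
      moreover have "ended_class (gmap ?\<phi> G, ?\<phi> s, 0) = ended_class (G, s, t)"
        using ended_class_gmap[OF G(1) st(1,2) inj[OF \<phi>(1)]] by simp
      ultimately show "z \<in> {(G', s') \<in> links_on {1..m} 0. ended_class (G', s', 0) = ended_class (G, s, t)}"
        using im[OF \<phi>(1)] by (simp add: links_on_def del: fun_upd_apply)
    qed
    show "{(G', s') \<in> links_on {1..m} 0. ended_class (G', s', 0) = ended_class (G, s, t)} \<subseteq> F ` A"
    proof
      fix z assume "z \<in> {(G', s') \<in> links_on {1..m} 0. ended_class (G', s', 0) = ended_class (G, s, t)}"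
      then obtain G' s' where z: "z = (G', s')" "is_link \<G> (G', s', 0)" "verts G' = insert 0 {1..m}"
        "ended_class (G', s', 0) = ended_class (G, s, t)" by (auto simp: links_on_def)
      have "(G', s', 0) \<in> ended_class (G, s, t)"
        using ended_class_self[OF conn_classD(3)[OF is_linkD(1)[OF z(2)]], of s' 0] z(4) by simp
      then obtain f where f: "inj_on f (verts G)" "G' = gmap f G" "s' = f s" "f t = 0"
        unfolding ended_class_eq by auto
      define \<phi> where "\<phi> = restrict f (verts G - {t})"
      have eq: "(\<phi>(t := 0)) v = f v" if "v \<in> verts G" for v
        using that f(4) by (simp add: \<phi>_def)
      have "f ` (verts G - {t}) = f ` verts G - f ` {t}"
        using st(2) by (intro inj_on_image_set_diff[OF f(1)]) auto
      also have "f ` verts G = insert 0 {1..m}" using z(3) f(2) by simp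
      finally have "f ` (verts G - {t}) = {1..m}" using f(4) by auto
      then have "bij_betw f (verts G - {t}) {1..m}"
        using inj_on_subset[OF f(1), of "verts G - {t}"] by (auto simp: bij_betw_def)
      then have "\<phi> \<in> A" by (simp add: A \<phi>_def bij_betw_def inj_on_def)
      moreover have "z = F \<phi>"
      proof -
        have "gmap (\<phi>(t := 0)) G = G'" unfolding f(2) using G(1) eq by (rule gmap_cong)
        moreover have "\<phi> s = s'" using st f(3) by (simp add: \<phi>_def)
        ultimately show ?thesis by (simp add: F_def z(1))
      qed
      ultimately show "z \<in> F ` A" by blast
    qed
  qed
  finally show ?thesis .
qed

text \<open>Relabelled copies of the links with sink 0, graded by the number of the remaining vertices. Weighting each copy by \<open>\<rho>\<^sup>m / m!\<close>
  and passing to isomorphism classes yields the measure on links.\<close>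

definition labelled_links :: "(nat \<times> nat graph \<times> nat) set" where
  "labelled_links = (SIGMA m:UNIV. links_on {1..m} 0)"

definition link_class :: "nat \<times> nat graph \<times> nat \<Rightarrow> nat ended set" where
  "link_class = (\<lambda>(m, G, s). ended_class (G, s, 0))"

lemma countable_labelled_links: "countable labelled_links"
  unfolding labelled_links_def by (intro countable_SIGMA countable_finite[OF finite_links_on]) auto

lemma link_class_image: "link_class ` labelled_links = links \<G>"
proof
  show "link_class ` labelled_links \<subseteq> links \<G>"
    by (auto simp: labelled_links_def link_class_def links_on_def intro: link_class_of_link)
  show "links \<G> \<subseteq> link_class ` labelled_links"
  proof
    fix E assume E: "E \<in> links \<G>"
    obtain G s t where x: "link_rep E = (G, s, t)" by (cases "link_rep E")
    have xE: "(G, s, t) \<in> E" using link_rep_in[OF E] x by simp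
    note l = link_classD(1)[OF E xE]
    have G: "finite (verts G)" "t \<in> verts G" using conn_classD[OF is_linkD(1)[OF l]] is_linkD[OF l] by auto
    let ?U = "verts G - {t}"
    have V: "insert t ?U = verts G" using G(2) by auto
    have "(G, s) \<in> links_on ?U t" using l V by (simp add: links_on_def)
    moreover have "(\<Sum>(G, s)\<in>links_on ?U t. if ended_class (G, s, t) = E then 1 else 0 :: real)
        = (\<Sum>(G, s)\<in>links_on {1..card ?U} 0. if ended_class (G, s, 0) = E then 1 else 0)"
      using G(1) by (intro sum_links_relabel[where h = "\<lambda>F. if F = E then 1 else 0"]) auto
    moreover have "0 < (\<Sum>(G, s)\<in>links_on ?U t. if ended_class (G, s, t) = E then 1 else 0 :: real)"
      using calculation(1) link_classD(2)[OF E xE] G(1) finite_links_on[of ?U t]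
      by (intro sum_pos2[of _ "(G, s)"]) (auto split: if_splits)
    \<comment> \<open>a copy on the standard labels exists because the numbers of copies agree\<close>
    ultimately have "(\<Sum>(G, s)\<in>links_on {1..card ?U} 0. if ended_class (G, s, 0) = E then 1 else 0 :: real) \<noteq> 0"
      by linarith
    then obtain z where "z \<in> links_on {1..card ?U} 0"
      "(case z of (G, s) \<Rightarrow> (if ended_class (G, s, 0) = E then 1 else 0)) \<noteq> (0 :: real)"
      by (rule sum.not_neutral_contains_not_neutral)
    then show "E \<in> link_class ` labelled_links"
      by (intro image_eqI[of _ _ "(card ?U, z)"])
        (auto simp: link_class_def labelled_links_def split: if_splits prod.splits)
  qed
qed

lemma countable_links: "countable (links \<G>)"
  unfolding link_class_image[symmetric] by (intro countable_image countable_labelled_links)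

end

context subcritical_class
begin

definition labelled_weight :: "nat \<times> nat graph \<times> nat \<Rightarrow> real" where
  "labelled_weight = (\<lambda>(m, _). \<rho> ^ m / fact m)"

lemma link_weight_eq:
  assumes E: "E \<in> links \<G>"
  shows "finite {y \<in> labelled_links. link_class y = E}"
    "link_weight \<G> E = (\<Sum>y\<in>{y \<in> labelled_links. link_class y = E}. labelled_weight y)"
proof -
  obtain G s t where x: "link_rep E = (G, s, t)" by (cases "link_rep E")
  have xE: "(G, s, t) \<in> E" using link_rep_in[OF E] x by simp
  note l = link_classD[OF E xE]
  define m where "m = card (verts G - {t})"
  have t: "t \<in> verts G" "finite (verts G)" using is_linkD[OF l(1)] conn_classD by auto
  let ?Y = "{(G', s') \<in> links_on {1..m} 0. ended_class (G', s', 0) = E}"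
  have eq: "{y \<in> labelled_links. link_class y = E} = Pair m ` ?Y"
  proof
    show "Pair m ` ?Y \<subseteq> {y \<in> labelled_links. link_class y = E}"
      by (auto simp: labelled_links_def link_class_def)
    show "{y \<in> labelled_links. link_class y = E} \<subseteq> Pair m ` ?Y"
    proof
      fix y assume "y \<in> {y \<in> labelled_links. link_class y = E}"
      then obtain k G' s' where y: "y = (k, G', s')" "is_link \<G> (G', s', 0)" "verts G' = insert 0 {1..k}"
        "ended_class (G', s', 0) = E"
        by (auto simp: labelled_links_def link_class_def links_on_def)
      have "(G, s, t) \<in> ended_class (G', s', 0)" using xE y(4) by simp
      then obtain f where f: "inj_on f (verts G')" "G = gmap f G'" unfolding ended_class_eq by auto
      have "card (verts G) = Suc k" using f y(3) by (simp add: card_image)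
      then have "k = m" using t by (simp add: m_def card_Diff_singleton)
      then show "y \<in> Pair m ` ?Y" using y by (auto simp: links_on_def)
    qed
  qed
  have fin: "finite ?Y" by (rule finite_subset[OF _ finite_links_on[of "{1..m}" 0]]) auto
  then show "finite {y \<in> labelled_links. link_class y = E}" unfolding eq by simp
  have "(\<Sum>y\<in>{y \<in> labelled_links. link_class y = E}. labelled_weight y) = (\<Sum>y\<in>?Y. \<rho> ^ m / fact m)"
    unfolding eq by (subst sum.reindex) (auto simp: inj_on_def labelled_weight_def)
  also have "\<dots> = real (card ?Y) * (\<rho> ^ m / fact m)" by simp
  also have "card ?Y = num_labellings (G, s, t)"
    using num_labellings_eq[OF l(1)] l(2) by (simp add: m_def)
  finally show "link_weight \<G> E = (\<Sum>y\<in>{y \<in> labelled_links. link_class y = E}. labelled_weight y)"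
    by (simp add: link_weight_def x Let_def ended_size_def m_def \<rho>_def)
qed

lemma space_link_measure: "space (link_measure \<G>) = links \<G>"
  by (simp add: link_measure_def space_point_measure)

lemma sets_link_measure: "sets (link_measure \<G>) = Pow (links \<G>)"
  by (simp add: link_measure_def sets_point_measure)

lemma sets_link_measure_count: "sets (link_measure \<G>) = sets (count_space (links \<G>))"
  by (simp add: sets_link_measure)

lemma labelled_weight_nonneg: "0 \<le> labelled_weight y"
  using conn_radius_eq(2) by (simp add: labelled_weight_def case_prod_beta)

lemma link_measure_distr:
  "link_measure \<G> = distr (point_measure labelled_links (\<lambda>y. ennreal (labelled_weight y)))
    (count_space (links \<G>)) link_class" (is "_ = distr ?P _ _")
proof (rule measure_eqI_countable[of _ "links \<G>"])
  show "sets (link_measure \<G>) = Pow (links \<G>)" by (rule sets_link_measure)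
  show "sets (distr ?P (count_space (links \<G>)) link_class) = Pow (links \<G>)" by simp
  show "countable (links \<G>)" by (rule countable_links)
  have meas: "link_class \<in> measurable ?P (count_space (links \<G>))"
    using link_class_image by (auto simp: measurable_def space_point_measure sets_point_measure)
  fix E assume E: "E \<in> links \<G>"
  note w = link_weight_eq[OF E]
  have "link_weight \<G> E \<ge> 0" unfolding w(2) by (intro sum_nonneg labelled_weight_nonneg)
  have "emeasure (link_measure \<G>) {E} = ennreal (link_weight \<G> E)"
    unfolding link_measure_def using E by (subst emeasure_point_measure_finite2) auto
  also have "\<dots> = (\<Sum>y\<in>{y \<in> labelled_links. link_class y = E}. ennreal (labelled_weight y))"
    unfolding w(2) using labelled_weight_nonneg by (subst sum_ennreal) auto
  also have "\<dots> = emeasure ?P {y \<in> labelled_links. link_class y = E}"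
    using w(1) by (subst emeasure_point_measure_finite2) auto
  also have "{y \<in> labelled_links. link_class y = E} = link_class -` {E} \<inter> space ?P"
    by (auto simp: space_point_measure)
  also have "emeasure ?P \<dots> = emeasure (distr ?P (count_space (links \<G>)) link_class) {E}"
    using E by (intro emeasure_distr[symmetric] meas) auto
  finally show "emeasure (link_measure \<G>) {E} = emeasure (distr ?P (count_space (links \<G>)) link_class) {E}" .
qed

lemma nn_integral_link_measure:
  "(\<integral>\<^sup>+E. h E \<partial>link_measure \<G>)
    = (\<Sum>m. \<Sum>(G, s)\<in>links_on {1..m} 0. ennreal (\<rho> ^ m / fact m) * h (ended_class (G, s, 0)))"
proof -
  let ?P = "point_measure labelled_links (\<lambda>y. ennreal (labelled_weight y))"
  have meas: "link_class \<in> measurable ?P (count_space (links \<G>))"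
    using link_class_image by (auto simp: measurable_def space_point_measure sets_point_measure)
  have "(\<integral>\<^sup>+E. h E \<partial>link_measure \<G>) = (\<integral>\<^sup>+y. h (link_class y) \<partial>?P)"
    unfolding link_measure_distr by (intro nn_integral_distr meas) simp
  also have "\<dots> = (\<integral>\<^sup>+y. ennreal (labelled_weight y) * h (link_class y) \<partial>count_space labelled_links)"
    unfolding point_measure_def by (rule nn_integral_density) simp_all
  also have "\<dots> = (\<integral>\<^sup>+y. ennreal (labelled_weight y) * h (link_class y) * indicator labelled_links y \<partial>count_space UNIV)"
    by (subst nn_integral_count_space_indicator) auto
  also have "\<dots> = (\<integral>\<^sup>+m. \<integral>\<^sup>+z. ennreal (labelled_weight (m, z)) * h (link_class (m, z)) * indicator labelled_links (m, z)
      \<partial>count_space UNIV \<partial>count_space UNIV)"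
    by (rule nn_integral_fst_count_space[symmetric])
  also have "\<dots> = (\<Sum>m. \<integral>\<^sup>+z. ennreal (labelled_weight (m, z)) * h (link_class (m, z)) * indicator labelled_links (m, z)
      \<partial>count_space UNIV)"
    by (rule nn_integral_count_space_nat)
  also have "(\<lambda>m. \<integral>\<^sup>+z. ennreal (labelled_weight (m, z)) * h (link_class (m, z)) * indicator labelled_links (m, z)
      \<partial>count_space UNIV)
    = (\<lambda>m. \<Sum>(G, s)\<in>links_on {1..m} 0. ennreal (\<rho> ^ m / fact m) * h (ended_class (G, s, 0)))"
  proof
    fix m
    have "(\<integral>\<^sup>+z. ennreal (labelled_weight (m, z)) * h (link_class (m, z)) * indicator labelled_links (m, z)
        \<partial>count_space UNIV)
      = (\<integral>\<^sup>+z. ennreal (labelled_weight (m, z)) * h (link_class (m, z)) * indicator (links_on {1..m} 0) z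
        \<partial>count_space UNIV)"
      by (intro nn_integral_cong) (auto simp: labelled_links_def split: split_indicator)
    also have "\<dots> = (\<integral>\<^sup>+z. ennreal (labelled_weight (m, z)) * h (link_class (m, z)) \<partial>count_space (links_on {1..m} 0))"
      by (subst nn_integral_count_space_indicator[symmetric]) auto
    also have "\<dots> = (\<Sum>z\<in>links_on {1..m} 0. ennreal (labelled_weight (m, z)) * h (link_class (m, z)))"
      by (intro nn_integral_count_space_finite finite_links_on) simp
    also have "\<dots> = (\<Sum>(G, s)\<in>links_on {1..m} 0. ennreal (\<rho> ^ m / fact m) * h (ended_class (G, s, 0)))"
      by (intro sum.cong) (auto simp: labelled_weight_def link_class_def)
    finally show "(\<integral>\<^sup>+z. ennreal (labelled_weight (m, z)) * h (link_class (m, z)) * indicator labelled_links (m, z)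
        \<partial>count_space UNIV)
      = (\<Sum>(G, s)\<in>links_on {1..m} 0. ennreal (\<rho> ^ m / fact m) * h (ended_class (G, s, 0)))" .
  qed
  finally show ?thesis .
qed

lemma prob_space_link_measure: "prob_space (link_measure \<G>)"
proof
  have "emeasure (link_measure \<G>) (space (link_measure \<G>)) = (\<integral>\<^sup>+E. 1 \<partial>link_measure \<G>)" by simp
  also have "\<dots> = (\<Sum>m. \<Sum>(G, s)\<in>links_on {1..m} 0. ennreal (\<rho> ^ m / fact m) * 1)"
    by (rule nn_integral_link_measure)
  also have "\<dots> = (\<Sum>m. ennreal (fps_nth L m * \<rho> ^ m))"
  proof (intro suminf_cong)
    fix m
    have "(\<Sum>(G, s)\<in>links_on {1..m} 0. ennreal (\<rho> ^ m / fact m) * 1)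
        = of_nat (nlinks m) * ennreal (\<rho> ^ m / fact m)"
      by (simp add: case_prod_beta nlinks_def)
    also have "\<dots> = ennreal (real (nlinks m) * (\<rho> ^ m / fact m))"
      using conn_radius_eq(2) by (subst ennreal_mult) (auto simp: ennreal_of_nat_eq_real_of_nat)
    finally show "(\<Sum>(G, s)\<in>links_on {1..m} 0. ennreal (\<rho> ^ m / fact m) * 1) = ennreal (fps_nth L m * \<rho> ^ m)"
      by (simp add: L_def)
  qed
  also have "\<dots> = ennreal 1"
  proof -
    have nn: "0 \<le> fps_nth L m * \<rho> ^ m" for m using conn_radius_eq(2) by (simp add: L_def)
    show ?thesis unfolding suminf_ennreal2[OF nn sums_summable[OF L_sums]] sums_unique[OF L_sums, symmetric] ..
  qed
  finally show "emeasure (link_measure \<G>) (space (link_measure \<G>)) = 1" by simp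
qed

end

section \<open>The infinite chain\<close>

definition shift_vertex :: "nat \<times> nat \<Rightarrow> nat \<times> nat" where
  "shift_vertex = (\<lambda>(j, v). (Suc j, v))"

lemma inj_shift_vertex: "inj_on shift_vertex A"
  by (auto simp: inj_on_def shift_vertex_def)

abbreviation ended_graph :: "'v ended \<Rightarrow> 'v graph" where "ended_graph x \<equiv> fst x"
abbreviation source :: "'v ended \<Rightarrow> 'v" where "source x \<equiv> fst (snd x)"
abbreviation sink :: "'v ended \<Rightarrow> 'v" where "sink x \<equiv> snd (snd x)"

lemma chain_vertex_eq:
  "chain_vertex x j v = (if v = sink (x j) then (Suc j, source (x (Suc j))) else (j, v))"
  by (simp add: chain_vertex_def split_beta)

context stable_class
begin

context
  fixes x :: "nat \<Rightarrow> nat ended"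
  assumes links: "\<And>j. is_link \<G> (x j)"
begin

lemma chain_link:
  "sgraph (ended_graph (x j))" "finite (verts (ended_graph (x j)))"
  "source (x j) \<in> verts (ended_graph (x j))" "sink (x j) \<in> verts (ended_graph (x j))"
  "source (x j) \<noteq> sink (x j)"
proof -
  have l: "is_link \<G> (ended_graph (x j), source (x j), sink (x j))" using links[of j] by simp
  show "sgraph (ended_graph (x j))" "finite (verts (ended_graph (x j)))"
    using conn_classD[OF is_linkD(1)[OF l]] by auto
  show "source (x j) \<in> verts (ended_graph (x j))" "sink (x j) \<in> verts (ended_graph (x j))"
    "source (x j) \<noteq> sink (x j)" using is_linkD[OF l] by auto
qed

lemma inj_chain_vertex: "inj_on (chain_vertex x j) A"
  by (auto simp: inj_on_def chain_vertex_eq split: if_splits)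

lemma chain_vertex_source: "chain_vertex x j (source (x j)) = (j, source (x j))"
  using chain_link(5) by (simp add: chain_vertex_eq)

lemma verts_chain: "verts (fst (chain x)) = (\<Union>j. chain_vertex x j ` verts (ended_graph (x j)))"
  by (simp add: chain_def)

lemma edges_chain: "edges (fst (chain x)) = (\<Union>j. (\<lambda>e. chain_vertex x j ` e) ` edges (ended_graph (x j)))"
  by (simp add: chain_def)

lemma chain_root: "snd (chain x) = (0, source (x 0))"
  by (simp add: chain_def)

lemma sgraph_chain: "sgraph (fst (chain x))"
  unfolding sgraph_def
proof
  fix e assume "e \<in> edges (fst (chain x))"
  then obtain j e' where e: "e' \<in> edges (ended_graph (x j))" "e = chain_vertex x j ` e'"
    unfolding edges_chain by blast
  have "card e' = 2" "e' \<subseteq> verts (ended_graph (x j))" using chain_link(1)[of j] e(1) by (auto simp: sgraph_def)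
  then show "e \<subseteq> verts (fst (chain x)) \<and> card e = 2"
    unfolding e(2) verts_chain by (auto simp: card_image[OF inj_chain_vertex])
qed

lemma source_in_chain: "(j, source (x j)) \<in> verts (fst (chain x))"
  using imageI[OF chain_link(3)[of j], of "chain_vertex x j"]
  unfolding chain_vertex_source verts_chain by (rule UN_I[OF UNIV_I])

lemma root_in_chain: "snd (chain x) \<in> verts (fst (chain x))"
  unfolding chain_root by (rule source_in_chain)

lemma infinite_chain: "infinite (verts (fst (chain x)))"
proof
  assume fin: "finite (verts (fst (chain x)))"
  have "range (\<lambda>j. (j, source (x j))) \<subseteq> verts (fst (chain x))"
    using source_in_chain by auto
  then have "finite (range (\<lambda>j. (j, source (x j))))" using fin by (rule finite_subset)
  moreover have "inj (\<lambda>j. (j, source (x j)))" by (auto simp: inj_on_def)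
  ultimately show False using finite_imageD[of "\<lambda>j. (j, source (x j))" UNIV] by simp
qed

text \<open>An edge at the vertex \<open>(j, v)\<close> belongs to one of the finitely many finite links up to the \<open>j\<close>-th.\<close>

lemma locally_finite_chain: "locally_finite (fst (chain x))"
  unfolding locally_finite_def
proof
  fix p assume "p \<in> verts (fst (chain x))"
  obtain j v where p: "p = (j, v)" by (cases p)
  have fe: "finite (edges (ended_graph (x i)))" for i
  proof (rule finite_subset)
    show "edges (ended_graph (x i)) \<subseteq> Pow (verts (ended_graph (x i)))"
      using sgraph_subset[OF chain_link(1)[of i]] by auto
  qed (use chain_link(2) in simp)
  have "{e \<in> edges (fst (chain x)). p \<in> e} \<subseteq> (\<Union>i\<in>{..j}. (\<lambda>e. chain_vertex x i ` e) ` edges (ended_graph (x i)))"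
  proof
    fix e assume e: "e \<in> {e \<in> edges (fst (chain x)). p \<in> e}"
    then obtain i e' where i: "e' \<in> edges (ended_graph (x i))" "e = chain_vertex x i ` e'"
      unfolding edges_chain by blast
    then obtain u where "p = chain_vertex x i u" using e by auto
    then have "i \<le> j" using p by (auto simp: chain_vertex_eq split: if_splits)
    then show "e \<in> (\<Union>i\<in>{..j}. (\<lambda>e. chain_vertex x i ` e) ` edges (ended_graph (x i)))" using i by blast
  qed
  then show "finite {e \<in> edges (fst (chain x)). p \<in> e}"
    by (rule finite_subset) (use fe in auto)
qed

end

lemma chain_unfold:
  assumes links: "\<And>j. is_link \<G> (x j)"
  shows "fst (chain x) = gunion (gmap (chain_vertex x 0) (ended_graph (x 0)))
      (gmap shift_vertex (fst (chain (x \<circ> Suc))))" (is "_ = gunion ?G1 ?G2")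
    and "verts (gmap (chain_vertex x 0) (ended_graph (x 0)))
      \<inter> verts (gmap shift_vertex (fst (chain (x \<circ> Suc)))) = {(1, source (x 1))}"
proof -
  have links': "is_link \<G> ((x \<circ> Suc) j)" for j using links by simp
  have cv: "shift_vertex (chain_vertex (x \<circ> Suc) j v) = chain_vertex x (Suc j) v" for j v
    by (simp add: chain_vertex_eq shift_vertex_def)
  have V2: "verts ?G2 = (\<Union>j. chain_vertex x (Suc j) ` verts (ended_graph (x (Suc j))))"
    unfolding gmap_simps verts_chain[of "x \<circ> Suc", OF links'] image_UN image_image cv by simp
  have E2: "edges ?G2 = (\<Union>j. (\<lambda>e. chain_vertex x (Suc j) ` e) ` edges (ended_graph (x (Suc j))))"
    unfolding gmap_simps edges_chain[of "x \<circ> Suc", OF links'] image_UN image_image cv by simp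
  have split: "(\<Union>j. A j) = A 0 \<union> (\<Union>j. A (Suc j))" for A :: "nat \<Rightarrow> 'z set"
  proof
    show "(\<Union>j. A j) \<subseteq> A 0 \<union> (\<Union>j. A (Suc j))"
    proof
      fix z assume "z \<in> (\<Union>j. A j)"
      then obtain j where "z \<in> A j" by blast
      then show "z \<in> A 0 \<union> (\<Union>j. A (Suc j))" by (cases j) auto
    qed
  qed auto
  have V: "verts (fst (chain x)) = verts ?G1 \<union> verts ?G2"
    unfolding verts_chain[of x, OF links] V2 unfolding gmap_simps by (rule split)
  have E: "edges (fst (chain x)) = edges ?G1 \<union> edges ?G2"
    unfolding edges_chain[of x, OF links] E2 unfolding gmap_simps by (rule split)
  show "fst (chain x) = gunion ?G1 ?G2"
    unfolding graph_eq_iff gunion_simps using V E by (rule conjI)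
  show "verts ?G1 \<inter> verts ?G2 = {(1, source (x 1))}"
  proof
    show "verts ?G1 \<inter> verts ?G2 \<subseteq> {(1, source (x 1))}"
    proof
      fix p assume p: "p \<in> verts ?G1 \<inter> verts ?G2"
      then obtain j v where "p = chain_vertex x (Suc j) v" unfolding V2 by blast
      then have "fst p \<noteq> 0" by (auto simp: chain_vertex_eq)
      moreover obtain u where "p = chain_vertex x 0 u" using p by auto
      ultimately show "p \<in> {(1, source (x 1))}" by (auto simp: chain_vertex_eq split: if_splits)
    qed
    have "(1, source (x 1)) \<in> verts ?G1"
      using imageI[OF chain_link(4)[of x 0, OF links], of "chain_vertex x 0"] by (simp add: chain_vertex_eq)
    moreover have "(1, source (x 1)) \<in> verts ?G2"
      unfolding V2 using imageI[OF chain_link(3)[of x "Suc 0", OF links], of "chain_vertex x (Suc 0)"]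
      unfolding chain_vertex_source[of x "Suc 0", OF links] by (intro UN_I[of 0]) auto
    ultimately show "{(1, source (x 1))} \<subseteq> verts ?G1 \<inter> verts ?G2" by blast
  qed
qed

lemma ball_class_chain_Suc:
  assumes links: "\<And>j. is_link \<G> (x j)"
  shows "ball_class (Suc r) (chain x) = glue_ball r (ended_class (x 0)) (ball_class r (chain (x \<circ> Suc)))"
proof -
  have links': "is_link \<G> ((x \<circ> Suc) j)" for j using links by simp
  \<comment> \<open>\<open>glue_ball\<close> speaks of graphs on \<^typ>\<open>nat\<close>, so the chain is first moved there\<close>
  let ?e = "to_nat :: nat \<times> nat \<Rightarrow> nat"
  have e: "inj_on ?e A" for A by (rule inj_on_subset[OF inj_to_nat]) simp
  let ?C = "fst (chain x)" and ?C' = "fst (chain (x \<circ> Suc))"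
  let ?G1 = "gmap (chain_vertex x 0) (ended_graph (x 0))" and ?G2 = "gmap shift_vertex ?C'"
  let ?f = "?e \<circ> chain_vertex x 0" and ?g = "?e \<circ> shift_vertex"
  let ?s = "source (x 0)" and ?t = "sink (x 0)"
  note u = chain_unfold[of x, OF links]
  have f: "inj_on ?f A" and g: "inj_on ?g B" for A B
    by (intro comp_inj_on inj_chain_vertex[of x, OF links] inj_shift_vertex e)+
  have fs: "?f ?s = ?e (0, ?s)" and ft: "?f ?t = ?e (1, source (x 1))"
    using chain_vertex_source[of x 0, OF links] by (simp_all add: chain_vertex_eq)
  have gt: "?g (snd (chain (x \<circ> Suc))) = ?e (1, source (x 1))"
    by (simp add: chain_root[of "x \<circ> Suc", OF links'] shift_vertex_def)
  have H1: "gmap ?e ?G1 = gmap ?f (ended_graph (x 0))" and H2: "gmap ?e ?G2 = gmap ?g ?C'"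
    by (rule gmap_comp)+
  have root: "snd (chain x) = (0, ?s)" by (rule chain_root[of x, OF links])
  have "ball_class (Suc r) (chain x) = ball_class (Suc r) (?C, (0, ?s))"
    using root by (metis prod.collapse)
  also have "\<dots> = ball_class (Suc r) (gmap ?e ?C, ?e (0, ?s))"
    using root_in_chain[of x, OF links] unfolding root
    by (intro ball_class_gmap[symmetric] sgraph_chain[of x, OF links] e)
  also have "gmap ?e ?C = gunion (gmap ?f (ended_graph (x 0))) (gmap ?g ?C')"
    unfolding u(1) gmap_gunion H1 H2 ..
  also have "ball_class (Suc r) (gunion (gmap ?f (ended_graph (x 0))) (gmap ?g ?C'), ?e (0, ?s))
    = glue_ball r (ended_class (gmap ?f (ended_graph (x 0)), ?e (0, ?s), ?e (1, source (x 1))))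
        (ball_class r (gmap ?g ?C', ?e (1, source (x 1))))"
  proof (rule glue_ball_eq[symmetric])
    show "sgraph (gmap ?f (ended_graph (x 0)))" by (intro sgraph_gmap chain_link(1)[of x, OF links] f)
    show "sgraph (gmap ?g ?C')" by (intro sgraph_gmap sgraph_chain[of "x \<circ> Suc", OF links'] g)
    have "verts (gmap ?e ?G1) \<inter> verts (gmap ?e ?G2) = ?e ` (verts ?G1 \<inter> verts ?G2)"
      unfolding gmap_simps(1)[of ?e] by (rule inj_on_image_Int[symmetric, OF e[of UNIV]]) auto
    then show "verts (gmap ?f (ended_graph (x 0))) \<inter> verts (gmap ?g ?C') = {?e (1, source (x 1))}"
      unfolding u(2) H1 H2 by simp
    show "?e (0, ?s) \<in> verts (gmap ?f (ended_graph (x 0)))"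
      unfolding gmap_simps fs[symmetric] using chain_link(3)[of x, OF links] by (rule imageI)
    show "?e (0, ?s) \<noteq> ?e (1, source (x 1))" by (simp add: inj_eq[OF inj_to_nat])
  qed
  also have "ended_class (gmap ?f (ended_graph (x 0)), ?e (0, ?s), ?e (1, source (x 1))) = ended_class (x 0)"
  proof -
    have "ended_class (gmap ?f (ended_graph (x 0)), ?f ?s, ?f ?t) = ended_class (ended_graph (x 0), ?s, ?t)"
      by (intro ended_class_gmap chain_link[of x, OF links] f)
    then show ?thesis unfolding fs ft by simp
  qed
  also have "ball_class r (gmap ?g ?C', ?e (1, source (x 1))) = ball_class r (chain (x \<circ> Suc))"
  proof -
    have "ball_class r (gmap ?g ?C', ?g (snd (chain (x \<circ> Suc)))) = ball_class r (?C', snd (chain (x \<circ> Suc)))"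
      by (intro ball_class_gmap sgraph_chain[of "x \<circ> Suc", OF links'] root_in_chain[of "x \<circ> Suc", OF links'] g)
    then show ?thesis unfolding gt by simp
  qed
  finally show ?thesis .
qed

end

lemma ball_class_0:
  fixes G :: "'v graph"
  assumes "sgraph G" "x \<in> verts G"
  shows "ball_class 0 (G, x) = range (\<lambda>y. (K1 y, y))"
proof -
  have e: "{e \<in> edges G. e \<subseteq> {x}} = {}"
  proof (rule ccontr)
    assume "{e \<in> edges G. e \<subseteq> {x}} \<noteq> {}"
    then obtain e where e: "e \<in> edges G" "e \<subseteq> {x}" by blast
    obtain a b where "e = {a, b}" "a \<noteq> b" "a \<in> verts G" "b \<in> verts G"
      by (rule sgraph_edge_obtain[OF assms(1) e(1)])
    then show False using e(2) by auto
  qed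
  have "ballset 0 G x = {x}" by (auto simp: ballset_def)
  then have "induced G (ballset 0 G x) = K1 x" using assms(2) e by (simp add: graph_eq_iff)
  then have "ball_class 0 (G, x) = {(K1 (f x), f x) |f :: 'v \<Rightarrow> nat. True}"
    by (simp add: ball_class_def rball_eq rooted_class_eq gmap_K1)
  also have "\<dots> = range (\<lambda>y. (K1 y, y))"
  proof
    show "range (\<lambda>y. (K1 y, y)) \<subseteq> {(K1 (f x), f x) |f :: 'v \<Rightarrow> nat. True}"
    proof
      fix z :: "nat graph \<times> nat" assume "z \<in> range (\<lambda>y. (K1 y, y))"
      then obtain y where "z = (K1 y, y)" by blast
      then show "z \<in> {(K1 (f x), f x) |f :: 'v \<Rightarrow> nat. True}" by (intro CollectI exI[of _ "\<lambda>_. y"]) simp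
    qed
  qed auto
  finally show ?thesis .
qed

context subcritical_class
begin

section \<open>The random chain\<close>

lemma space_chain_space: "space (chain_space \<G>) = {\<omega>. \<forall>j. \<omega> j \<in> links \<G>}"
  by (auto simp: chain_space_def space_PiM space_link_measure)

lemma sequence_space_links: "sequence_space (link_measure \<G>)"
  unfolding sequence_space_def by (rule product_prob_spaceI) (rule prob_space_link_measure)

lemma prob_space_chain: "prob_space (chain_space \<G>)"
  unfolding chain_space_def by (intro prob_space_PiM prob_space_link_measure)

lemma link_chain_links:
  assumes "\<omega> \<in> space (chain_space \<G>)"
  shows "is_link \<G> (link_rep (\<omega> j))" "ended_class (link_rep (\<omega> j)) = \<omega> j"
proof -
  have "\<omega> j \<in> links \<G>" using assms by (simp add: space_chain_space)
  then show "is_link \<G> (link_rep (\<omega> j))" "ended_class (link_rep (\<omega> j)) = \<omega> j"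
    using link_classD[of "\<omega> j" "fst (link_rep (\<omega> j))" "source (link_rep (\<omega> j))" "sink (link_rep (\<omega> j))"]
      link_rep_in by simp_all
qed

lemma ball_class_link_chain_Suc:
  assumes \<omega>: "\<omega> \<in> space (chain_space \<G>)"
  shows "ball_class (Suc r) (link_chain \<omega>) = glue_ball r (\<omega> 0) (ball_class r (link_chain (\<omega> \<circ> Suc)))"
proof -
  have "ball_class (Suc r) (chain (\<lambda>j. link_rep (\<omega> j)))
      = glue_ball r (ended_class (link_rep (\<omega> 0))) (ball_class r (chain ((\<lambda>j. link_rep (\<omega> j)) \<circ> Suc)))"
    by (rule ball_class_chain_Suc) (rule link_chain_links[OF \<omega>])
  then show ?thesis
    unfolding link_chain_def link_chain_links(2)[OF \<omega>] by (simp add: comp_def)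
qed

lemma ball_class_link_chain_0:
  assumes "\<omega> \<in> space (chain_space \<G>)"
  shows "ball_class 0 (link_chain \<omega>) = range (\<lambda>y. (K1 y, y))"
proof -
  let ?x = "\<lambda>j. link_rep (\<omega> j)"
  note l = link_chain_links(1)[OF assms]
  have "ball_class 0 (fst (chain ?x), snd (chain ?x)) = range (\<lambda>y. (K1 y, y))"
    by (intro ball_class_0 sgraph_chain[of ?x, OF l] root_in_chain[of ?x, OF l])
  then show ?thesis by (simp add: link_chain_def)
qed

lemma measurable_shift: "(\<lambda>\<omega>. \<omega> \<circ> Suc) \<in> measurable (chain_space \<G>) (chain_space \<G>)"
  unfolding chain_space_def comp_def
  by (rule measurable_PiM_single') (auto simp: space_PiM PiE_iff intro: measurable_component_singleton)

lemma measurable_head: "(\<lambda>\<omega>. \<omega> 0) \<in> measurable (chain_space \<G>) (count_space (links \<G>))"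
proof -
  have "(\<lambda>\<omega>. \<omega> 0) \<in> measurable (chain_space \<G>) (link_measure \<G>)"
    unfolding chain_space_def by (rule measurable_component_singleton) simp
  then show ?thesis by (simp only: measurable_cong_sets[OF refl sets_link_measure_count])
qed

lemma measurable_ball:
  "(\<lambda>\<omega>. ball_class r (link_chain \<omega>)) \<in> measurable (chain_space \<G>) (count_space UNIV)"
proof (induction r)
  case 0
  have "(\<lambda>\<omega>. ball_class 0 (link_chain \<omega>)) \<in> measurable (chain_space \<G>) (count_space UNIV)
      \<longleftrightarrow> (\<lambda>\<omega>. range (\<lambda>y. (K1 y, y)) :: (nat graph \<times> nat) set) \<in> measurable (chain_space \<G>) (count_space UNIV)"
    by (rule measurable_cong) (rule ball_class_link_chain_0)
  then show ?case by simp
next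
  case (Suc r)
  have "(\<lambda>\<omega>. glue_ball r (\<omega> 0) (ball_class r (link_chain (\<omega> \<circ> Suc)))) \<in> measurable (chain_space \<G>) (count_space UNIV)"
  proof (rule measurable_compose_countable'[where I = "links \<G>" and g = "\<lambda>\<omega>. \<omega> 0"
        and f = "\<lambda>E \<omega>. glue_ball r E (ball_class r (link_chain (\<omega> \<circ> Suc)))"])
    fix E
    have "(\<lambda>\<omega>. ball_class r (link_chain (\<omega> \<circ> Suc))) \<in> measurable (chain_space \<G>) (count_space UNIV)"
      by (rule measurable_compose[OF measurable_shift Suc])
    then show "(\<lambda>\<omega>. glue_ball r E (ball_class r (link_chain (\<omega> \<circ> Suc)))) \<in> measurable (chain_space \<G>) (count_space UNIV)"
      by (rule measurable_compose) simp
  qed (rule measurable_head, rule countable_links)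
  moreover have "(\<lambda>\<omega>. ball_class (Suc r) (link_chain \<omega>)) \<in> measurable (chain_space \<G>) (count_space UNIV)
      \<longleftrightarrow> (\<lambda>\<omega>. glue_ball r (\<omega> 0) (ball_class r (link_chain (\<omega> \<circ> Suc)))) \<in> measurable (chain_space \<G>) (count_space UNIV)"
    by (rule measurable_cong) (rule ball_class_link_chain_Suc)
  ultimately show ?case by simp
qed

definition chain_mean :: "nat \<Rightarrow> ((nat graph \<times> nat) set \<Rightarrow> real) \<Rightarrow> real" where
  "chain_mean r f = (\<integral>\<omega>. f (ball_class r (link_chain \<omega>)) \<partial>chain_space \<G>)"

lemma measurable_ball_fun: "(\<lambda>\<omega>. f (ball_class r (link_chain \<omega>))) \<in> measurable (chain_space \<G>) (borel :: real measure)"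
  by (rule measurable_compose[OF measurable_ball]) simp

lemma integrable_ball_fun:
  assumes "\<And>b. \<bar>f b\<bar> \<le> K"
  shows "integrable (chain_space \<G>) (\<lambda>\<omega>. f (ball_class r (link_chain \<omega>)) :: real)"
proof -
  interpret prob_space "chain_space \<G>" by (rule prob_space_chain)
  show ?thesis by (rule integrable_const_bound[where B = K]) (use assms measurable_ball_fun in auto)
qed

lemma nn_integral_chain_mean:
  assumes "\<And>b. 0 \<le> f b \<and> f b \<le> 1"
  shows "(\<integral>\<^sup>+\<omega>. ennreal (f (ball_class r (link_chain \<omega>))) \<partial>chain_space \<G>) = ennreal (chain_mean r f)"
  unfolding chain_mean_def using assms
  by (intro nn_integral_eq_integral integrable_ball_fun[where K = 1]) auto

lemma chain_mean_nonneg: "(\<And>b. 0 \<le> f b) \<Longrightarrow> 0 \<le> chain_mean r f"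
  unfolding chain_mean_def by (rule integral_nonneg_AE) simp

lemma chain_mean_linear:
  assumes "\<And>b. \<bar>f b\<bar> \<le> K"
  shows "chain_mean r (\<lambda>b. c * f b + d) = c * chain_mean r f + d"
proof -
  interpret prob_space "chain_space \<G>" by (rule prob_space_chain)
  note i = integrable_ball_fun[of f K r, OF assms]
  have "chain_mean r (\<lambda>b. c * f b + d)
      = (\<integral>\<omega>. c * f (ball_class r (link_chain \<omega>)) \<partial>chain_space \<G>) + (\<integral>\<omega>. d \<partial>chain_space \<G>)"
    unfolding chain_mean_def using i by (intro Bochner_Integration.integral_add) auto
  then show ?thesis by (simp add: chain_mean_def prob_space)
qed

text \<open>By independence the chain after the first link has the law of the whole chain.\<close>

lemma chain_mean_Suc_sums:
  assumes f: "\<And>b. 0 \<le> f b \<and> f b \<le> 1"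
  shows "(\<lambda>m. \<Sum>(G, s)\<in>links_on {1..m} 0. \<rho> ^ m / fact m *
      chain_mean r (\<lambda>b. f (glue_ball r (ended_class (G, s, 0)) b))) sums chain_mean (Suc r) f"
proof -
  interpret seq: sequence_space "link_measure \<G>" by (rule sequence_space_links)
  interpret S: prob_space "chain_space \<G>" by (rule prob_space_chain)
  let ?M = "link_measure \<G>" and ?S = "chain_space \<G>"
  define g where "g = (\<lambda>E b. f (glue_ball r E b))"
  have g: "0 \<le> g E b \<and> g E b \<le> 1" for E b using f by (simp add: g_def)
  have iter: "distr (?M \<Otimes>\<^sub>M ?S) ?S (\<lambda>(s, \<omega>). case_nat s \<omega>) = ?S"
    unfolding chain_space_def by (rule seq.PiM_iter)
  have meas: "(\<lambda>(s, \<omega>). case_nat s \<omega>) \<in> measurable (?M \<Otimes>\<^sub>M ?S) ?S"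
    unfolding chain_space_def by measurable
  let ?F = "\<lambda>\<omega>. ennreal (f (ball_class (Suc r) (link_chain \<omega>)))"
  have F: "?F \<in> borel_measurable ?S" using measurable_ball_fun by measurable
  have "ennreal (chain_mean (Suc r) f) = (\<integral>\<^sup>+\<omega>. ?F \<omega> \<partial>?S)"
    by (rule nn_integral_chain_mean[symmetric]) (rule f)
  also have "\<dots> = (\<integral>\<^sup>+\<omega>. ?F \<omega> \<partial>distr (?M \<Otimes>\<^sub>M ?S) ?S (\<lambda>(s, \<omega>). case_nat s \<omega>))"
    unfolding iter ..
  also have "\<dots> = (\<integral>\<^sup>+p. ?F (case p of (s, \<omega>) \<Rightarrow> case_nat s \<omega>) \<partial>(?M \<Otimes>\<^sub>M ?S))"
    using F by (intro nn_integral_distr[OF meas]) simp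
  also have "\<dots> = (\<integral>\<^sup>+E. \<integral>\<^sup>+\<omega>. ?F (case (E, \<omega>) of (s, \<omega>) \<Rightarrow> case_nat s \<omega>) \<partial>?S \<partial>?M)"
    by (rule S.nn_integral_fst[symmetric]) (rule measurable_compose[OF meas F])
  also have "\<dots> = (\<integral>\<^sup>+E. ennreal (chain_mean r (g E)) \<partial>?M)"
  proof (rule nn_integral_cong)
    fix E assume E: "E \<in> space ?M"
    have "(\<integral>\<^sup>+\<omega>. ?F (case (E, \<omega>) of (s, \<omega>) \<Rightarrow> case_nat s \<omega>) \<partial>?S)
        = (\<integral>\<^sup>+\<omega>. ennreal (g E (ball_class r (link_chain \<omega>))) \<partial>?S)"
    proof (rule nn_integral_cong)
      fix \<omega> assume \<omega>: "\<omega> \<in> space ?S"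
      have "case_nat E \<omega> \<in> space ?S"
        using E \<omega> by (auto simp: space_chain_space space_link_measure split: nat.split)
      from ball_class_link_chain_Suc[OF this, of r]
      have "ball_class (Suc r) (link_chain (case_nat E \<omega>)) = glue_ball r E (ball_class r (link_chain \<omega>))"
        by (simp add: comp_def)
      then show "?F (case (E, \<omega>) of (s, \<omega>) \<Rightarrow> case_nat s \<omega>) = ennreal (g E (ball_class r (link_chain \<omega>)))"
        by (simp add: g_def)
    qed
    also have "\<dots> = ennreal (chain_mean r (g E))" by (rule nn_integral_chain_mean) (rule g)
    finally show "(\<integral>\<^sup>+\<omega>. ?F (case (E, \<omega>) of (s, \<omega>) \<Rightarrow> case_nat s \<omega>) \<partial>?S) = ennreal (chain_mean r (g E))" .
  qed
  also have "\<dots> = (\<Sum>m. \<Sum>(G, s)\<in>links_on {1..m} 0. ennreal (\<rho> ^ m / fact m) * ennreal (chain_mean r (g (ended_class (G, s, 0)))))"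
    by (rule nn_integral_link_measure)
  also have "\<dots> = (\<Sum>m. ennreal (\<Sum>(G, s)\<in>links_on {1..m} 0. \<rho> ^ m / fact m * chain_mean r (g (ended_class (G, s, 0)))))"
  proof (rule suminf_cong)
    fix m
    have nn: "0 \<le> chain_mean r (g E)" for E using g by (intro chain_mean_nonneg) simp
    have "(\<Sum>(G, s)\<in>links_on {1..m} 0. ennreal (\<rho> ^ m / fact m) * ennreal (chain_mean r (g (ended_class (G, s, 0)))))
        = (\<Sum>(G, s)\<in>links_on {1..m} 0. ennreal (\<rho> ^ m / fact m * chain_mean r (g (ended_class (G, s, 0)))))"
    proof -
      have "ennreal (\<rho> ^ m / fact m) * ennreal (chain_mean r (g E)) = ennreal (\<rho> ^ m / fact m * chain_mean r (g E))" for E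
        using nn conn_radius_eq(2) by (intro ennreal_mult[symmetric]) auto
      then show ?thesis by (simp only:)
    qed
    also have "\<dots> = ennreal (\<Sum>(G, s)\<in>links_on {1..m} 0. \<rho> ^ m / fact m * chain_mean r (g (ended_class (G, s, 0))))"
      unfolding case_prod_beta using nn conn_radius_eq(2) by (intro sum_ennreal) auto
    finally show "(\<Sum>(G, s)\<in>links_on {1..m} 0. ennreal (\<rho> ^ m / fact m) * ennreal (chain_mean r (g (ended_class (G, s, 0)))))
        = ennreal (\<Sum>(G, s)\<in>links_on {1..m} 0. \<rho> ^ m / fact m * chain_mean r (g (ended_class (G, s, 0))))" .
  qed
  finally have eq: "ennreal (chain_mean (Suc r) f)
      = (\<Sum>m. ennreal (\<Sum>(G, s)\<in>links_on {1..m} 0. \<rho> ^ m / fact m * chain_mean r (g (ended_class (G, s, 0)))))" .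
  define h where "h = (\<lambda>m. \<Sum>(G, s)\<in>links_on {1..m} 0. \<rho> ^ m / fact m * chain_mean r (g (ended_class (G, s, 0))))"
  have "0 \<le> chain_mean r (g E)" for E using g by (intro chain_mean_nonneg) simp
  then have h0: "0 \<le> h m" for m
    unfolding h_def case_prod_beta using conn_radius_eq(2) by (intro sum_nonneg mult_nonneg_nonneg) auto
  have eq': "(\<Sum>m. ennreal (h m)) = ennreal (chain_mean (Suc r) f)" using eq by (simp add: h_def)
  have sm: "summable h" using h0 by (rule summable_suminf_not_top) (simp add: eq')
  have "ennreal (suminf h) = ennreal (chain_mean (Suc r) f)"
    using suminf_ennreal2[OF h0 sm] eq' by simp
  then have "suminf h = chain_mean (Suc r) f"
    using suminf_nonneg[OF sm h0] chain_mean_nonneg[of f] f by simp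
  then have "h sums chain_mean (Suc r) f" using summable_sums[OF sm] by simp
  then show ?thesis by (simp add: h_def g_def)
qed

section \<open>Balls in finite graphs\<close>

text \<open>The second mark enters only as a multiplicity, so this is the expectation for the random rooted graph.\<close>

definition finite_mean :: "nat \<Rightarrow> nat \<Rightarrow> ((nat graph \<times> nat) set \<Rightarrow> real) \<Rightarrow> real" where
  "finite_mean n r f = (\<Sum>(G, x, v)\<in>birooted {1..n}. f (ball_class r (G, x))) / real (card (birooted {1..n}))"

text \<open>The coefficients of \<open>X T'\<close>, the series of connected graphs with two marked vertices.\<close>

definition pointed_coeff :: "nat \<Rightarrow> real" where "pointed_coeff n = real n * fps_nth T n"

lemma card_birooted_coeff: "real (card (birooted {1..n})) = fact n * pointed_coeff n"
  using card_birooted[of "{1..n}"] by (simp add: pointed_coeff_def)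

lemma T_pos: "0 < n \<Longrightarrow> 0 < fps_nth T n"
proof (induction n)
  case (Suc n)
  show ?case
  proof (cases "n = 0")
    case True
    then show ?thesis using T_nth_Suc[of 0] nconn_1 by simp
  next
    case False
    then have "0 < fps_nth \<phi> 1 * fps_nth T n" using Suc.IH \<phi>_coeffs(2) by simp
    then show ?thesis using tree_series_supermult(2)[OF T_equation \<phi>_nonneg, of n] by linarith
  qed
qed simp

lemma pointed_coeff_pos: "0 < n \<Longrightarrow> 0 < pointed_coeff n"
  using T_pos by (simp add: pointed_coeff_def)

text \<open>The factor \<open>n / (n + 1)\<close> between the ratios of \<open>n c\<^sub>n\<close> and of \<open>c\<^sub>n\<close> tends to 1.\<close>

lemma pointed_coeff_ratio: "(\<lambda>n. pointed_coeff (n - m) / pointed_coeff n) \<longlonglongrightarrow> \<rho> ^ m"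
proof -
  have q: "(\<lambda>n. pointed_coeff n / pointed_coeff (Suc n)) \<longlonglongrightarrow> \<rho>"
  proof -
    have "(\<lambda>n. real n / real (Suc n) * (fps_nth T n / fps_nth T (Suc n))) \<longlonglongrightarrow> 1 * \<rho>"
      by (intro tendsto_mult T_ratio LIMSEQ_n_over_Suc_n)
    then show ?thesis by (simp add: pointed_coeff_def)
  qed
  have "(\<lambda>n. pointed_coeff n / pointed_coeff (n + m)) \<longlonglongrightarrow> \<rho> ^ m"
  proof (induction m)
    case 0
    have "eventually (\<lambda>n. pointed_coeff n / pointed_coeff (n + 0) = 1) sequentially"
      using eventually_gt_at_top[of 0]
    proof eventually_elim
      case (elim n)
      then show ?case using pointed_coeff_pos[OF elim] by simp
    qed
    then show ?case by (simp add: tendsto_eventually)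
  next
    case (Suc m)
    have "(\<lambda>n. pointed_coeff n / pointed_coeff (n + m) * (pointed_coeff (n + m) / pointed_coeff (Suc (n + m)))) \<longlonglongrightarrow> \<rho> ^ m * \<rho>"
      using Suc LIMSEQ_ignore_initial_segment[OF q, of m] by (intro tendsto_mult) simp_all
    moreover have "eventually (\<lambda>n. pointed_coeff n / pointed_coeff (n + m) * (pointed_coeff (n + m) / pointed_coeff (Suc (n + m))) = pointed_coeff n / pointed_coeff (n + Suc m)) sequentially"
      using eventually_gt_at_top[of 0]
    proof eventually_elim
      case (elim n)
      then have "pointed_coeff (n + m) \<noteq> 0" using pointed_coeff_pos[of "n + m"] by simp
      then show ?case by simp
    qed
    ultimately have "(\<lambda>n. pointed_coeff n / pointed_coeff (n + Suc m)) \<longlonglongrightarrow> \<rho> ^ m * \<rho>"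
      by (rule Lim_transform_eventually)
    then show ?case by (simp add: mult.commute)
  qed
  then have "(\<lambda>n. (\<lambda>k. pointed_coeff (k - m) / pointed_coeff k) (n + m)) \<longlonglongrightarrow> \<rho> ^ m" by simp
  then show ?thesis by (rule LIMSEQ_offset)
qed

lemma finite_mean_linear:
  assumes n: "0 < n"
  shows "finite_mean n r (\<lambda>b. c * f b + d) = c * finite_mean n r f + d"
proof -
  let ?D = "birooted {1..n}"
  have D: "0 < real (card ?D)" unfolding card_birooted_coeff using pointed_coeff_pos[OF n] by simp
  have "(\<Sum>(G, x, v)\<in>?D. c * f (ball_class r (G, x)) + d)
      = c * (\<Sum>(G, x, v)\<in>?D. f (ball_class r (G, x))) + real (card ?D) * d"
    unfolding case_prod_beta by (simp add: sum.distrib sum_distrib_left)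
  then show ?thesis using D by (simp add: finite_mean_def field_simps)
qed

text \<open>Dropping the graphs whose two marks coincide, the decomposition at the first link bounds the mean from
  below. Since the limiting weights of the links have total mass 1, nothing is lost in the limit.\<close>

lemma finite_mean_Suc_ge:
  assumes f: "\<And>b. 0 \<le> f b" and N: "N \<le> n" "0 < n"
  shows "(\<Sum>m\<le>N. \<Sum>(G, s)\<in>links_on {1..m} 0. (pointed_coeff (n - m) / pointed_coeff n / fact m) *
      finite_mean (n - m) r (\<lambda>b. f (glue_ball r (ended_class (G, s, 0)) b))) \<le> finite_mean n (Suc r) f"
proof -
  define V where "V = {1..n}"
  have V: "finite V" "card V = n" by (simp_all add: V_def)
  define g where "g = (\<lambda>E b. f (glue_ball r E b))"
  define h where "h = (\<lambda>m. \<Sum>(G, s)\<in>links_on {1..m} 0.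
      fact (n - m) * pointed_coeff (n - m) * finite_mean (n - m) r (g (ended_class (G, s, 0))))"
  have fm: "(\<Sum>(G, x, v)\<in>birooted {1..k}. g E (ball_class r (G, x))) = fact k * pointed_coeff k * finite_mean k r (g E)" for k E
  proof (cases "k = 0")
    case True
    then show ?thesis by (simp add: birooted_eq finite_mean_def)
  next
    case False
    then show ?thesis unfolding finite_mean_def card_birooted_coeff using pointed_coeff_pos[of k] by simp
  qed
  have h0: "0 \<le> h m" for m
    unfolding h_def fm[symmetric] case_prod_beta using f by (intro sum_nonneg) (simp add: g_def)
  have "(\<Sum>U\<in>Pow V. h (card U))
      = (\<Sum>U\<in>Pow V. \<Sum>(G2, t, v)\<in>birooted (V - U). \<Sum>(G1, s)\<in>links_on U t. f (ball_class (Suc r) (gunion G1 G2, s)))"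
  proof (rule sum.cong)
    fix U assume "U \<in> Pow V"
    then have U: "finite U" "finite (V - U)" "card (V - U) = n - card U"
      using V finite_subset[of U V] by (auto simp: card_Diff_subset)
    have "(\<Sum>(G2, t, v)\<in>birooted (V - U). \<Sum>(G1, s)\<in>links_on U t. f (ball_class (Suc r) (gunion G1 G2, s)))
        = (\<Sum>(G2, t, v)\<in>birooted (V - U). \<Sum>(G1, s)\<in>links_on {1..card U} 0.
            g (ended_class (G1, s, 0)) (ball_class r (G2, t)))"
    proof (intro sum.cong refl)
      fix p assume "p \<in> birooted (V - U)"
      then obtain G2 t v where p: "p = (G2, t, v)" "G2 \<in> conn_class \<G>" "verts G2 = V - U" "t \<in> V - U"
        by (auto simp: birooted_def)
      have "(\<Sum>(G1, s)\<in>links_on U t. f (ball_class (Suc r) (gunion G1 G2, s)))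
          = (\<Sum>(G1, s)\<in>links_on U t. g (ended_class (G1, s, t)) (ball_class r (G2, t)))"
      proof (intro sum.cong refl)
        fix z assume "z \<in> links_on U t"
        then obtain G1 s where z: "z = (G1, s)" "is_link \<G> (G1, s, t)" "verts G1 = insert t U"
          by (auto simp: links_on_def)
        have "glue_ball r (ended_class (G1, s, t)) (ball_class r (G2, t)) = ball_class (Suc r) (gunion G1 G2, s)"
          using conn_classD(3)[OF is_linkD(1)[OF z(2)]] conn_classD(3)[OF p(2)] is_linkD(2,4)[OF z(2)] z(3) p(3,4)
          by (intro glue_ball_eq) auto
        then show "(case z of (G1, s) \<Rightarrow> f (ball_class (Suc r) (gunion G1 G2, s)))
            = (case z of (G1, s) \<Rightarrow> g (ended_class (G1, s, t)) (ball_class r (G2, t)))"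
          by (simp add: z(1) g_def)
      qed
      also have "\<dots> = (\<Sum>(G1, s)\<in>links_on {1..card U} 0. g (ended_class (G1, s, 0)) (ball_class r (G2, t)))"
        using U(1) p(4) by (intro sum_links_relabel[where h = "\<lambda>E. g E (ball_class r (G2, t))"]) auto
      finally show "(case p of (G2, t, v) \<Rightarrow> \<Sum>(G1, s)\<in>links_on U t. f (ball_class (Suc r) (gunion G1 G2, s)))
          = (case p of (G2, t, v) \<Rightarrow> \<Sum>(G1, s)\<in>links_on {1..card U} 0. g (ended_class (G1, s, 0)) (ball_class r (G2, t)))"
        by (simp add: p(1))
    qed
    also have "\<dots> = (\<Sum>(G1, s)\<in>links_on {1..card U} 0. \<Sum>(G2, t, v)\<in>birooted (V - U).
            g (ended_class (G1, s, 0)) (ball_class r (G2, t)))"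
      unfolding case_prod_beta by (rule sum.swap)
    also have "\<dots> = h (card U)"
      unfolding h_def sum_birooted_relabel[OF U(2)] U(3) fm ..
    finally show "h (card U) = (\<Sum>(G2, t, v)\<in>birooted (V - U). \<Sum>(G1, s)\<in>links_on U t. f (ball_class (Suc r) (gunion G1 G2, s)))" ..
  qed simp
  also have "\<dots> = (\<Sum>(G, x, v) \<in> {(G, x, v) \<in> birooted V. x \<noteq> v}. f (ball_class (Suc r) (G, x)))"
    by (rule sum_birooted_glue[OF V(1), symmetric])
  also have "\<dots> \<le> (\<Sum>(G, x, v) \<in> birooted V. f (ball_class (Suc r) (G, x)))"
    unfolding case_prod_beta using f finite_birooted[OF V(1)] by (intro sum_mono2) auto
  also have "\<dots> = fact n * pointed_coeff n * finite_mean n (Suc r) f"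
    unfolding finite_mean_def card_birooted_coeff V_def using pointed_coeff_pos[OF N(2)] by simp
  finally have le: "(\<Sum>m\<le>n. real (n choose m) * h m) \<le> fact n * pointed_coeff n * finite_mean n (Suc r) f"
    using sum_Pow_card[OF V(1), of h] V(2) by simp
  \<comment> \<open>link sizes above \<open>N\<close> are dropped, so that only finitely many limits are needed\<close>
  have "(\<Sum>m\<le>N. real (n choose m) * h m) \<le> (\<Sum>m\<le>n. real (n choose m) * h m)"
    using N h0 by (intro sum_mono2) auto
  also note le
  finally have "(\<Sum>m\<le>N. real (n choose m) * h m) / (fact n * pointed_coeff n) \<le> finite_mean n (Suc r) f"
    using pointed_coeff_pos[OF N(2)] by (simp add: divide_le_eq mult.commute)
  moreover have "(\<Sum>m\<le>N. real (n choose m) * h m) / (fact n * pointed_coeff n)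
      = (\<Sum>m\<le>N. \<Sum>(G, s)\<in>links_on {1..m} 0. (pointed_coeff (n - m) / pointed_coeff n / fact m) * finite_mean (n - m) r (g (ended_class (G, s, 0))))"
    unfolding sum_divide_distrib
  proof (rule sum.cong)
    fix m assume "m \<in> {..N}"
    then have "real (n choose m) = fact n / (fact m * fact (n - m))" using N(1) by (simp add: binomial_fact)
    then have "real (n choose m) * (fact (n - m) * pointed_coeff (n - m) * y) / (fact n * pointed_coeff n) = (pointed_coeff (n - m) / pointed_coeff n / fact m) * y" for y
      by simp
    then show "real (n choose m) * h m / (fact n * pointed_coeff n)
        = (\<Sum>(G, s)\<in>links_on {1..m} 0. (pointed_coeff (n - m) / pointed_coeff n / fact m) * finite_mean (n - m) r (g (ended_class (G, s, 0))))"
      unfolding h_def sum_distrib_left sum_divide_distrib case_prod_beta by simp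
  qed simp
  ultimately show ?thesis by (simp add: g_def)
qed

text \<open>The lower bound passes to the limit for each finite set of link sizes. Applied to \<open>1 - f\<close> it also bounds the means of \<open>f\<close> from above.\<close>

lemma finite_mean_tendsto:
  assumes "\<And>b. 0 \<le> f b \<and> f b \<le> 1"
  shows "(\<lambda>n. finite_mean n r f) \<longlonglongrightarrow> chain_mean r f"
  using assms
proof (induction r arbitrary: f)
  case 0
  let ?c = "range (\<lambda>y. (K1 y, y)) :: (nat graph \<times> nat) set"
  interpret S: prob_space "chain_space \<G>" by (rule prob_space_chain)
  have "chain_mean 0 f = (\<integral>\<omega>. f ?c \<partial>chain_space \<G>)"
    unfolding chain_mean_def by (intro Bochner_Integration.integral_cong) (auto simp: ball_class_link_chain_0)
  also have "\<dots> = f ?c" by (simp add: S.prob_space)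
  finally have c: "chain_mean 0 f = f ?c" .
  have "eventually (\<lambda>n. finite_mean n 0 f = f ?c) sequentially"
    using eventually_gt_at_top[of 0]
  proof eventually_elim
    case (elim n)
    have "(\<Sum>(G, x, v)\<in>birooted {1..n}. f (ball_class 0 (G, x))) = (\<Sum>p\<in>birooted {1..n}. f ?c)"
    proof (intro sum.cong refl)
      fix p assume "p \<in> birooted {1..n}"
      then obtain G x v where p: "p = (G, x, v)" "G \<in> conn_class \<G>" "x \<in> verts G"
        by (auto simp: birooted_def)
      then show "(case p of (G, x, v) \<Rightarrow> f (ball_class 0 (G, x))) = f ?c"
        using ball_class_0[OF conn_classD(3)[OF p(2)] p(3)] by simp
    qed
    moreover have "0 < real (card (birooted {1..n}))" unfolding card_birooted_coeff using pointed_coeff_pos[OF elim] by simp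
    ultimately show ?case by (simp add: finite_mean_def)
  qed
  then show ?case unfolding c by (rule tendsto_eventually)
next
  case (Suc r)
  have lower: "eventually (\<lambda>n. y < finite_mean n (Suc r) f) sequentially"
    if f: "\<And>b. 0 \<le> f b \<and> f b \<le> 1" and y: "y < chain_mean (Suc r) f" for f y
  proof -
    let ?g = "\<lambda>G s b. f (glue_ball r (ended_class (G, s, 0)) b)"
    have "(\<lambda>N. \<Sum>m\<le>N. \<Sum>(G, s)\<in>links_on {1..m} 0. \<rho> ^ m / fact m * chain_mean r (?g G s)) \<longlonglongrightarrow> chain_mean (Suc r) f"
      using chain_mean_Suc_sums[OF f] by (simp add: sums_def_le)
    then have "eventually (\<lambda>N. y < (\<Sum>m\<le>N. \<Sum>(G, s)\<in>links_on {1..m} 0. \<rho> ^ m / fact m * chain_mean r (?g G s))) sequentially"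
      using y by (rule order_tendstoD(1))
    then obtain N where N: "y < (\<Sum>m\<le>N. \<Sum>(G, s)\<in>links_on {1..m} 0. \<rho> ^ m / fact m * chain_mean r (?g G s))"
      by (auto simp: eventually_sequentially)
    have "(\<lambda>n. \<Sum>m\<le>N. \<Sum>(G, s)\<in>links_on {1..m} 0. (pointed_coeff (n - m) / pointed_coeff n / fact m) * finite_mean (n - m) r (?g G s))
        \<longlonglongrightarrow> (\<Sum>m\<le>N. \<Sum>(G, s)\<in>links_on {1..m} 0. \<rho> ^ m / fact m * chain_mean r (?g G s))"
      unfolding case_prod_beta
    proof (intro tendsto_sum tendsto_mult tendsto_divide pointed_coeff_ratio tendsto_const)
      fix m and z :: "nat graph \<times> nat"
      have "(\<lambda>n. finite_mean n r (?g (fst z) (snd z))) \<longlonglongrightarrow> chain_mean r (?g (fst z) (snd z))"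
        using f by (intro Suc.IH) simp
      then show "(\<lambda>n. finite_mean (n - m) r (?g (fst z) (snd z))) \<longlonglongrightarrow> chain_mean r (?g (fst z) (snd z))"
        by (rule filterlim_compose) (rule filterlim_minus_const_nat_at_top)
    qed simp
    then have "eventually (\<lambda>n. y < (\<Sum>m\<le>N. \<Sum>(G, s)\<in>links_on {1..m} 0.
        (pointed_coeff (n - m) / pointed_coeff n / fact m) * finite_mean (n - m) r (?g G s))) sequentially"
      using N by (rule order_tendstoD(1))
    then show ?thesis
      using eventually_ge_at_top[of N] eventually_gt_at_top[of 0]
    proof eventually_elim
      case (elim n)
      have "0 \<le> f b" for b using f by simp
      from finite_mean_Suc_ge[of f N n r, OF this elim(2,3)] show ?case using elim(1) by linarith
    qed
  qed
  show ?case
  proof (rule order_tendstoI)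
    fix y assume "y < chain_mean (Suc r) f"
    then show "eventually (\<lambda>n. y < finite_mean n (Suc r) f) sequentially" by (rule lower[OF Suc.prems])
  next
    fix y assume y: "chain_mean (Suc r) f < y"
    have "chain_mean (Suc r) (\<lambda>b. - 1 * f b + 1) = - 1 * chain_mean (Suc r) f + 1"
      using Suc.prems by (intro chain_mean_linear[of f 1]) auto
    then have "1 - y < chain_mean (Suc r) (\<lambda>b. - 1 * f b + 1)" using y by simp
    then have "eventually (\<lambda>n. 1 - y < finite_mean n (Suc r) (\<lambda>b. - 1 * f b + 1)) sequentially"
      using Suc.prems by (intro lower) auto
    then show "eventually (\<lambda>n. finite_mean n (Suc r) f < y) sequentially"
      using eventually_gt_at_top[of 0]
    proof eventually_elim
      case (elim n)
      then show ?case using finite_mean_linear[OF elim(2), of "Suc r" "- 1" f 1] by simp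
    qed
  qed
qed

lemma finite_mean_tendsto_bounded:
  assumes f: "\<And>b. \<bar>f b\<bar> \<le> K"
  shows "(\<lambda>n. finite_mean n r f) \<longlonglongrightarrow> chain_mean r f"
proof -
  define C where "C = max K 1"
  have C: "0 < C" "\<bar>f b\<bar> \<le> C" for b using f[of b] by (auto simp: C_def)
  \<comment> \<open>rescaling into \<open>[0, 1]\<close>\<close>
  let ?g = "\<lambda>b. 1 / (2 * C) * f b + 1 / 2"
  have g: "0 \<le> ?g b \<and> ?g b \<le> 1" for b
  proof -
    have "- C \<le> f b" "f b \<le> C" using C(2)[of b] by auto
    then show ?thesis using C(1) by (auto simp: field_simps)
  qed

  have 1: "(\<lambda>n. 2 * C * finite_mean n r ?g + (- C)) \<longlonglongrightarrow> 2 * C * chain_mean r ?g + (- C)"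
    by (intro tendsto_add tendsto_mult tendsto_const finite_mean_tendsto g)
  have 2: "2 * C * chain_mean r ?g + (- C) = chain_mean r f"
    using C(1) by (subst chain_mean_linear[of f C, OF C(2)]) (simp add: field_simps)
  have 3: "eventually (\<lambda>n. 2 * C * finite_mean n r ?g + (- C) = finite_mean n r f) sequentially"
    using eventually_gt_at_top[of 0]
  proof eventually_elim
    case (elim n)
    show ?case using C(1) by (subst finite_mean_linear[OF elim]) (simp add: field_simps)
  qed
  show ?thesis using Lim_transform_eventually[OF 1 3] unfolding 2 .
qed

lemma integral_random_rooted:
  assumes n: "0 < n"
  shows "(\<integral>b. f b \<partial>measure_pmf (map_pmf (ball_class r) (random_rooted \<G> n))) = finite_mean n r f"
proof -
  let ?A = "conn_on {1..n} \<times> {1..n}"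
  have A: "{(G, x). G \<in> conn_class \<G> \<and> verts G = {1..n} \<and> x \<in> verts G} = ?A"
    by (auto simp: conn_on_def)
  have fin: "finite ?A" by (intro finite_cartesian_product finite_conn_on) auto
  have "0 < real (card (birooted {1..n}))" unfolding card_birooted_coeff using pointed_coeff_pos[OF n] by simp
  then have c: "0 < card (conn_on {1..n})"
    by (cases "card (conn_on {1..n})") (simp_all add: birooted_eq card_cartesian_product)
  then have ne: "?A \<noteq> {}" using n by auto
  have "(\<integral>b. f b \<partial>measure_pmf (map_pmf (ball_class r) (random_rooted \<G> n)))
      = (\<Sum>p\<in>?A. f (ball_class r p)) / real (card ?A)"
    unfolding random_rooted_def A integral_map_pmf by (rule integral_pmf_of_set[OF ne fin])
  also have "\<dots> = finite_mean n r f"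
  proof -
    have "(\<Sum>(G, x, v)\<in>birooted {1..n}. f (ball_class r (G, x))) = (\<Sum>G\<in>conn_on {1..n}. \<Sum>x\<in>{1..n}. \<Sum>v\<in>{1..n}. f (ball_class r (G, x)))"
      unfolding birooted_eq by (simp only: sum.cartesian_product)
    also have "\<dots> = real n * (\<Sum>G\<in>conn_on {1..n}. \<Sum>x\<in>{1..n}. f (ball_class r (G, x)))"
      by (simp add: sum_distrib_left)
    also have "(\<Sum>G\<in>conn_on {1..n}. \<Sum>x\<in>{1..n}. f (ball_class r (G, x))) = (\<Sum>p\<in>?A. f (ball_class r p))"
      by (simp add: sum.cartesian_product case_prod_beta)
    finally show ?thesis
      using n c by (simp add: finite_mean_def birooted_eq card_cartesian_product)
  qed
  finally show ?thesis .
qed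

lemma converges_to_chain: "converges_weakly (random_rooted \<G>) (chain_space \<G>) link_chain"
  unfolding converges_weakly_def
proof (intro conjI allI)
  show "random_rooted_graph (chain_space \<G>) link_chain"
    unfolding random_rooted_graph_def
  proof (intro conjI ballI allI)
    show "prob_space (chain_space \<G>)" by (rule prob_space_chain)
    show "(\<lambda>\<omega>. ball_class r (link_chain \<omega>)) \<in> measurable (chain_space \<G>) (count_space UNIV)" for r
      by (rule measurable_ball)
    fix \<omega> assume \<omega>: "\<omega> \<in> space (chain_space \<G>)"
    let ?x = "\<lambda>j. link_rep (\<omega> j)"
    note l = link_chain_links(1)[OF \<omega>]
    show "case link_chain \<omega> of (G, x) \<Rightarrow> sgraph G \<and> locally_finite G \<and> x \<in> verts G"
      unfolding link_chain_def case_prod_beta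
      by (intro conjI sgraph_chain[of ?x, OF l] locally_finite_chain[of ?x, OF l] root_in_chain[of ?x, OF l])
  qed
  fix r
  show "discrete_weak_conv (\<lambda>n. measure_pmf (map_pmf (ball_class r) (random_rooted \<G> n)))
      (distr (chain_space \<G>) (count_space UNIV) (\<lambda>\<omega>. ball_class r (link_chain \<omega>)))"
    unfolding discrete_weak_conv_def
  proof (intro allI impI)
    fix f :: "(nat graph \<times> nat) set \<Rightarrow> real" assume "bounded (range f)"
    then obtain K where K: "\<And>b. \<bar>f b\<bar> \<le> K" by (auto simp: bounded_iff)
    have "integral\<^sup>L (distr (chain_space \<G>) (count_space UNIV) (\<lambda>\<omega>. ball_class r (link_chain \<omega>))) f = chain_mean r f"
      unfolding chain_mean_def by (rule integral_distr[OF measurable_ball]) simp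
    moreover have "eventually (\<lambda>n. finite_mean n r f
        = integral\<^sup>L (measure_pmf (map_pmf (ball_class r) (random_rooted \<G> n))) f) sequentially"
      using eventually_gt_at_top[of 0] by eventually_elim (simp only: integral_random_rooted)
    ultimately show "(\<lambda>n. integral\<^sup>L (measure_pmf (map_pmf (ball_class r) (random_rooted \<G> n))) f)
        \<longlonglongrightarrow> integral\<^sup>L (distr (chain_space \<G>) (count_space UNIV) (\<lambda>\<omega>. ball_class r (link_chain \<omega>))) f"
      using Lim_transform_eventually[OF finite_mean_tendsto_bounded[OF K]] by simp
  qed
qed

end

theorem theorem3p2:
  fixes \<G> :: "nat graph set"
  assumes "block_stable \<G>"
    and "subcritical \<G>"
  shows "prob_space (link_measure \<G>)
    \<and> converges_weakly (random_rooted \<G>) (chain_space \<G>) link_chain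
    \<and> (\<forall>\<omega>\<in>space (chain_space \<G>). infinite (verts (fst (link_chain \<omega>))))"
proof -
  interpret subcritical_class \<G> by unfold_locales (rule assms)+
  have "infinite (verts (fst (link_chain \<omega>)))" if "\<omega> \<in> space (chain_space \<G>)" for \<omega>
    unfolding link_chain_def by (rule infinite_chain) (rule link_chain_links(1)[OF that])
  then show ?thesis using prob_space_link_measure converges_to_chain by blast
qed

end
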